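(* Let $G$ be a discrete group and let $X$ be a G-projective space. Then $C(X)$, with the induced $G$-action, is G-injective in each of the following categories: (1) the category of G-operator spaces and completely contractive G-equivariant linear maps; (2) the category of G-operator systems and completely positive G-equivariant maps; (3) the category of G-Banach spaces and contractive G-equivariant linear maps.
   Context: $G$ is a discrete group. A G-space is a compact Hausdorff space $X$ together with a homomorphism from $G$ into the group of homeomorphisms of $X$; the action is written $g\cdot x$. A G-map between G-spaces is a continuous map $f$ with $f(g\cdot x)=g\cdot f(x)$ for all $g\in G$ and all $x$. A G-space $P$ is G-projective if for all G-spaces $X,Y$ and G-maps $h:Y\to X$, $f:P\to X$ with $h$ onto, there is a G-map $r:P\to Y$ with $h\circ r=f$. For a G-space $X$, $G$ acts on $C(X)$ by $(g\cdot u)(x)=u(g^{-1}\cdot x)$. A G-operator space (resp. G-operator system, G-Banach space) is an operator space (resp. operator system, Banach space) with an action of $G$ by completely isometric linear isomorphisms (resp. unital complete order isomorphisms, isometric linear isomorphisms). An object $V$ is G-injective in one of these categories if for every G-equivariant inclusion of objects $E\subseteq F$ (completely isometric, resp. unital complete order, resp. isometric inclusion) and every morphism $\varphi:E\to V$ there is a morphism $\psi:F\to V$ extending $\varphi$. *)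

theory Defs
  imports
    "HOL-Analysis.Analysis"
    "HOL-Algebra.Group_Action"
    "HOL-Library.Function_Algebras"
    "Jordan_Normal_Form.Schur_Decomposition"
begin

section \<open>G-spaces and G-projectivity\<close>

definition G_space :: "('g, 'm) monoid_scheme \<Rightarrow> 'x topology \<Rightarrow> ('g \<Rightarrow> 'x \<Rightarrow> 'x) \<Rightarrow> bool" where
  "G_space G X \<alpha> \<longleftrightarrow>
     compact_space X \<and> Hausdorff_space X \<and>
     group_action G (topspace X) \<alpha> \<and>
     (\<forall>g\<in>carrier G. homeomorphic_map X X (\<alpha> g))"

definition equivariant_on ::
    "('g, 'm) monoid_scheme \<Rightarrow> 'a set \<Rightarrow> ('g \<Rightarrow> 'a \<Rightarrow> 'a) \<Rightarrow> ('g \<Rightarrow> 'b \<Rightarrow> 'b) \<Rightarrow> ('a \<Rightarrow> 'b) \<Rightarrow> bool" where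
  "equivariant_on G S \<alpha> \<beta> f \<longleftrightarrow> (\<forall>g\<in>carrier G. \<forall>x\<in>S. f (\<alpha> g x) = \<beta> g (f x))"

definition G_map ::
    "('g, 'm) monoid_scheme \<Rightarrow> 'x topology \<Rightarrow> ('g \<Rightarrow> 'x \<Rightarrow> 'x) \<Rightarrow>
     'y topology \<Rightarrow> ('g \<Rightarrow> 'y \<Rightarrow> 'y) \<Rightarrow> ('x \<Rightarrow> 'y) \<Rightarrow> bool" where
  "G_map G X \<alpha> Y \<beta> f \<longleftrightarrow> continuous_map X Y f \<and> equivariant_on G (topspace X) \<alpha> \<beta> f"

text \<open>
  HOL cannot quantify over all types inside a formula, so the test spaces \<open>X\<close> and \<open>Y\<close> range over
  all G-spaces whose points form a subset of a given type \<open>'u\<close>.  For every \<open>'u\<close> this is implied by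
  projectivity against all G-spaces, so assuming it is assuming less.  Nothing is lost when \<open>'u\<close> is
  \<open>('g \<times> 'x) set set\<close>: this type has room for a copy of \<open>P\<close> and for the Stone-Cech
  compactification (the ultrafilters) of the discrete G-set \<open>G \<times> P\<close>, and lifting the identity of
  \<open>P\<close> along the canonical surjection of the latter onto \<open>P\<close> exhibits \<open>P\<close> as a retract of a
  G-projective space.
\<close>
definition G_projective ::
    "'u itself \<Rightarrow> ('g, 'm) monoid_scheme \<Rightarrow> 'x topology \<Rightarrow> ('g \<Rightarrow> 'x \<Rightarrow> 'x) \<Rightarrow> bool" where
  "G_projective tu G P \<pi> \<longleftrightarrow>
     G_space G P \<pi> \<and>
     (\<forall>(X :: 'u topology) \<alpha> (Y :: 'u topology) \<beta> h f.
        G_space G X \<alpha> \<longrightarrow> G_space G Y \<beta> \<longrightarrow>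
        G_map G Y \<beta> X \<alpha> h \<longrightarrow> h ` topspace Y = topspace X \<longrightarrow>
        G_map G P \<pi> X \<alpha> f \<longrightarrow>
        (\<exists>r. G_map G P \<pi> Y \<beta> r \<and> (\<forall>p\<in>topspace P. h (r p) = f p)))"


section \<open>Complex vector spaces and matrices over them\<close>

text \<open>
  A complex vector space is a subspace \<open>carrier V\<close> of an ambient one; addition is that of the
  ambient type.  Linear maps and actions are constrained on the carrier only.
\<close>
record 'a cspace = "'a partial_object" +
  cscale :: "complex \<Rightarrow> 'a \<Rightarrow> 'a"

definition is_cspace :: "('a::ab_group_add, 'm) cspace_scheme \<Rightarrow> bool" where
  "is_cspace V \<longleftrightarrow> vector_space (cscale V) \<and> module.subspace (cscale V) (carrier V)"

definition linear_map ::
    "('a::ab_group_add, 'm) cspace_scheme \<Rightarrow> ('b::ab_group_add, 'n) cspace_scheme \<Rightarrow>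
     ('a \<Rightarrow> 'b) \<Rightarrow> bool" where
  "linear_map V W \<phi> \<longleftrightarrow>
     \<phi> \<in> carrier V \<rightarrow> carrier W \<and>
     (\<forall>x\<in>carrier V. \<forall>y\<in>carrier V. \<phi> (x + y) = \<phi> x + \<phi> y) \<and>
     (\<forall>c. \<forall>x\<in>carrier V. \<phi> (cscale V c x) = cscale W c (\<phi> x))"

definition mats :: "('a, 'm) cspace_scheme \<Rightarrow> nat \<Rightarrow> 'a mat set" where
  "mats V n = {x \<in> carrier_mat n n. elements_mat x \<subseteq> carrier V}"

text \<open>The product \<open>a x b\<close> of a matrix over a vector space with two scalar matrices.\<close>
definition sandwich ::
    "('a::ab_group_add, 'm) cspace_scheme \<Rightarrow> complex mat \<Rightarrow> 'a mat \<Rightarrow> complex mat \<Rightarrow> 'a mat" where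
  "sandwich V a x b =
     Matrix.mat (dim_row a) (dim_col b)
       (\<lambda>(i, j). \<Sum>k<dim_row x. \<Sum>l<dim_col x. cscale V (a $$ (i, k) * b $$ (l, j)) (x $$ (k, l)))"

definition direct_sum_mat :: "'a::zero mat \<Rightarrow> 'a mat \<Rightarrow> 'a mat" where
  "direct_sum_mat x y =
     four_block_mat x (0\<^sub>m (dim_row x) (dim_col y)) (0\<^sub>m (dim_row y) (dim_col x)) y"

definition l2norm :: "complex Matrix.vec \<Rightarrow> real" where
  "l2norm v = sqrt (\<Sum>i<dim_vec v. (cmod (vec_index v i))\<^sup>2)"

text \<open>The norm of a matrix as an operator between the Hilbert spaces \<open>\<complex>\<^sup>m\<close> and \<open>\<complex>\<^sup>n\<close>.\<close>
definition opnorm :: "complex mat \<Rightarrow> real" where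
  "opnorm a = Sup {l2norm (a *\<^sub>v v) | v. v \<in> carrier_vec (dim_col a) \<and> l2norm v \<le> 1}"

text \<open>
  Here \<open>0 \<le> z\<close> for complex \<open>z\<close> says that \<open>z\<close> is real and nonnegative, so that these matrices
  are in particular Hermitian.
\<close>
definition psd_mat :: "complex mat \<Rightarrow> bool" where
  "psd_mat a \<longleftrightarrow> square_mat a \<and> (\<forall>v\<in>carrier_vec (dim_row a). 0 \<le> (a *\<^sub>v v) \<bullet>c v)"


section \<open>Operator spaces\<close>

text \<open>
  Operator spaces are taken in their abstract form (Effros-Ruan): \<open>mnorm V\<close> restricts to a norm on
  each \<open>M\<^sub>n(V)\<close>, and these satisfy Ruan's axioms.  Completeness is not required.
\<close>
record 'a opspace = "'a cspace" +
  mnorm :: "'a mat \<Rightarrow> real"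

definition operator_space :: "'a::ab_group_add opspace \<Rightarrow> bool" where
  "operator_space V \<longleftrightarrow>
     is_cspace V \<and>
     (\<forall>n. \<forall>x\<in>mats V n.
        0 \<le> mnorm V x \<and>
        (mnorm V x = 0 \<longleftrightarrow> x = 0\<^sub>m n n) \<and>
        (\<forall>y\<in>mats V n. mnorm V (x + y) \<le> mnorm V x + mnorm V y) \<and>
        (\<forall>c. mnorm V (map_mat (cscale V c) x) = cmod c * mnorm V x)) \<and>
     (\<forall>m n. \<forall>x\<in>mats V m. \<forall>y\<in>mats V n.
        mnorm V (direct_sum_mat x y) = max (mnorm V x) (mnorm V y)) \<and>
     (\<forall>m n. \<forall>x\<in>mats V m. \<forall>a\<in>carrier_mat n m. \<forall>b\<in>carrier_mat m n.
        mnorm V (sandwich V a x b) \<le> opnorm a * mnorm V x * opnorm b)"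

definition completely_contractive ::
    "'a::ab_group_add opspace \<Rightarrow> 'b::ab_group_add opspace \<Rightarrow> ('a \<Rightarrow> 'b) \<Rightarrow> bool" where
  "completely_contractive V W \<phi> \<longleftrightarrow>
     linear_map V W \<phi> \<and> (\<forall>n. \<forall>x\<in>mats V n. mnorm W (map_mat \<phi> x) \<le> mnorm V x)"

definition completely_isometric ::
    "'a::ab_group_add opspace \<Rightarrow> 'b::ab_group_add opspace \<Rightarrow> ('a \<Rightarrow> 'b) \<Rightarrow> bool" where
  "completely_isometric V W \<phi> \<longleftrightarrow>
     linear_map V W \<phi> \<and> (\<forall>n. \<forall>x\<in>mats V n. mnorm W (map_mat \<phi> x) = mnorm V x)"

text \<open>Bijectivity of each \<open>\<beta> g\<close> on the carrier is part of \<^locale>\<open>group_action\<close>.\<close>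
definition G_operator_space ::
    "('g, 'm) monoid_scheme \<Rightarrow> 'a::ab_group_add opspace \<Rightarrow> ('g \<Rightarrow> 'a \<Rightarrow> 'a) \<Rightarrow> bool" where
  "G_operator_space G V \<beta> \<longleftrightarrow>
     operator_space V \<and> group_action G (carrier V) \<beta> \<and>
     (\<forall>g\<in>carrier G. completely_isometric V V (\<beta> g))"

text \<open>
  In this and the two analogous definitions below, the objects \<open>E\<close> and \<open>F\<close> live in the types
  \<open>'e\<close> and \<open>'f\<close>, to be left as free type variables (hence universally quantified) in theorems.
  The inclusion of \<open>E\<close> into \<open>F\<close> is an embedding \<open>\<iota>\<close> of the kind appropriate to the category.
\<close>
definition G_injective_operator_space ::
    "'e::ab_group_add itself \<Rightarrow> 'f::ab_group_add itself \<Rightarrow> ('g, 'm) monoid_scheme \<Rightarrow>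
     'a::ab_group_add opspace \<Rightarrow> ('g \<Rightarrow> 'a \<Rightarrow> 'a) \<Rightarrow> bool" where
  "G_injective_operator_space te tf G V \<beta> \<longleftrightarrow>
     G_operator_space G V \<beta> \<and>
     (\<forall>(E :: 'e opspace) \<gamma> (F :: 'f opspace) \<delta> \<iota> \<phi>.
        G_operator_space G E \<gamma> \<longrightarrow> G_operator_space G F \<delta> \<longrightarrow>
        completely_isometric E F \<iota> \<longrightarrow> equivariant_on G (carrier E) \<gamma> \<delta> \<iota> \<longrightarrow>
        completely_contractive E V \<phi> \<longrightarrow> equivariant_on G (carrier E) \<gamma> \<beta> \<phi> \<longrightarrow>
        (\<exists>\<psi>. completely_contractive F V \<psi> \<and> equivariant_on G (carrier F) \<delta> \<beta> \<psi> \<and>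
             (\<forall>x\<in>carrier E. \<psi> (\<iota> x) = \<phi> x)))"


section \<open>Operator systems\<close>

text \<open>
  Operator systems are taken in their abstract form (Choi-Effros): matrix-ordered complex
  \<open>*\<close>-vector spaces with an Archimedean matrix order unit.  The set \<open>mcone V\<close> collects the positive
  matrices of all sizes; the cone in \<open>M\<^sub>n(V)\<close> is \<open>mcone V \<inter> mats V n\<close>.
\<close>
record 'a opsystem = "'a cspace" +
  invol :: "'a \<Rightarrow> 'a"
  mcone :: "'a mat set"
  ounit :: 'a

definition mat_star :: "'a opsystem \<Rightarrow> 'a mat \<Rightarrow> 'a mat" where
  "mat_star V x = transpose_mat (map_mat (invol V) x)"

text \<open>The diagonal matrix \<open>diag(r e, \<dots>, r e)\<close>, where \<open>e\<close> is the unit.\<close>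
definition unit_mat :: "'a::ab_group_add opsystem \<Rightarrow> real \<Rightarrow> nat \<Rightarrow> 'a mat" where
  "unit_mat V r n =
     Matrix.mat n n (\<lambda>(i, j). if i = j then cscale V (complex_of_real r) (ounit V) else 0)"

definition star_space :: "'a::ab_group_add opsystem \<Rightarrow> bool" where
  "star_space V \<longleftrightarrow>
     is_cspace V \<and>
     (\<forall>x\<in>carrier V. invol V x \<in> carrier V \<and> invol V (invol V x) = x) \<and>
     (\<forall>x\<in>carrier V. \<forall>y\<in>carrier V. invol V (x + y) = invol V x + invol V y) \<and>
     (\<forall>c. \<forall>x\<in>carrier V. invol V (cscale V c x) = cscale V (cnj c) (invol V x))"

definition matrix_ordered :: "'a::ab_group_add opsystem \<Rightarrow> bool" where
  "matrix_ordered V \<longleftrightarrow>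
     star_space V \<and>
     mcone V \<subseteq> (\<Union>n. mats V n) \<and>
     (\<forall>x\<in>mcone V. mat_star V x = x) \<and>
     (\<forall>n. 0\<^sub>m n n \<in> mcone V) \<and>
     (\<forall>n. \<forall>x\<in>mcone V \<inter> mats V n. \<forall>y\<in>mcone V \<inter> mats V n. x + y \<in> mcone V) \<and>
     (\<forall>x\<in>mcone V. \<forall>r\<ge>0. map_mat (cscale V (complex_of_real r)) x \<in> mcone V) \<and>
     (\<forall>n. \<forall>x\<in>mcone V \<inter> mats V n. - x \<in> mcone V \<longrightarrow> x = 0\<^sub>m n n) \<and>
     (\<forall>m n. \<forall>x\<in>mcone V \<inter> mats V m. \<forall>a\<in>carrier_mat m n.
        sandwich V (mat_adjoint a) x a \<in> mcone V)"

definition operator_system :: "'a::ab_group_add opsystem \<Rightarrow> bool" where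
  "operator_system V \<longleftrightarrow>
     matrix_ordered V \<and>
     ounit V \<in> carrier V \<and> invol V (ounit V) = ounit V \<and>
     (\<forall>n. \<forall>x\<in>mats V n. mat_star V x = x \<longrightarrow>
        (\<exists>r>0. unit_mat V r n + x \<in> mcone V) \<and>
        ((\<forall>r>0. unit_mat V r n + x \<in> mcone V) \<longrightarrow> x \<in> mcone V))"

definition completely_positive ::
    "'a::ab_group_add opsystem \<Rightarrow> 'b::ab_group_add opsystem \<Rightarrow> ('a \<Rightarrow> 'b) \<Rightarrow> bool" where
  "completely_positive V W \<phi> \<longleftrightarrow>
     linear_map V W \<phi> \<and> (\<forall>n. \<forall>x\<in>mats V n. x \<in> mcone V \<longrightarrow> map_mat \<phi> x \<in> mcone W)"

text \<open>Injectivity follows from the cones of \<open>V\<close> being proper and spanning.\<close>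
definition unital_complete_order_embedding ::
    "'a::ab_group_add opsystem \<Rightarrow> 'b::ab_group_add opsystem \<Rightarrow> ('a \<Rightarrow> 'b) \<Rightarrow> bool" where
  "unital_complete_order_embedding V W \<phi> \<longleftrightarrow>
     linear_map V W \<phi> \<and> \<phi> (ounit V) = ounit W \<and>
     (\<forall>n. \<forall>x\<in>mats V n. map_mat \<phi> x \<in> mcone W \<longleftrightarrow> x \<in> mcone V)"

definition G_operator_system ::
    "('g, 'm) monoid_scheme \<Rightarrow> 'a::ab_group_add opsystem \<Rightarrow> ('g \<Rightarrow> 'a \<Rightarrow> 'a) \<Rightarrow> bool" where
  "G_operator_system G V \<beta> \<longleftrightarrow>
     operator_system V \<and> group_action G (carrier V) \<beta> \<and>
     (\<forall>g\<in>carrier G. unital_complete_order_embedding V V (\<beta> g))"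

definition G_injective_operator_system ::
    "'e::ab_group_add itself \<Rightarrow> 'f::ab_group_add itself \<Rightarrow> ('g, 'm) monoid_scheme \<Rightarrow>
     'a::ab_group_add opsystem \<Rightarrow> ('g \<Rightarrow> 'a \<Rightarrow> 'a) \<Rightarrow> bool" where
  "G_injective_operator_system te tf G V \<beta> \<longleftrightarrow>
     G_operator_system G V \<beta> \<and>
     (\<forall>(E :: 'e opsystem) \<gamma> (F :: 'f opsystem) \<delta> \<iota> \<phi>.
        G_operator_system G E \<gamma> \<longrightarrow> G_operator_system G F \<delta> \<longrightarrow>
        unital_complete_order_embedding E F \<iota> \<longrightarrow> equivariant_on G (carrier E) \<gamma> \<delta> \<iota> \<longrightarrow>
        completely_positive E V \<phi> \<longrightarrow> equivariant_on G (carrier E) \<gamma> \<beta> \<phi> \<longrightarrow>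
        (\<exists>\<psi>. completely_positive F V \<psi> \<and> equivariant_on G (carrier F) \<delta> \<beta> \<psi> \<and>
             (\<forall>x\<in>carrier E. \<psi> (\<iota> x) = \<phi> x)))"


section \<open>Banach spaces\<close>

record 'a nspace = "'a cspace" +
  vnorm :: "'a \<Rightarrow> real"

definition banach_space :: "'a::ab_group_add nspace \<Rightarrow> bool" where
  "banach_space V \<longleftrightarrow>
     is_cspace V \<and>
     (\<forall>x\<in>carrier V.
        0 \<le> vnorm V x \<and>
        (vnorm V x = 0 \<longleftrightarrow> x = 0) \<and>
        (\<forall>y\<in>carrier V. vnorm V (x + y) \<le> vnorm V x + vnorm V y) \<and>
        (\<forall>c. vnorm V (cscale V c x) = cmod c * vnorm V x)) \<and>
     (\<forall>s :: nat \<Rightarrow> 'a.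
        range s \<subseteq> carrier V \<longrightarrow>
        (\<forall>\<epsilon>>0. \<exists>N. \<forall>m\<ge>N. \<forall>n\<ge>N. vnorm V (s m - s n) < \<epsilon>) \<longrightarrow>
        (\<exists>x\<in>carrier V. (\<lambda>n. vnorm V (s n - x)) \<longlonglongrightarrow> 0))"

definition contractive ::
    "'a::ab_group_add nspace \<Rightarrow> 'b::ab_group_add nspace \<Rightarrow> ('a \<Rightarrow> 'b) \<Rightarrow> bool" where
  "contractive V W \<phi> \<longleftrightarrow>
     linear_map V W \<phi> \<and> (\<forall>x\<in>carrier V. vnorm W (\<phi> x) \<le> vnorm V x)"

definition linear_isometry ::
    "'a::ab_group_add nspace \<Rightarrow> 'b::ab_group_add nspace \<Rightarrow> ('a \<Rightarrow> 'b) \<Rightarrow> bool" where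
  "linear_isometry V W \<phi> \<longleftrightarrow>
     linear_map V W \<phi> \<and> (\<forall>x\<in>carrier V. vnorm W (\<phi> x) = vnorm V x)"

definition G_banach_space ::
    "('g, 'm) monoid_scheme \<Rightarrow> 'a::ab_group_add nspace \<Rightarrow> ('g \<Rightarrow> 'a \<Rightarrow> 'a) \<Rightarrow> bool" where
  "G_banach_space G V \<beta> \<longleftrightarrow>
     banach_space V \<and> group_action G (carrier V) \<beta> \<and>
     (\<forall>g\<in>carrier G. linear_isometry V V (\<beta> g))"

definition G_injective_banach_space ::
    "'e::ab_group_add itself \<Rightarrow> 'f::ab_group_add itself \<Rightarrow> ('g, 'm) monoid_scheme \<Rightarrow>
     'a::ab_group_add nspace \<Rightarrow> ('g \<Rightarrow> 'a \<Rightarrow> 'a) \<Rightarrow> bool" where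
  "G_injective_banach_space te tf G V \<beta> \<longleftrightarrow>
     G_banach_space G V \<beta> \<and>
     (\<forall>(E :: 'e nspace) \<gamma> (F :: 'f nspace) \<delta> \<iota> \<phi>.
        G_banach_space G E \<gamma> \<longrightarrow> G_banach_space G F \<delta> \<longrightarrow>
        linear_isometry E F \<iota> \<longrightarrow> equivariant_on G (carrier E) \<gamma> \<delta> \<iota> \<longrightarrow>
        contractive E V \<phi> \<longrightarrow> equivariant_on G (carrier E) \<gamma> \<beta> \<phi> \<longrightarrow>
        (\<exists>\<psi>. contractive F V \<psi> \<and> equivariant_on G (carrier F) \<delta> \<beta> \<psi> \<and>
             (\<forall>x\<in>carrier E. \<psi> (\<iota> x) = \<phi> x)))"


section \<open>The function space \<open>C(X)\<close>\<close>

text \<open>Functions are extended by \<open>0\<close> outside \<open>topspace X\<close> to make their representation unique.\<close>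
definition C_carrier :: "'x topology \<Rightarrow> ('x \<Rightarrow> complex) set" where
  "C_carrier X = {u. continuous_map X euclidean u \<and> (\<forall>x. x \<notin> topspace X \<longrightarrow> u x = 0)}"

definition C_scale :: "complex \<Rightarrow> ('x \<Rightarrow> complex) \<Rightarrow> 'x \<Rightarrow> complex" where
  "C_scale c u = (\<lambda>x. c * u x)"

text \<open>
  A matrix over \<open>C(X)\<close> is a matrix-valued function on \<open>X\<close>: norm and positivity are the ones of
  \<open>C(X, M\<^sub>n)\<close>.  The element \<open>0\<close> inserted into the suprema matters only if \<open>X\<close> is empty.
\<close>
definition C_opspace :: "'x topology \<Rightarrow> ('x \<Rightarrow> complex) opspace" where
  "C_opspace X =
     \<lparr>carrier = C_carrier X, cscale = C_scale,
      mnorm = (\<lambda>a. Sup (insert 0 ((\<lambda>x. opnorm (map_mat (\<lambda>u. u x) a)) ` topspace X)))\<rparr>"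

definition C_opsystem :: "'x topology \<Rightarrow> ('x \<Rightarrow> complex) opsystem" where
  "C_opsystem X =
     \<lparr>carrier = C_carrier X, cscale = C_scale,
      invol = (\<lambda>u x. cnj (u x)),
      mcone = {a. square_mat a \<and> elements_mat a \<subseteq> C_carrier X \<and>
                  (\<forall>x\<in>topspace X. psd_mat (map_mat (\<lambda>u. u x) a))},
      ounit = (\<lambda>x. if x \<in> topspace X then 1 else 0)\<rparr>"

definition C_banach :: "'x topology \<Rightarrow> ('x \<Rightarrow> complex) nspace" where
  "C_banach X =
     \<lparr>carrier = C_carrier X, cscale = C_scale,
      vnorm = (\<lambda>u. Sup (insert 0 ((\<lambda>x. cmod (u x)) ` topspace X)))\<rparr>"

text \<open>\<^locale>\<open>group_action\<close> asks for each \<open>C_action G X \<alpha> g\<close> to be extensional, hence the restriction.\<close>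
definition C_action ::
    "('g, 'm) monoid_scheme \<Rightarrow> 'x topology \<Rightarrow> ('g \<Rightarrow> 'x \<Rightarrow> 'x) \<Rightarrow>
     'g \<Rightarrow> ('x \<Rightarrow> complex) \<Rightarrow> 'x \<Rightarrow> complex" where
  "C_action G X \<alpha> g =
     (\<lambda>u\<in>C_carrier X. \<lambda>x. if x \<in> topspace X then u (\<alpha> (inv\<^bsub>G\<^esub> g) x) else 0)"

end

theory Submission
  imports Defs
begin

text \<open>
  Let \<open>\<beta>D\<close> be the space of ultrafilters on the discrete set \<open>D = G \<times> X\<close>, on which \<open>G\<close> acts through
  the first factor.  The orbit map \<open>(g, x) \<mapsto> g \<cdot> x\<close> extends to a G-map from \<open>\<beta>D\<close> onto \<open>X\<close>, and
  projectivity provides an equivariant continuous section \<open>r\<close> of it.  Given an equivariant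
  \<open>\<phi> : E \<rightarrow> C(X)\<close>, extend each functional \<open>e \<mapsto> \<phi> e x\<close> to a contractive (or positive) functional
  \<open>\<omega> x\<close> on \<open>F\<close> by Hahn-Banach, without regard to equivariance or continuity in \<open>x\<close>.  Then
  \<open>\<psi> f y = lim \<omega> x (g\<^sup>-\<^sup>1 \<cdot> f)\<close>, the limit of \<open>(g, x)\<close> along the ultrafilter \<open>r y\<close>, is continuous in
  \<open>y\<close>, equivariant, and extends \<open>\<phi>\<close>.  Pointwise limits preserve contractivity and positivity of
  functionals, and functionals with these properties have them completely.
\<close>


section \<open>Hahn-Banach for complex spaces with a sublinear majorant\<close>

text \<open>The free choice of \<omega> rests on the first factor of G \<times> X: an equivariant
  map from F into the bounded functions on G \<times> X amounts to a family of functionals \<omega>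
  x with uniform bounds on orbits, through f \<mapsto> ((g, x) \<mapsto> \<omega> x (g^-1 f)). On
  the image of E such a function is \<phi> e (g x), the pullback of \<phi> e along the orbit map,
  however \<omega> x was continued beyond that image; continuity of \<phi> e then makes its limit
  along r y equal to \<phi> e y. Composition with r thus replaces an averaging over G.

  For the limits to exist, \<omega> x (g f) must be bounded uniformly in g and x. An isometric
  action gives this at once. For operator systems it has to be extracted from the order: \<phi> need
  not be unital, and the extension theorem yields bounds on real parts only, in terms of multiples
  of the unit that dominate the self-adjoint part of f.\<close>

text \<open>Partial real-linear functionals below \<open>p\<close>, given by their graphs; being below \<open>p\<close> makes them
  single-valued.\<close>

definition real_graph :: "('f::ab_group_add, 'm) cspace_scheme \<Rightarrow> ('f \<Rightarrow> real) \<Rightarrow> ('f \<times> real) set \<Rightarrow> bool" where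
  "real_graph F p H \<longleftrightarrow>
     H \<subseteq> carrier F \<times> UNIV \<and> (0, 0) \<in> H \<and>
     (\<forall>x a y b. (x, a) \<in> H \<longrightarrow> (y, b) \<in> H \<longrightarrow> (x + y, a + b) \<in> H) \<and>
     (\<forall>x a t. (x, a) \<in> H \<longrightarrow> (cscale F (complex_of_real t) x, t * a) \<in> H) \<and>
     (\<forall>x a. (x, a) \<in> H \<longrightarrow> a \<le> p x)"

text \<open>Homogeneity is asked for nonnegative real factors only, so that norms are covered as
  well as the majorant built from the order of an operator system, which is not symmetric. The
  factor 0 is included and yields p 0 = 0.\<close>

definition sublinear :: "('f::ab_group_add, 'm) cspace_scheme \<Rightarrow> ('f \<Rightarrow> real) \<Rightarrow> bool" where
  "sublinear F p \<longleftrightarrow>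
     (\<forall>x\<in>carrier F. \<forall>y\<in>carrier F. p (x + y) \<le> p x + p y) \<and>
     (\<forall>x\<in>carrier F. \<forall>t\<ge>0. p (cscale F (complex_of_real t) x) = t * p x)"

lemma is_cspaceD:
  assumes "is_cspace V"
  shows "0 \<in> carrier V"
    and "x \<in> carrier V \<Longrightarrow> y \<in> carrier V \<Longrightarrow> x + y \<in> carrier V"
    and "x \<in> carrier V \<Longrightarrow> cscale V c x \<in> carrier V"
    and "x \<in> carrier V \<Longrightarrow> - x \<in> carrier V"
    and "x \<in> carrier V \<Longrightarrow> y \<in> carrier V \<Longrightarrow> x - y \<in> carrier V"
    and "cscale V c (x + y) = cscale V c x + cscale V c y"
    and "cscale V (c + d) x = cscale V c x + cscale V d x"
    and "cscale V (c * d) x = cscale V c (cscale V d x)"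
    and "cscale V 1 x = x"
    and "cscale V 0 x = 0"
    and "cscale V c 0 = 0"
    and "cscale V (- 1) x = - x"
    and "cscale V c (- x) = - cscale V c x"
proof -
  interpret vector_space "cscale V" using assms by (simp add: is_cspace_def)
  have s: "subspace (carrier V)" using assms by (simp add: is_cspace_def)
  show "0 \<in> carrier V" using s by (rule subspace_0)
  show "x \<in> carrier V \<Longrightarrow> y \<in> carrier V \<Longrightarrow> x + y \<in> carrier V" using s by (rule subspace_add)
  show "x \<in> carrier V \<Longrightarrow> cscale V c x \<in> carrier V" using s by (rule subspace_scale)
  show "x \<in> carrier V \<Longrightarrow> - x \<in> carrier V" using s by (rule subspace_neg)
  show "x \<in> carrier V \<Longrightarrow> y \<in> carrier V \<Longrightarrow> x - y \<in> carrier V" using s by (rule subspace_diff)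
  show "cscale V c (x + y) = cscale V c x + cscale V c y" by (rule scale_right_distrib)
  show "cscale V (c + d) x = cscale V c x + cscale V d x" by (rule scale_left_distrib)
  show "cscale V (c * d) x = cscale V c (cscale V d x)" by (rule scale_scale[symmetric])
  show "cscale V 1 x = x" by (rule scale_one)
  show "cscale V 0 x = 0" by (rule scale_zero_left)
  show "cscale V c 0 = 0" by (rule scale_zero_right)
  show "cscale V (- 1) x = - x" using scale_minus_left[of 1 x] by (simp only: scale_one)
  show "cscale V c (- x) = - cscale V c x" by (rule scale_minus_right)
qed

lemma is_cspace_sum:
  assumes "is_cspace V" "\<And>i. i \<in> I \<Longrightarrow> u i \<in> carrier V"
  shows "(\<Sum>i\<in>I. u i) \<in> carrier V"
  using assms(2) by (induction I rule: infinite_finite_induct) (auto simp: is_cspaceD[OF assms(1)])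

lemma cscale_inverse_cancel:
  assumes F: "is_cspace F" and "t \<noteq> 0"
  shows "cscale F (complex_of_real t) (cscale F (complex_of_real (1 / t)) x) = x"
  by (simp add: assms is_cspaceD[OF F] flip: is_cspaceD(8)[OF F] of_real_mult)

text \<open>The one-dimensional step: domination at x - y and at z + y confines the value c at y
  between all \<open>a - p (x - y)\<close> and all \<open>p (z + y) - b\<close>, and the supremum of
  the lower bounds is taken. The vector y may already lie in the domain of H; domination of the new
  graph then forces c to be the old value.\<close>

lemma real_graph_extend:
  assumes F: "is_cspace F" and p: "sublinear F p" and H: "real_graph F p H" and y: "y \<in> carrier F"
  obtains H' c where "real_graph F p H'" "H \<subseteq> H'" "(y, c) \<in> H'"
proof -
  note cs = is_cspaceD[OF F]
  let ?s = "\<lambda>t. cscale F (complex_of_real t)"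
  have padd: "p (u + v) \<le> p u + p v" if "u \<in> carrier F" "v \<in> carrier F" for u v
    using p that by (auto simp: sublinear_def)
  have pscale: "p (?s t u) = t * p u" if "u \<in> carrier F" "t \<ge> 0" for u t
    using p that by (auto simp: sublinear_def)
  have Hc: "(x, a) \<in> H \<Longrightarrow> x \<in> carrier F" and H0: "(0, 0) \<in> H"
    and Ha: "(x, a) \<in> H \<Longrightarrow> (z, b) \<in> H \<Longrightarrow> (x + z, a + b) \<in> H"
    and Hs: "(x, a) \<in> H \<Longrightarrow> (?s t x, t * a) \<in> H"
    and Hp: "(x, a) \<in> H \<Longrightarrow> a \<le> p x" for x a z b t
    using H by (auto simp: real_graph_def)
  define L where "L = {a - p (x - y) | x a. (x, a) \<in> H}"
  have le: "a - p (x - y) \<le> p (z + y) - b" if "(x, a) \<in> H" "(z, b) \<in> H" for x a z b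
  proof -
    \<comment> \<open>The vector y cancels in this sum, so the domination already known on H applies
      to it.\<close>
    have "a + b \<le> p ((x - y) + (z + y))" using Hp[OF Ha[OF that]] by (simp add: algebra_simps)
    also have "\<dots> \<le> p (x - y) + p (z + y)" using that y by (intro padd cs(2,5)) (auto dest: Hc)
    finally show ?thesis by simp
  qed
  define c where "c = Sup L"
  have Lne: "L \<noteq> {}" using H0 by (auto simp: L_def)
  have Lbd: "bdd_above L" using le[OF _ H0] by (auto simp: L_def bdd_above_def)
  have c1: "a - p (x - y) \<le> c" if "(x, a) \<in> H" for x a
    unfolding c_def by (rule cSup_upper[OF _ Lbd]) (use that in \<open>auto simp: L_def\<close>)
  have c2: "c \<le> p (z + y) - b" if "(z, b) \<in> H" for z b
    unfolding c_def by (rule cSup_least[OF Lne]) (use le[OF _ that] in \<open>auto simp: L_def\<close>)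
  define H' where "H' = {(x + ?s t y, a + t * c) | x a t. (x, a) \<in> H}"
  have bound: "a + t * c \<le> p (x + ?s t y)" if xa: "(x, a) \<in> H" for x a t
  proof -
    consider "t = 0" | "t > 0" | "t < 0" by linarith
    then show ?thesis
    proof cases
      case 1
      then show ?thesis using Hp[OF xa] by (simp add: cs)
    next
      case 2
      \<comment> \<open>Division by |t| reduces this case to t = 1, the upper bound on c, and the
        next case to t = -1, the lower bound.\<close>
      let ?z = "?s (1/t) x"
      have "c \<le> p (?z + y) - (1/t) * a" using c2[OF Hs[OF xa]] .
      then have "t * c \<le> t * p (?z + y) - a" using 2 by (simp add: field_simps)
      also have "t * p (?z + y) = p (?s t (?z + y))"
        using 2 xa y Hc by (subst pscale) (auto simp: cs)
      also have "?s t (?z + y) = x + ?s t y"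
        using 2 by (simp only: cs cscale_inverse_cancel[OF F])
      finally show ?thesis by simp
    next
      case 3
      define s where "s = - t"
      have s: "s > 0" "t = - s" using 3 by (auto simp: s_def)
      let ?z = "?s (1/s) x"
      have "(1/s) * a - p (?z - y) \<le> c" using c1[OF Hs[OF xa]] .
      then have "a - s * p (?z - y) \<le> s * c" using s by (simp add: field_simps)
      then have "a + t * c \<le> s * p (?z - y)" using s by simp
      also have "s * p (?z - y) = p (?s s (?z - y))"
        using s xa y Hc by (subst pscale) (auto simp: cs)
      also have "?s s (?z - y) = x + ?s t y"
      proof -
        have "?s t y = - ?s s y"
          using cs(8)[of "- 1" "complex_of_real s" y] by (simp add: s cs)
        moreover have "?s s (?z - y) = ?s s ?z - ?s s y"
          using cs(6)[of "complex_of_real s" ?z "- y"] by (simp add: cs)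
        moreover have "?s s ?z = x" using s cscale_inverse_cancel[OF F, of s x] by simp
        ultimately show ?thesis using s by simp
      qed
      finally show ?thesis .
    qed
  qed
  have "real_graph F p H'"
    unfolding real_graph_def
  proof (intro conjI allI impI)
    show "H' \<subseteq> carrier F \<times> UNIV" using y by (auto simp: H'_def cs Hc)
    show "(0, 0) \<in> H'" unfolding H'_def using H0 by (force intro!: exI[of _ 0] simp: cs)
  next
    fix u a v b assume "(u, a) \<in> H'" "(v, b) \<in> H'"
    then obtain x1 a1 t1 x2 a2 t2 where
      e: "u = x1 + ?s t1 y" "a = a1 + t1 * c" "(x1, a1) \<in> H"
         "v = x2 + ?s t2 y" "b = a2 + t2 * c" "(x2, a2) \<in> H"
      by (auto simp: H'_def)
    have "u + v = (x1 + x2) + ?s (t1 + t2) y" "a + b = (a1 + a2) + (t1 + t2) * c"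
      by (simp_all add: e cs algebra_simps)
    then show "(u + v, a + b) \<in> H'" using Ha[OF e(3,6)] unfolding H'_def by blast
  next
    fix u a t assume "(u, a) \<in> H'"
    then obtain x1 a1 t1 where e: "u = x1 + ?s t1 y" "a = a1 + t1 * c" "(x1, a1) \<in> H"
      by (auto simp: H'_def)
    have "?s t u = ?s t x1 + ?s (t * t1) y" "t * a = t * a1 + (t * t1) * c"
      by (simp_all only: e cs of_real_mult) (simp add: algebra_simps)
    then show "(?s t u, t * a) \<in> H'" using Hs[OF e(3)] unfolding H'_def by blast
  next
    fix u a assume "(u, a) \<in> H'"
    then show "a \<le> p u" using bound by (auto simp: H'_def)
  qed
  moreover have "H \<subseteq> H'"
  proof
    fix z assume "z \<in> H"
    moreover obtain x a where "z = (x, a)" by (cases z)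
    ultimately have "(x + ?s 0 y, a + 0 * c) \<in> H'" unfolding H'_def by blast
    then show "z \<in> H'" using \<open>z = (x, a)\<close> by (simp add: cs)
  qed
  moreover have "(0 + ?s 1 y, 0 + 1 * c) \<in> H'" unfolding H'_def using H0 by blast
  then have "(y, c) \<in> H'" by (simp add: cs)
  ultimately show ?thesis using that by blast
qed

text \<open>Both (0, a - b) and (0, b - a) belong to H, and domination by p 0 = 0 leaves only a = b.
  Domination thus takes the place of a separate condition of single-valuedness.\<close>

lemma real_graph_unique:
  assumes F: "is_cspace F" and p: "sublinear F p" and H: "real_graph F p H"
    and "(x, a) \<in> H" "(x, b) \<in> H"
  shows "a = b"
proof -
  have le: "a \<le> b" if "(x, a) \<in> H" "(x, b) \<in> H" for a b
  proof -
    have "(cscale F (complex_of_real (- 1)) x, - 1 * b) \<in> H"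
      using that H unfolding real_graph_def by blast
    then have "(- x, - b) \<in> H" by (simp add: is_cspaceD[OF F])
    then have "(x + - x, a + - b) \<in> H"
      using that(1) H unfolding real_graph_def by blast
    then have "a + - b \<le> p 0" using H by (simp add: real_graph_def)
    moreover have "p 0 = 0"
      using p is_cspaceD(1,10)[OF F] unfolding sublinear_def
      by (metis mult_zero_left of_real_0 order_refl)
    ultimately show ?thesis by simp
  qed
  show ?thesis using le[of a b] le[of b a] assms by simp
qed

text \<open>Zorn's lemma for graphs ordered by inclusion. The conditions on a graph involve at most
  two of its points at a time, so they pass to unions of chains; a maximal graph is total because
  \<open>real_graph_extend\<close> cannot enlarge it.\<close>

lemma real_graph_total_extension:
  assumes F: "is_cspace F" and p: "sublinear F p" and H: "real_graph F p H"
  obtains H' where "real_graph F p H'" "H \<subseteq> H'" "\<And>y. y \<in> carrier F \<Longrightarrow> \<exists>c. (y, c) \<in> H'"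
proof -
  let ?A = "{H'. real_graph F p H' \<and> H \<subseteq> H'}"
  have "\<exists>M\<in>?A. \<forall>Y\<in>?A. M \<subseteq> Y \<longrightarrow> Y = M"
  proof (rule subset_Zorn_nonempty)
    show "?A \<noteq> {}" using H by auto
  next
    fix C assume ne: "C \<noteq> {}" and ch: "subset.chain ?A C"
    have sub: "C \<subseteq> ?A" and tot: "\<And>P Q. P \<in> C \<Longrightarrow> Q \<in> C \<Longrightarrow> P \<subseteq> Q \<or> Q \<subseteq> P"
      using ch unfolding subset.chain_def by blast+
    have g: "real_graph F p P" if "P \<in> C" for P using sub that by auto
    have "real_graph F p (\<Union>C)"
      unfolding real_graph_def
    proof (intro conjI allI impI)
      show "\<Union>C \<subseteq> carrier F \<times> UNIV" using g by (intro Union_least) (simp add: real_graph_def)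
      show "(0, 0) \<in> \<Union>C" using g ne by (auto simp: real_graph_def)
    next
      fix x a y b assume "(x, a) \<in> \<Union>C" "(y, b) \<in> \<Union>C"
      then obtain P Q where "P \<in> C" "Q \<in> C" "(x, a) \<in> P" "(y, b) \<in> Q" by auto
      with tot obtain R where "R \<in> C" "(x, a) \<in> R" "(y, b) \<in> R" by blast
      then show "(x + y, a + b) \<in> \<Union>C" using g unfolding real_graph_def by blast
    next
      fix x a t assume "(x, a) \<in> \<Union>C"
      then show "(cscale F (complex_of_real t) x, t * a) \<in> \<Union>C"
        using g unfolding real_graph_def by blast
    next
      fix x a assume "(x, a) \<in> \<Union>C"
      then show "a \<le> p x" using g unfolding real_graph_def by blast
    qed
    then show "\<Union>C \<in> ?A" using ne sub by auto
  qed
  then obtain M where M: "real_graph F p M" "H \<subseteq> M"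
    and max: "\<And>Y. real_graph F p Y \<Longrightarrow> M \<subseteq> Y \<Longrightarrow> Y = M"
    by (auto intro: subset_trans)
  have "\<exists>c. (y, c) \<in> M" if "y \<in> carrier F" for y
    using real_graph_extend[OF F p M(1) that] max by metis
  then show ?thesis using that M by blast
qed

section \<open>Complex functionals\<close>

definition scalars :: "complex cspace" where
  "scalars = \<lparr>carrier = UNIV, cscale = (*)\<rparr>"

lemma linear_map_scalars_iff:
  "linear_map V scalars \<phi> \<longleftrightarrow>
     (\<forall>x\<in>carrier V. \<forall>y\<in>carrier V. \<phi> (x + y) = \<phi> x + \<phi> y) \<and>
     (\<forall>c. \<forall>x\<in>carrier V. \<phi> (cscale V c x) = c * \<phi> x)"
  by (simp add: linear_map_def scalars_def)

text \<open>A complex functional is recovered from its real part u as u f - i u (i f), so it is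
  enough to extend Re \<phi> over the reals. Starting from the graph of Re \<phi> over the range of
  \<iota> lets the bound \<open>le\<close> secure that the values depend on \<iota> e alone.\<close>

theorem complex_Hahn_Banach:
  assumes E: "is_cspace E" and F: "is_cspace F" and \<iota>: "linear_map E F \<iota>"
    and \<phi>: "linear_map E scalars \<phi>" and p: "sublinear F p"
    and le: "\<And>e. e \<in> carrier E \<Longrightarrow> Re (\<phi> e) \<le> p (\<iota> e)"
  obtains \<psi> where "linear_map F scalars \<psi>" "\<And>e. e \<in> carrier E \<Longrightarrow> \<psi> (\<iota> e) = \<phi> e"
    "\<And>f. f \<in> carrier F \<Longrightarrow> Re (\<psi> f) \<le> p f"
proof -
  note cs = is_cspaceD[OF F] and ce = is_cspaceD[OF E]
  have i_add: "\<iota> (x + y) = \<iota> x + \<iota> y" if "x \<in> carrier E" "y \<in> carrier E" for x y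
    using \<iota> that by (simp add: linear_map_def)
  have i_sc: "\<iota> (cscale E c x) = cscale F c (\<iota> x)" if "x \<in> carrier E" for x c
    using \<iota> that by (simp add: linear_map_def)
  have i_in: "\<iota> x \<in> carrier F" if "x \<in> carrier E" for x
    using \<iota> that by (auto simp: linear_map_def)
  have f_add: "\<phi> (x + y) = \<phi> x + \<phi> y" if "x \<in> carrier E" "y \<in> carrier E" for x y
    using \<phi> that by (simp add: linear_map_scalars_iff)
  have f_sc: "\<phi> (cscale E c x) = c * \<phi> x" if "x \<in> carrier E" for x c
    using \<phi> that by (simp add: linear_map_scalars_iff)
  define H where "H = {(\<iota> e, Re (\<phi> e)) | e. e \<in> carrier E}"
  have "real_graph F p H"
    unfolding real_graph_def
  proof (intro conjI allI impI)
    show "H \<subseteq> carrier F \<times> UNIV" using i_in by (auto simp: H_def)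
    have "\<iota> 0 = 0" "\<phi> 0 = 0"
      using i_sc[OF ce(1), of 0] f_sc[OF ce(1), of 0] by (simp_all add: cs ce)
    then show "(0, 0) \<in> H" using ce(1) by (force simp: H_def)
  next
    fix x a y b assume "(x, a) \<in> H" "(y, b) \<in> H"
    then obtain e d where "e \<in> carrier E" "d \<in> carrier E"
      "x = \<iota> e" "a = Re (\<phi> e)" "y = \<iota> d" "b = Re (\<phi> d)" by (auto simp: H_def)
    then show "(x + y, a + b) \<in> H"
      unfolding H_def using ce(2) by (intro CollectI exI[of _ "e + d"]) (simp add: i_add f_add)
  next
    fix x a t assume "(x, a) \<in> H"
    then obtain e where "e \<in> carrier E" "x = \<iota> e" "a = Re (\<phi> e)" by (auto simp: H_def)
    then show "(cscale F (complex_of_real t) x, t * a) \<in> H"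
      unfolding H_def using ce(3)
      by (intro CollectI exI[of _ "cscale E (complex_of_real t) e"]) (simp add: i_sc f_sc)
  next
    fix x a assume "(x, a) \<in> H"
    then show "a \<le> p x" by (auto simp: H_def le)
  qed
  then obtain H' where H': "real_graph F p H'" "H \<subseteq> H'"
    and tot: "\<And>y. y \<in> carrier F \<Longrightarrow> \<exists>c. (y, c) \<in> H'"
    using real_graph_total_extension[OF F p] by blast
  define u where "u y = (THE c. (y, c) \<in> H')" for y
  have uI: "u y = c" if "(y, c) \<in> H'" for y c
    unfolding u_def using that real_graph_unique[OF F p H'(1)] by blast
  have uH: "(y, u y) \<in> H'" if "y \<in> carrier F" for y
    using tot[OF that] uI by blast
  have u_add: "u (x + y) = u x + u y" if "x \<in> carrier F" "y \<in> carrier F" for x y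
    using H'(1) uH[OF that(1)] uH[OF that(2)] by (intro uI) (auto simp: real_graph_def)
  have u_sc: "u (cscale F (complex_of_real t) x) = t * u x" if "x \<in> carrier F" for x t
    using H'(1) uH[OF that(1)] by (intro uI) (auto simp: real_graph_def)
  have u_le: "u x \<le> p x" if "x \<in> carrier F" for x
    using H'(1) uH[OF that(1)] by (auto simp: real_graph_def)
  have u_i: "u (\<iota> e) = Re (\<phi> e)" if "e \<in> carrier E" for e
    using H'(2) that by (intro uI) (auto simp: H_def)
  define \<psi> where "\<psi> f = Complex (u f) (- u (cscale F \<i> f))" for f
  have "\<psi> (x + y) = \<psi> x + \<psi> y" if "x \<in> carrier F" "y \<in> carrier F" for x y
    using that by (simp add: \<psi>_def complex_eq_iff u_add cs)
  moreover have "\<psi> (cscale F c x) = c * \<psi> x" if x: "x \<in> carrier F" for c x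
  proof -
    have split: "cscale F c x = cscale F (complex_of_real (Re c)) x
        + cscale F (complex_of_real (Im c)) (cscale F \<i> x)" for c x
      using complex_eq[of c] cs(7,8) by (metis mult.commute)
    have "u (cscale F c x) = Re c * u x + Im c * u (cscale F \<i> x)" for c
      by (subst split) (simp add: u_add u_sc cs x)
    \<comment> \<open>The formula at c settles the real part of the claim, the formula at i c the
      imaginary part.\<close>
    from this[of c] this[of "\<i> * c"] show ?thesis
      by (simp add: \<psi>_def complex_eq_iff cs)
  qed
  ultimately have "linear_map F scalars \<psi>" by (simp add: linear_map_scalars_iff)
  moreover have "\<psi> (\<iota> e) = \<phi> e" if e: "e \<in> carrier E" for e
    using u_i[OF e] u_i[OF ce(3)[OF e, of \<i>]]
    by (simp add: \<psi>_def complex_eq_iff i_sc[OF e] f_sc[OF e])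
  moreover have "Re (\<psi> f) \<le> p f" if "f \<in> carrier F" for f
    using u_le[OF that] by (simp add: \<psi>_def)
  ultimately show ?thesis using that by blast
qed

section \<open>Ultrafilters on a discrete G-set\<close>

text \<open>Members are subsets of the whole type and complements are taken there; as D is always a
  member, only the traces on D matter. Families of sets, instead of values of type
  \<open>filter\<close>, make the ultrafilters elements of the type over which the projectivity
  hypothesis quantifies.\<close>

definition ultrafilters :: "'d set \<Rightarrow> 'd set set set" where
  "ultrafilters D = {U. D \<in> U \<and> {} \<notin> U \<and> (\<forall>A\<in>U. \<forall>B. A \<subseteq> B \<longrightarrow> B \<in> U) \<and>
     (\<forall>A\<in>U. \<forall>B\<in>U. A \<inter> B \<in> U) \<and> (\<forall>A. A \<in> U \<or> - A \<in> U)}"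

text \<open>The same object as a filter, so that limits along it can be expressed by
  \<open>limitin\<close> and by convergence of functions.\<close>

definition ufilter :: "'d set set \<Rightarrow> 'd filter" where
  "ufilter U = Abs_filter (\<lambda>P. Collect P \<in> U)"

lemma ultrafiltersD:
  assumes "U \<in> ultrafilters D"
  shows "D \<in> U" and "{} \<notin> U" and "A \<in> U \<Longrightarrow> A \<subseteq> B \<Longrightarrow> B \<in> U"
    and "A \<in> U \<Longrightarrow> B \<in> U \<Longrightarrow> A \<inter> B \<in> U" and "A \<notin> U \<Longrightarrow> - A \<in> U" and "- A \<in> U \<Longrightarrow> A \<notin> U"
proof -
  show "D \<in> U" "{} \<notin> U" "A \<in> U \<Longrightarrow> A \<subseteq> B \<Longrightarrow> B \<in> U"
    using assms by (simp_all add: ultrafilters_def)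
  show "A \<notin> U \<Longrightarrow> - A \<in> U" using assms by (auto simp add: ultrafilters_def)
  have int: "A \<inter> B \<in> U" if "A \<in> U" "B \<in> U" for A B
    using assms that by (simp add: ultrafilters_def)
  show "A \<in> U \<Longrightarrow> B \<in> U \<Longrightarrow> A \<inter> B \<in> U" by (rule int)
  show "- A \<in> U \<Longrightarrow> A \<notin> U" using int[of A "- A"] \<open>{} \<notin> U\<close> by auto
qed

lemma eventually_ufilter:
  assumes "U \<in> ultrafilters D"
  shows "eventually P (ufilter U) \<longleftrightarrow> Collect P \<in> U"
  unfolding ufilter_def
proof (rule eventually_Abs_filter, standard)
  show "Collect (\<lambda>x. True) \<in> U" using ultrafiltersD(3)[OF assms ultrafiltersD(1)[OF assms]] by simp
  show "Collect (\<lambda>x. P x \<and> Q x) \<in> U" if "Collect P \<in> U" "Collect Q \<in> U" for P Q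
    using ultrafiltersD(4)[OF assms that] by (simp add: Collect_conj_eq)
  show "Collect Q \<in> U" if "\<forall>x. P x \<longrightarrow> Q x" "Collect P \<in> U" for P Q
    by (rule ultrafiltersD(3)[OF assms that(2)]) (use that(1) in blast)
qed

lemma eventually_ufilter_carrier:
  assumes "U \<in> ultrafilters D" "\<And>d. d \<in> D \<Longrightarrow> P d"
  shows "eventually P (ufilter U)"
  unfolding eventually_ufilter[OF assms(1)]
  by (rule ultrafiltersD(3)[OF assms(1) ultrafiltersD(1)[OF assms(1)]]) (use assms(2) in blast)

lemma ufilter_neq_bot:
  assumes "U \<in> ultrafilters D"
  shows "ufilter U \<noteq> bot"
  using ultrafiltersD(2)[OF assms] eventually_ufilter[OF assms, of "\<lambda>_. False"] by auto

text \<open>Zorn's lemma for the families that contain D and H and have nonempty finite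
  intersections. In a maximal family, a set that meets every finite intersection of members is
  itself a member (\<open>mem\<close>); the closure axioms and the dichotomy follow from
  this.\<close>

lemma ultrafilter_extension:
  assumes fip: "\<And>\<A>. finite \<A> \<Longrightarrow> \<A> \<subseteq> H \<Longrightarrow> D \<inter> \<Inter>\<A> \<noteq> {}"
  obtains U where "U \<in> ultrafilters D" "H \<subseteq> U"
proof -
  define \<F> where "\<F> = {M. insert D H \<subseteq> M \<and> (\<forall>\<A>. finite \<A> \<longrightarrow> \<A> \<subseteq> M \<longrightarrow> \<Inter>\<A> \<noteq> {})}"
  have "\<exists>M\<in>\<F>. \<forall>N\<in>\<F>. M \<subseteq> N \<longrightarrow> N = M"
  proof (rule subset_Zorn_nonempty)
    have "\<Inter>\<A> \<noteq> {}" if "finite \<A>" "\<A> \<subseteq> insert D H" for \<A>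
    proof -
      have "D \<inter> \<Inter>(\<A> - {D}) \<subseteq> \<Inter>\<A>" by auto
      moreover have "D \<inter> \<Inter>(\<A> - {D}) \<noteq> {}" using that by (intro fip) auto
      ultimately show ?thesis by auto
    qed
    then show "\<F> \<noteq> {}" unfolding \<F>_def by blast
  next
    fix C assume ne: "C \<noteq> {}" and ch: "subset.chain \<F> C"
    have sub: "C \<subseteq> \<F>" using ch by (simp add: subset.chain_def)
    have "\<Inter>\<A> \<noteq> {}" if fin: "finite \<A>" and le: "\<A> \<subseteq> \<Union>C" for \<A>
    proof -
      obtain B where "B \<in> C" "\<A> \<subseteq> B" using finite_subset_Union_chain[OF fin le ne ch] .
      then show ?thesis using sub fin by (auto simp: \<F>_def)
    qed
    moreover have "insert D H \<subseteq> \<Union>C" using sub ne unfolding \<F>_def by blast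
    ultimately show "\<Union>C \<in> \<F>" unfolding \<F>_def by blast
  qed
  then obtain M where "M \<in> \<F>" and max: "\<And>N. N \<in> \<F> \<Longrightarrow> M \<subseteq> N \<Longrightarrow> N = M" by blast
  then have M: "insert D H \<subseteq> M" and Mf: "\<And>\<A>. finite \<A> \<Longrightarrow> \<A> \<subseteq> M \<Longrightarrow> \<Inter>\<A> \<noteq> {}"
    by (simp_all add: \<F>_def)
  have mem: "A \<in> M" if "\<And>\<A>. finite \<A> \<Longrightarrow> \<A> \<subseteq> M \<Longrightarrow> A \<inter> \<Inter>\<A> \<noteq> {}" for A
  proof -
    have "\<Inter>\<A> \<noteq> {}" if "finite \<A>" "\<A> \<subseteq> insert A M" for \<A>
    proof -
      have "A \<inter> \<Inter>(\<A> - {A}) \<subseteq> \<Inter>\<A>" by auto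
      moreover have "A \<inter> \<Inter>(\<A> - {A}) \<noteq> {}" using that by (intro \<open>\<And>\<A>. _ \<Longrightarrow> _ \<Longrightarrow> A \<inter> \<Inter>\<A> \<noteq> {}\<close>) auto
      ultimately show ?thesis by auto
    qed
    then have "insert A M \<in> \<F>" using M by (auto simp: \<F>_def)
    then show ?thesis using max[of "insert A M"] by auto
  qed
  have "M \<in> ultrafilters D"
    unfolding ultrafilters_def
  proof (intro CollectI conjI ballI allI impI)
    show "D \<in> M" using M by auto
    show "{} \<notin> M" using Mf[of "{{}}"] by auto
    show "B \<in> M" if "A \<in> M" "A \<subseteq> B" for A B
    proof (rule mem)
      fix \<A> assume "finite \<A>" "\<A> \<subseteq> M"
      then show "B \<inter> \<Inter>\<A> \<noteq> {}" using Mf[of "insert A \<A>"] that by auto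
    qed
    show "A \<inter> B \<in> M" if "A \<in> M" "B \<in> M" for A B
    proof (rule mem)
      fix \<A> assume "finite \<A>" "\<A> \<subseteq> M"
      then show "A \<inter> B \<inter> \<Inter>\<A> \<noteq> {}" using Mf[of "insert A (insert B \<A>)"] that by auto
    qed
    show "A \<in> M \<or> - A \<in> M" for A
    proof (rule ccontr)
      assume "\<not> (A \<in> M \<or> - A \<in> M)"
      \<comment> \<open>By \<open>mem\<close>, one finite intersection of members misses A and
        another misses - A; together they miss everything.\<close>
      then obtain \<A> \<B> where "finite \<A>" "\<A> \<subseteq> M" "A \<inter> \<Inter>\<A> = {}" "finite \<B>" "\<B> \<subseteq> M" "- A \<inter> \<Inter>\<B> = {}"
        using mem by meson
      moreover from this have "\<Inter>(\<A> \<union> \<B>) = {}" by blast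
      ultimately show False using Mf[of "\<A> \<union> \<B>"] by blast
    qed
  qed
  then show ?thesis using that M by blast
qed

section \<open>Limits along ultrafilters and the Stone-Cech compactification\<close>

text \<open>If no point were a limit, every point would have a neighbourhood that f does not enter
  eventually, hence avoids eventually, because U decides every set. Finitely many of these
  neighbourhoods cover T, so f would eventually have no place to go.\<close>

lemma ultrafilter_limit_exists:
  assumes T: "compact_space T" and f: "\<And>d. d \<in> D \<Longrightarrow> f d \<in> topspace T" and U: "U \<in> ultrafilters D"
  shows "\<exists>l. limitin T f l (ufilter U)"
proof (rule ccontr)
  assume "\<nexists>l. limitin T f l (ufilter U)"
  then have "\<forall>l\<in>topspace T. \<exists>W. openin T W \<and> l \<in> W \<and> \<not> eventually (\<lambda>d. f d \<in> W) (ufilter U)"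
    by (auto simp: limitin_def)
  then obtain W where "\<forall>l\<in>topspace T.
      openin T (W l) \<and> l \<in> W l \<and> \<not> eventually (\<lambda>d. f d \<in> W l) (ufilter U)"
    unfolding bchoice_iff by blast
  then have W: "openin T (W l)" "l \<in> W l" "\<not> eventually (\<lambda>d. f d \<in> W l) (ufilter U)"
    if "l \<in> topspace T" for l using that by auto
  have "\<forall>V\<in>W ` topspace T. openin T V" "topspace T \<subseteq> \<Union>(W ` topspace T)" using W(1,2) by auto
  then obtain K where K: "finite K" "K \<subseteq> W ` topspace T" "topspace T \<subseteq> \<Union>K"
    using T[unfolded compact_space_alt, rule_format, of "W ` topspace T"] by auto
  have "eventually (\<lambda>d. f d \<notin> V) (ufilter U)" if V: "V \<in> K" for V
  proof -
    obtain l where "l \<in> topspace T" "V = W l" using V K(2) by auto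
    then have "{d. f d \<in> V} \<notin> U" using W(3) by (simp add: eventually_ufilter[OF U])
    then have "- {d. f d \<in> V} \<in> U" by (rule ultrafiltersD(5)[OF U])
    then show ?thesis by (simp add: eventually_ufilter[OF U] Collect_neg_eq)
  qed
  then have "eventually (\<lambda>d. \<forall>V\<in>K. f d \<notin> V) (ufilter U)"
    using K(1) by (simp add: eventually_ball_finite)
  moreover have "eventually (\<lambda>d. f d \<in> topspace T) (ufilter U)"
    using U f by (rule eventually_ufilter_carrier)
  ultimately have "eventually (\<lambda>d. False) (ufilter U)"
    by eventually_elim (use K(3) in auto)
  then show False using ufilter_neq_bot[OF U] by simp
qed

text \<open>The Stone topology, generated by the sets of all ultrafilters containing a given A. It
  makes the ultrafilters the Stone-Cech compactification of the discrete set D.\<close>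

definition ultra_topology :: "'d set \<Rightarrow> 'd set set topology" where
  "ultra_topology D = topology (\<lambda>W. W \<subseteq> ultrafilters D \<and>
     (\<forall>U\<in>W. \<exists>A\<in>U. \<forall>V\<in>ultrafilters D. A \<in> V \<longrightarrow> V \<in> W))"

lemma openin_ultra_topology:
  "openin (ultra_topology D) W \<longleftrightarrow> W \<subseteq> ultrafilters D \<and>
     (\<forall>U\<in>W. \<exists>A\<in>U. \<forall>V\<in>ultrafilters D. A \<in> V \<longrightarrow> V \<in> W)"
proof -
  let ?O = "\<lambda>W. W \<subseteq> ultrafilters D \<and> (\<forall>U\<in>W. \<exists>A\<in>U. \<forall>V\<in>ultrafilters D. A \<in> V \<longrightarrow> V \<in> W)"
  have "istopology ?O"
    unfolding istopology_def
  proof (intro conjI allI impI)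
    fix S T assume S: "?O S" and T: "?O T"
    show "S \<inter> T \<subseteq> ultrafilters D" using S by blast
    show "\<forall>U\<in>S \<inter> T. \<exists>A\<in>U. \<forall>V\<in>ultrafilters D. A \<in> V \<longrightarrow> V \<in> S \<inter> T"
    proof
      fix U assume U: "U \<in> S \<inter> T"
      obtain A where "A \<in> U" "\<forall>V\<in>ultrafilters D. A \<in> V \<longrightarrow> V \<in> S" using S U by auto
      moreover obtain B where "B \<in> U" "\<forall>V\<in>ultrafilters D. B \<in> V \<longrightarrow> V \<in> T" using T U by auto
      moreover have "U \<in> ultrafilters D" using S U by blast
      moreover have "A \<in> V \<and> B \<in> V" if "V \<in> ultrafilters D" "A \<inter> B \<in> V" for V
        using ultrafiltersD(3)[OF that] by blast
      ultimately show "\<exists>A\<in>U. \<forall>V\<in>ultrafilters D. A \<in> V \<longrightarrow> V \<in> S \<inter> T"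
        by (intro bexI[of _ "A \<inter> B"]) (auto intro: ultrafiltersD(4))
    qed
  next
    fix \<K> assume "\<forall>K\<in>\<K>. ?O K"
    then show "\<Union>\<K> \<subseteq> ultrafilters D" "\<forall>U\<in>\<Union>\<K>. \<exists>A\<in>U. \<forall>V\<in>ultrafilters D. A \<in> V \<longrightarrow> V \<in> \<Union>\<K>"
      by (simp_all add: Union_least) (metis UnionI)
  qed
  then show ?thesis by (simp add: ultra_topology_def topology_inverse')
qed

lemma openin_ultra_topology_basic: "openin (ultra_topology D) {U \<in> ultrafilters D. A \<in> U}"
  by (auto simp: openin_ultra_topology)

lemma topspace_ultra_topology [simp]: "topspace (ultra_topology D) = ultrafilters D"
proof
  show "topspace (ultra_topology D) \<subseteq> ultrafilters D"
    using openin_topspace[of "ultra_topology D"] by (simp only: openin_ultra_topology)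
  have "openin (ultra_topology D) (ultrafilters D)"
    unfolding openin_ultra_topology using ultrafiltersD(1) by (intro conjI subset_refl ballI) auto
  then show "ultrafilters D \<subseteq> topspace (ultra_topology D)" by (rule openin_subset)
qed

lemma Hausdorff_ultra_topology: "Hausdorff_space (ultra_topology D)"
  unfolding Hausdorff_space_def topspace_ultra_topology
proof (intro allI impI, elim conjE)
  fix U V assume U: "U \<in> ultrafilters D" and V: "V \<in> ultrafilters D" and "U \<noteq> V"
  then obtain A where "A \<in> U" "- A \<in> V"
    using ultrafiltersD(5)[OF U] ultrafiltersD(5)[OF V] by (metis double_complement subsetI subset_antisym)
  then show "\<exists>S T. openin (ultra_topology D) S \<and> openin (ultra_topology D) T \<and> U \<in> S \<and> V \<in> T \<and> disjnt S T"
    using U V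
    by (intro exI[of _ "{W \<in> ultrafilters D. A \<in> W}"] exI[of _ "{W \<in> ultrafilters D. - A \<in> W}"])
      (auto simp: openin_ultra_topology_basic disjnt_def dest: ultrafiltersD(6))
qed

text \<open>Without a finite subcover, the complements of all A whose basic open set lies in a
  member of the cover fit into one ultrafilter U. Some member W of the cover contains U together
  with the basic neighbourhood given by some A in U, and then - A is in U as well.\<close>

lemma compact_ultra_topology: "compact_space (ultra_topology D)"
  unfolding compact_space_alt topspace_ultra_topology
proof (intro allI impI, elim conjE, rule ccontr)
  fix \<U> assume op: "\<forall>W\<in>\<U>. openin (ultra_topology D) W" and cov: "ultrafilters D \<subseteq> \<Union>\<U>"
    and no: "\<nexists>\<F>. finite \<F> \<and> \<F> \<subseteq> \<U> \<and> ultrafilters D \<subseteq> \<Union>\<F>"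
  define B where "B A = {U \<in> ultrafilters D. A \<in> U}" for A
  define H where "H = {- A | A. \<exists>W\<in>\<U>. B A \<subseteq> W}"
  \<comment> \<open>If D and finitely many of these complements have empty intersection, each
    ultrafilter on D omits one of them and so contains the corresponding original set; the members
    of the cover chosen for these sets form a finite subcover.\<close>
  have fip: "D \<inter> \<Inter>\<A> \<noteq> {}" if "finite \<A>" "\<A> \<subseteq> H" for \<A>
  proof
    assume e: "D \<inter> \<Inter>\<A> = {}"
    have "\<forall>A\<in>\<A>. \<exists>W. W \<in> \<U> \<and> B (- A) \<subseteq> W"
    proof
      fix A assume "A \<in> \<A>"
      with that(2) obtain A' W where "A = - A'" "W \<in> \<U>" "B A' \<subseteq> W" unfolding H_def by blast
      then show "\<exists>W. W \<in> \<U> \<and> B (- A) \<subseteq> W" by auto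
    qed
    then obtain w where w: "\<And>A. A \<in> \<A> \<Longrightarrow> w A \<in> \<U>" "\<And>A. A \<in> \<A> \<Longrightarrow> B (- A) \<subseteq> w A"
      unfolding bchoice_iff by blast
    have "ultrafilters D \<subseteq> \<Union>(w ` \<A>)"
    proof
      fix U assume U: "U \<in> ultrafilters D"
      have "\<exists>A\<in>\<A>. - A \<in> U"
      proof (rule ccontr)
        assume "\<not> (\<exists>A\<in>\<A>. - A \<in> U)"
        then have "\<forall>A\<in>\<A>. A \<in> U" using ultrafiltersD(5)[OF U] by metis
        then have "\<forall>A\<in>\<A>. eventually (\<lambda>d. d \<in> A) (ufilter U)" by (simp add: eventually_ufilter[OF U])
        with that(1) have "eventually (\<lambda>d. \<forall>A\<in>\<A>. d \<in> A) (ufilter U)"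
          by (simp add: eventually_ball_finite)
        moreover have "eventually (\<lambda>d. d \<in> D) (ufilter U)" using U by (rule eventually_ufilter_carrier)
        ultimately have "eventually (\<lambda>d. False) (ufilter U)" by eventually_elim (use e in blast)
        then show False using ufilter_neq_bot[OF U] by simp
      qed
      then show "U \<in> \<Union>(w ` \<A>)" using w(2) U by (auto simp: B_def)
    qed
    then show False using no w(1) that(1) by (metis finite_imageI image_subsetI)
  qed
  obtain U where U: "U \<in> ultrafilters D" "H \<subseteq> U" using ultrafilter_extension[OF fip] by blast
  then obtain W where W: "W \<in> \<U>" "U \<in> W" using cov by blast
  then have "openin (ultra_topology D) W" using op by blast
  then obtain A where "A \<in> U" "\<forall>V\<in>ultrafilters D. A \<in> V \<longrightarrow> V \<in> W"
    using W(2) by (auto simp: openin_ultra_topology)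
  then have "A \<in> U" "B A \<subseteq> W" by (auto simp: B_def)
  then show False using W(1) U ultrafiltersD(6)[OF U(1), of A] by (auto simp: H_def)
qed

text \<open>The map q is the Stone-Cech extension of f. A limit is only known to stay in closed
  sets, so regularity of T is used to place an open V inside a closed C inside W: values that are
  eventually in V have their limit in C.\<close>

lemma continuous_map_ultrafilter_limit:
  assumes T: "compact_space T" "Hausdorff_space T"
    and q: "\<And>U. U \<in> ultrafilters D \<Longrightarrow> limitin T f (q U) (ufilter U)"
  shows "continuous_map (ultra_topology D) T q"
  unfolding continuous_map_def topspace_ultra_topology Pi_iff
proof (intro conjI allI impI ballI)
  show "q U \<in> topspace T" if "U \<in> ultrafilters D" for U using q[OF that] by (rule limitin_topspace)
next
  fix W assume W: "openin T W"
  have reg: "regular_space T" using T by (simp add: compact_Hausdorff_imp_regular_space)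
  show "openin (ultra_topology D) {U \<in> ultrafilters D. q U \<in> W}"
    unfolding openin_ultra_topology
  proof (intro conjI ballI)
    fix U assume "U \<in> {U \<in> ultrafilters D. q U \<in> W}"
    then have U: "U \<in> ultrafilters D" "q U \<in> W" by auto
    obtain V C where V: "openin T V" "closedin T C" "q U \<in> V" "V \<subseteq> C" "C \<subseteq> W"
      using reg W U(2) unfolding neighbourhood_base_of_closedin[symmetric] neighbourhood_base_of by metis
    have "{d. f d \<in> V} \<in> U"
      using limitinD[OF q[OF U(1)] V(1,3)] by (simp add: eventually_ufilter[OF U(1)])
    moreover have "q U' \<in> W" if U': "U' \<in> ultrafilters D" "{d. f d \<in> V} \<in> U'" for U'
    proof -
      have "eventually (\<lambda>d. f d \<in> C) (ufilter U')"
        unfolding eventually_ufilter[OF U'(1)] using V(4) by (intro ultrafiltersD(3)[OF U']) auto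
      then have "q U' \<in> C"
        using limitin_closedin[OF q[OF U'(1)] V(2)] ufilter_neq_bot[OF U'(1)] by blast
      then show ?thesis using V(5) by blast
    qed
    ultimately show "\<exists>A\<in>U. \<forall>V\<in>ultrafilters D. A \<in> V \<longrightarrow> V \<in> {U \<in> ultrafilters D. q U \<in> W}"
      by blast
  qed auto
qed

section \<open>Image ultrafilters\<close>

definition push :: "('d \<Rightarrow> 'd) \<Rightarrow> 'd set set \<Rightarrow> 'd set set" where
  "push \<sigma> U = {A. \<sigma> -` A \<in> U}"

lemma push_in_ultrafilters:
  assumes "\<sigma> \<in> D \<rightarrow> D" "U \<in> ultrafilters D"
  shows "push \<sigma> U \<in> ultrafilters D"
proof -
  have "D \<subseteq> \<sigma> -` D" using assms(1) by auto
  then have "\<sigma> -` D \<in> U" by (rule ultrafiltersD(3)[OF assms(2) ultrafiltersD(1)[OF assms(2)]])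
  moreover have "\<sigma> -` B \<in> U" if "\<sigma> -` A \<in> U" "A \<subseteq> B" for A B
    by (rule ultrafiltersD(3)[OF assms(2) that(1)]) (use that(2) in blast)
  moreover have "\<sigma> -` A \<in> U \<or> - \<sigma> -` A \<in> U" for A
    using ultrafiltersD(5)[OF assms(2)] by blast
  ultimately show ?thesis
    using ultrafiltersD(2,4)[OF assms(2)]
    by (simp add: ultrafilters_def[of D] push_def vimage_Int vimage_Compl)
qed

text \<open>Values off D are irrelevant because D belongs to U. The laws of the translation action
  hold on \<open>carrier G \<times> S\<close> only, and this lemma carries them over to
  ultrafilters.\<close>

lemma push_cong:
  assumes "U \<in> ultrafilters D" "\<And>d. d \<in> D \<Longrightarrow> \<sigma> d = \<tau> d"
  shows "push \<sigma> U = push \<tau> U"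
proof -
  have "\<sigma> -` A \<in> U \<Longrightarrow> \<tau> -` A \<in> U" if "\<And>d. d \<in> D \<Longrightarrow> \<sigma> d = \<tau> d" for A \<sigma> \<tau>
  proof -
    assume "\<sigma> -` A \<in> U"
    then have "D \<inter> \<sigma> -` A \<in> U" by (rule ultrafiltersD(4)[OF assms(1) ultrafiltersD(1)[OF assms(1)]])
    moreover have "D \<inter> \<sigma> -` A \<subseteq> \<tau> -` A" using that by auto
    ultimately show ?thesis by (rule ultrafiltersD(3)[OF assms(1)])
  qed
  from this[of \<sigma> \<tau>] this[of \<tau> \<sigma>] show ?thesis using assms(2) by (auto simp: push_def)
qed

lemma ufilter_push:
  assumes "\<sigma> \<in> D \<rightarrow> D" "U \<in> ultrafilters D"
  shows "ufilter (push \<sigma> U) = filtermap \<sigma> (ufilter U)"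
  unfolding filter_eq_iff eventually_ufilter[OF push_in_ultrafilters[OF assms]] eventually_filtermap
    eventually_ufilter[OF assms(2)]
  by (simp add: push_def vimage_def)

lemma continuous_map_push:
  assumes "\<sigma> \<in> D \<rightarrow> D"
  shows "continuous_map (ultra_topology D) (ultra_topology D) (push \<sigma>)"
  unfolding continuous_map_def topspace_ultra_topology Pi_iff
proof (intro conjI allI impI ballI)
  show "push \<sigma> U \<in> ultrafilters D" if "U \<in> ultrafilters D" for U
    using assms that by (rule push_in_ultrafilters)
  fix W assume W: "openin (ultra_topology D) W"
  show "openin (ultra_topology D) {U \<in> ultrafilters D. push \<sigma> U \<in> W}"
    unfolding openin_ultra_topology
  proof (intro conjI ballI)
    fix U assume "U \<in> {U \<in> ultrafilters D. push \<sigma> U \<in> W}"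
    then have U: "U \<in> ultrafilters D" "push \<sigma> U \<in> W" by auto
    then obtain A where A: "A \<in> push \<sigma> U" "\<And>V. V \<in> ultrafilters D \<Longrightarrow> A \<in> V \<Longrightarrow> V \<in> W"
      using W by (auto simp: openin_ultra_topology)
    show "\<exists>A\<in>U. \<forall>V\<in>ultrafilters D. A \<in> V \<longrightarrow> V \<in> {U \<in> ultrafilters D. push \<sigma> U \<in> W}"
      using A push_in_ultrafilters[OF assms] by (intro bexI[of _ "\<sigma> -` A"]) (auto simp: push_def)
  qed auto
qed

section \<open>Group actions and the test G-spaces\<close>

text \<open>An action is a homomorphism into \<open>BijGroup E\<close>, whose elements are
  extensional bijections composed with restriction to E. Bijectivity of \<phi> g follows from the
  laws, the action of the inverse element being the inverse map.\<close>

lemma group_actionI: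
  assumes G: "group G"
    and extn: "\<And>g. g \<in> carrier G \<Longrightarrow> \<phi> g \<in> extensional E"
    and closed: "\<And>g x. g \<in> carrier G \<Longrightarrow> x \<in> E \<Longrightarrow> \<phi> g x \<in> E"
    and one: "\<And>x. x \<in> E \<Longrightarrow> \<phi> \<one>\<^bsub>G\<^esub> x = x"
    and mult: "\<And>g h x. g \<in> carrier G \<Longrightarrow> h \<in> carrier G \<Longrightarrow> x \<in> E \<Longrightarrow> \<phi> (g \<otimes>\<^bsub>G\<^esub> h) x = \<phi> g (\<phi> h x)"
  shows "group_action G E \<phi>"
proof -
  interpret group G by fact
  have bij: "\<phi> g \<in> Bij E" if g: "g \<in> carrier G" for g
  proof -
    have "bij_betw (\<phi> g) E E"
      using g closed mult[of g "inv\<^bsub>G\<^esub> g"] mult[of "inv\<^bsub>G\<^esub> g" g] one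
      by (intro bij_betwI[where g = "\<phi> (inv\<^bsub>G\<^esub> g)"]) auto
    then show ?thesis using extn[OF g] by (simp add: Bij_def)
  qed
  have "\<phi> (g \<otimes>\<^bsub>G\<^esub> h) = compose E (\<phi> g) (\<phi> h)" if "g \<in> carrier G" "h \<in> carrier G" for g h
    using that extn[of "g \<otimes>\<^bsub>G\<^esub> h"] mult[OF that] by (intro HOL.ext) (auto simp: compose_def extensional_def)
  then have "\<phi> \<in> hom G (BijGroup E)" using bij by (intro homI) (auto simp: BijGroup_def)
  then show ?thesis
    by (simp add: group_action_def group_hom_def group_hom_axioms_def group_BijGroup G)
qed

lemma group_action_inv_cancel:
  assumes "group_action G E \<phi>" "g \<in> carrier G" "x \<in> E"
  shows "\<phi> (inv\<^bsub>G\<^esub> g) (\<phi> g x) = x" and "\<phi> g (\<phi> (inv\<^bsub>G\<^esub> g) x) = x"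
proof -
  interpret group_action G E \<phi> by fact
  interpret group G using group_hom group_hom.axioms(1) by auto
  have "\<phi> \<one>\<^bsub>G\<^esub> x = x" using id_eq_one assms(3) by (metis restrict_apply')
  then show "\<phi> (inv\<^bsub>G\<^esub> g) (\<phi> g x) = x" "\<phi> g (\<phi> (inv\<^bsub>G\<^esub> g) x) = x"
    using composition_rule[OF assms(3), of "inv\<^bsub>G\<^esub> g" g] composition_rule[OF assms(3), of g "inv\<^bsub>G\<^esub> g"]
      assms(2) by auto
qed

lemma G_spaceI:
  assumes "compact_space X" "Hausdorff_space X" "group_action G (topspace X) \<alpha>"
    and cont: "\<And>g. g \<in> carrier G \<Longrightarrow> continuous_map X X (\<alpha> g)"
  shows "G_space G X \<alpha>"
  unfolding G_space_def
proof (intro conjI ballI assms(1-3))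
  fix g assume g: "g \<in> carrier G"
  interpret group_action G "topspace X" \<alpha> by fact
  interpret group G using group_hom group_hom.axioms(1) by auto
  show "homeomorphic_map X X (\<alpha> g)"
    unfolding homeomorphic_map_maps homeomorphic_maps_def
    using g cont group_action_inv_cancel[OF assms(3)] by (intro exI[of _ "\<alpha> (inv\<^bsub>G\<^esub> g)"]) auto
qed

text \<open>Only the group coordinate moves, so G \<times> S is a union of copies of G, one for each
  point of S. An equivariant map out of it can be prescribed freely on the slice over the unit
  element; this is what makes a pointwise choice of functionals possible later.\<close>

definition shift :: "('g, 'm) monoid_scheme \<Rightarrow> 'g \<Rightarrow> 'g \<times> 'x \<Rightarrow> 'g \<times> 'x" where
  "shift G g = (\<lambda>(h, x). (g \<otimes>\<^bsub>G\<^esub> h, x))"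

definition ultra_action :: "('g, 'm) monoid_scheme \<Rightarrow> 'x set \<Rightarrow> 'g \<Rightarrow> ('g \<times> 'x) set set \<Rightarrow> ('g \<times> 'x) set set" where
  "ultra_action G S g = restrict (push (shift G g)) (ultrafilters (carrier G \<times> S))"

lemma shift_closed:
  assumes "group G" "g \<in> carrier G"
  shows "shift G g \<in> carrier G \<times> S \<rightarrow> carrier G \<times> S"
  using assms by (auto simp: shift_def group.is_monoid monoid.m_closed)

lemma G_space_ultra:
  assumes G: "group G"
  shows "G_space G (ultra_topology (carrier G \<times> S)) (ultra_action G S)"
proof (rule G_spaceI[OF compact_ultra_topology Hausdorff_ultra_topology])
  interpret group G by fact
  show "group_action G (topspace (ultra_topology (carrier G \<times> S))) (ultra_action G S)"
    unfolding topspace_ultra_topology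
  proof (rule group_actionI[OF G])
    show "ultra_action G S g \<in> extensional (ultrafilters (carrier G \<times> S))" for g
      by (simp add: ultra_action_def)
    show c: "ultra_action G S g U \<in> ultrafilters (carrier G \<times> S)"
      if "g \<in> carrier G" "U \<in> ultrafilters (carrier G \<times> S)" for g U
      using that push_in_ultrafilters[OF shift_closed[OF G]] by (simp add: ultra_action_def)
    show "ultra_action G S \<one>\<^bsub>G\<^esub> U = U" if U: "U \<in> ultrafilters (carrier G \<times> S)" for U
    proof -
      have "push (shift G \<one>\<^bsub>G\<^esub>) U = push id U"
        using U by (rule push_cong) (auto simp: shift_def)
      then show ?thesis using U by (simp add: ultra_action_def push_def)
    qed
    show "ultra_action G S (g \<otimes>\<^bsub>G\<^esub> h) U = ultra_action G S g (ultra_action G S h U)"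
      if gh: "g \<in> carrier G" "h \<in> carrier G" and U: "U \<in> ultrafilters (carrier G \<times> S)" for g h U
    proof -
      have "push (shift G (g \<otimes>\<^bsub>G\<^esub> h)) U = push (shift G g \<circ> shift G h) U"
        using U by (rule push_cong) (auto simp: shift_def m_assoc gh)
      also have "\<dots> = push (shift G g) (push (shift G h) U)" by (simp add: push_def vimage_comp)
      finally show ?thesis
        using U push_in_ultrafilters[OF shift_closed[OF G gh(2)] U] by (simp add: ultra_action_def)
    qed
  qed
  show "continuous_map (ultra_topology (carrier G \<times> S)) (ultra_topology (carrier G \<times> S)) (ultra_action G S g)"
    if "g \<in> carrier G" for g
    using continuous_map_push[OF shift_closed[OF G that]]
    by (rule continuous_map_eq) (simp add: ultra_action_def)
qed


text \<open>A copy of \<open>X\<close> inside the type of the ultrafilters, so that it can serve as a test space.\<close>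

definition point_code :: "'x \<Rightarrow> ('g \<times> 'x) set set" where
  "point_code x = {{(undefined, x)}}"

definition point_decode :: "('g \<times> 'x) set set \<Rightarrow> 'x" where
  "point_decode U = snd (the_elem (the_elem U))"

lemma point_decode_code [simp]: "point_decode (point_code x) = x"
  by (simp add: point_decode_def point_code_def)

definition code_topology :: "'x topology \<Rightarrow> ('g \<times> 'x) set set topology" where
  "code_topology X = pullback_topology (point_code ` topspace X) point_decode X"

lemma topspace_code_topology [simp]: "topspace (code_topology X) = point_code ` topspace X"
  by (auto simp: code_topology_def topspace_pullback_topology)

lemma homeomorphic_maps_code: "homeomorphic_maps X (code_topology X) point_code point_decode"
  unfolding homeomorphic_maps_def
proof (intro conjI)
  have "continuous_map X X (point_decode \<circ> point_code)"
    by (rule continuous_map_eq[OF continuous_map_id]) simp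
  then show "continuous_map X (code_topology X) point_code"
    unfolding code_topology_def by (rule continuous_map_pullback') auto
  have "continuous_map (code_topology X) X (id \<circ> point_decode)"
    unfolding code_topology_def by (rule continuous_map_pullback) (rule continuous_map_id)
  then show "continuous_map (code_topology X) X point_decode" by simp
qed auto

definition code_action :: "'x topology \<Rightarrow> ('g \<Rightarrow> 'x \<Rightarrow> 'x) \<Rightarrow> 'g \<Rightarrow> ('g \<times> 'x) set set \<Rightarrow> ('g \<times> 'x) set set" where
  "code_action X \<alpha> g = restrict (point_code \<circ> \<alpha> g \<circ> point_decode) (point_code ` topspace X)"

lemma G_spaceD:
  assumes "G_space G X \<alpha>"
  shows "compact_space X" and "Hausdorff_space X" and "group_action G (topspace X) \<alpha>"
    and "g \<in> carrier G \<Longrightarrow> continuous_map X X (\<alpha> g)"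
    and "g \<in> carrier G \<Longrightarrow> x \<in> topspace X \<Longrightarrow> \<alpha> g x \<in> topspace X"
  using assms group_action.element_image
  by (fastforce simp: G_space_def homeomorphic_imp_continuous_map)+

lemma group_action_one:
  assumes "group_action G E \<phi>" "x \<in> E"
  shows "\<phi> \<one>\<^bsub>G\<^esub> x = x"
  using group_action.id_eq_one[OF assms(1)] assms(2) by (metis restrict_apply')

lemma G_space_code:
  assumes G: "group G" and X: "G_space G X \<alpha>"
  shows "G_space G (code_topology X :: ('g \<times> 'x) set set topology) (code_action X \<alpha>)"
proof (rule G_spaceI)
  note D = G_spaceD[OF X]
  let ?T = "code_topology X :: ('g \<times> 'x) set set topology"
  have hom: "X homeomorphic_space ?T"
    using homeomorphic_maps_code unfolding homeomorphic_space_def by blast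
  show "compact_space ?T" using homeomorphic_compact_space[OF hom] D(1) by simp
  show "Hausdorff_space ?T" using homeomorphic_Hausdorff_space[OF hom] D(2) by simp
  show "group_action G (topspace ?T) (code_action X \<alpha>)"
    unfolding topspace_code_topology
    by (rule group_actionI[OF G])
      (auto simp: code_action_def D(5) group_action_one[OF D(3)] group_action.composition_rule[OF D(3)])
  show "continuous_map ?T ?T (code_action X \<alpha> g)" if "g \<in> carrier G" for g
  proof -
    have "continuous_map ?T ?T (point_code \<circ> (\<alpha> g \<circ> point_decode))"
      using homeomorphic_maps_code[of X] D(4)[OF that] unfolding homeomorphic_maps_def
      by (intro continuous_map_compose[of _ X]) auto
    then show ?thesis by (rule continuous_map_eq) (auto simp: code_action_def)
  qed
qed

definition principal :: "'d \<Rightarrow> 'd set set" where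
  "principal d = {A. d \<in> A}"

lemma principal_in_ultrafilters: "d \<in> D \<Longrightarrow> principal d \<in> ultrafilters D"
  by (auto simp: principal_def ultrafilters_def)

text \<open>
  Lifting the identity of \<open>X\<close> along the orbit map \<open>(g, x) \<mapsto> g \<cdot> x\<close>, extended to the ultrafilters
  on \<open>G \<times> X\<close>.
\<close>
lemma G_projective_section:
  fixes G :: "('g, 'm) monoid_scheme" and X :: "'x topology"
  assumes G: "group G" and proj: "G_projective TYPE(('g \<times> 'x) set set) G X \<alpha>"
  obtains r where
    "G_map G X \<alpha> (ultra_topology (carrier G \<times> topspace X)) (ultra_action G (topspace X)) r"
    "\<And>y. y \<in> topspace X \<Longrightarrow> limitin X (\<lambda>(g, x). \<alpha> g x) y (ufilter (r y))"
proof -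
  interpret group G by fact
  let ?S = "topspace X" let ?D = "carrier G \<times> topspace X" let ?f = "\<lambda>(g, x). \<alpha> g x"
  let ?T = "code_topology X :: ('g \<times> 'x) set set topology"
  have X: "G_space G X \<alpha>" using proj by (simp add: G_projective_def)
  note D = G_spaceD[OF X]
  have "\<forall>U\<in>ultrafilters ?D. \<exists>l. limitin X ?f l (ufilter U)"
    using D by (intro ballI ultrafilter_limit_exists) auto
  then obtain q where q: "\<And>U. U \<in> ultrafilters ?D \<Longrightarrow> limitin X ?f (q U) (ufilter U)"
    unfolding bchoice_iff by blast
  have qI: "q U = l" if "U \<in> ultrafilters ?D" "limitin X ?f l (ufilter U)" for U l
    using limitin_Hausdorff_unique[OF q that(2)] that ufilter_neq_bot D(2) by blast
  have qc: "continuous_map (ultra_topology ?D) X q"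
    using D q by (intro continuous_map_ultrafilter_limit)
  \<comment> \<open>Since \<alpha> g is continuous, it may be taken inside the limit, where it turns
    the orbit map into the orbit map after \<open>shift G g\<close>; a limit of the latter is a
    limit along the image ultrafilter.\<close>
  have qe: "q (ultra_action G ?S g U) = \<alpha> g (q U)" if g: "g \<in> carrier G" and U: "U \<in> ultrafilters ?D" for g U
  proof -
    note sc = shift_closed[OF G g, of ?S]
    have "limitin X (\<alpha> g \<circ> ?f) (\<alpha> g (q U)) (ufilter U)"
      by (rule continuous_map_limit[OF D(4)[OF g] q[OF U]])
    moreover have "eventually (\<lambda>d. (\<alpha> g \<circ> ?f) d = ?f (shift G g d)) (ufilter U)"
      using U by (rule eventually_ufilter_carrier)
        (auto simp: shift_def group_action.composition_rule[OF D(3)] g)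
    ultimately have "limitin X (\<lambda>d. ?f (shift G g d)) (\<alpha> g (q U)) (ufilter U)"
      by (rule limitin_transform_eventually[rotated])
    then have "limitin X ?f (\<alpha> g (q U)) (ufilter (push (shift G g) U))"
      by (simp add: ufilter_push[OF sc U] limitin_def eventually_filtermap)
    then show ?thesis
      using qI[OF push_in_ultrafilters[OF sc U]] U by (simp add: ultra_action_def)
  qed
  \<comment> \<open>This yields surjectivity of q: along a principal ultrafilter the limit is the
    value at its point, and the orbit map sends \<open>(\<one>, x)\<close> to x.\<close>
  have qs: "q (principal (\<one>\<^bsub>G\<^esub>, x)) = x" if "x \<in> ?S" for x
  proof (rule qI)
    show p: "principal (\<one>\<^bsub>G\<^esub>, x) \<in> ultrafilters ?D"
      using that by (intro principal_in_ultrafilters) auto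
    show "limitin X ?f x (ufilter (principal (\<one>\<^bsub>G\<^esub>, x)))"
      using that group_action_one[OF D(3) that]
      by (intro limitin_eventually, simp, subst eventually_ufilter[OF p]) (simp add: principal_def)
  qed
  \<comment> \<open>Both test spaces must have points of the same type, so X is replaced as target
    by its coded copy.\<close>
  define h where "h = (point_code \<circ> q :: _ \<Rightarrow> ('g \<times> 'x) set set)"
  have cc: "continuous_map X ?T point_code"
    using homeomorphic_maps_code[of X] by (auto simp: homeomorphic_maps_def)
  have qin: "q U \<in> ?S" if "U \<in> ultrafilters ?D" for U using q[OF that] by (rule limitin_topspace)
  have "G_map G (ultra_topology ?D) (ultra_action G ?S) ?T (code_action X \<alpha>) h"
    unfolding G_map_def equivariant_on_def h_def
    using continuous_map_compose[OF qc cc] qe qin by (simp add: code_action_def)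
  moreover have "h ` topspace (ultra_topology ?D) = topspace ?T"
  proof
    show "h ` topspace (ultra_topology ?D) \<subseteq> topspace ?T" using qin by (auto simp: h_def)
    show "topspace ?T \<subseteq> h ` topspace (ultra_topology ?D)"
    proof
      fix u assume "u \<in> topspace ?T"
      then obtain x where "x \<in> ?S" "u = point_code x" by auto
      then show "u \<in> h ` topspace (ultra_topology ?D)"
        using qs[of x] principal_in_ultrafilters[of "(\<one>\<^bsub>G\<^esub>, x)" ?D]
        by (auto simp: h_def intro!: image_eqI[of _ _ "principal (\<one>\<^bsub>G\<^esub>, x)"])
    qed
  qed
  moreover have "G_map G X \<alpha> ?T (code_action X \<alpha>) point_code"
    unfolding G_map_def equivariant_on_def using cc by (simp add: code_action_def)
  ultimately obtain r where r: "G_map G X \<alpha> (ultra_topology ?D) (ultra_action G ?S) r"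
    and hr: "\<And>p. p \<in> ?S \<Longrightarrow> h (r p) = point_code p"
    using proj G_space_code[OF G X] G_space_ultra[OF G, of ?S] unfolding G_projective_def by metis
  have "limitin X ?f y (ufilter (r y))" if y: "y \<in> ?S" for y
  proof -
    have "r \<in> ?S \<rightarrow> ultrafilters ?D"
      using r by (simp add: G_map_def continuous_map_def)
    then have "r y \<in> ultrafilters ?D" using y by (rule funcset_mem)
    moreover have "q (r y) = y" using arg_cong[OF hr[OF y], of point_decode] by (simp add: h_def)
    ultimately show ?thesis using q[of "r y"] by simp
  qed
  then show ?thesis using that r by blast
qed

section \<open>The spaces of continuous functions as G-objects\<close>

lemma l2norm_L2_set: "l2norm v = L2_set (\<lambda>i. cmod (vec_index v i)) {..<dim_vec v}"
  by (simp add: l2norm_def L2_set_def)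

lemma l2norm_nonneg [simp]: "0 \<le> l2norm v"
  by (simp add: l2norm_L2_set L2_set_nonneg)

lemma l2norm_triangle:
  assumes "dim_vec v = dim_vec w"
  shows "l2norm (v + w) \<le> l2norm v + l2norm w"
proof -
  have "l2norm (v + w) \<le> L2_set (\<lambda>i. cmod (vec_index v i) + cmod (vec_index w i)) {..<dim_vec w}"
    unfolding l2norm_L2_set using assms by (simp, intro L2_set_mono) (auto simp: norm_triangle_ineq)
  also have "\<dots> \<le> l2norm v + l2norm w"
    unfolding l2norm_L2_set assms by (rule L2_set_triangle_ineq)
  finally show ?thesis .
qed

lemma l2norm_smult: "l2norm (c \<cdot>\<^sub>v v) = cmod c * l2norm v"
  unfolding l2norm_L2_set L2_set_right_distrib[OF norm_ge_zero]
  by (simp, intro L2_set_cong) (simp_all add: norm_mult)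

lemma l2norm_eq_0: "l2norm v = 0 \<longleftrightarrow> v = 0\<^sub>v (dim_vec v)"
proof -
  have "l2norm v = 0 \<longleftrightarrow> (\<forall>i<dim_vec v. vec_index v i = 0)"
    by (simp add: l2norm_L2_set L2_set_eq_0_iff Ball_def)
  also have "\<dots> \<longleftrightarrow> v = 0\<^sub>v (dim_vec v)" by (metis eq_vecI index_zero_vec)
  finally show ?thesis .
qed

lemma cmod_le_l2norm: "i < dim_vec v \<Longrightarrow> cmod (vec_index v i) \<le> l2norm v"
  unfolding l2norm_L2_set by (intro member_le_L2_set) auto

lemma l2norm_append:
  "(l2norm (v @\<^sub>v w))\<^sup>2 = (l2norm v)\<^sup>2 + (l2norm w)\<^sup>2"
proof -
  have sq: "(l2norm u)\<^sup>2 = (\<Sum>i<dim_vec u. (cmod (vec_index u i))\<^sup>2)" for u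
    by (simp add: l2norm_def sum_nonneg)
  have "(\<Sum>i<n + m. f i) = (\<Sum>i<n. f i) + (\<Sum>i<m. f (n + i))" for f :: "nat \<Rightarrow> real" and n m
    by (induction m) (simp_all add: add.assoc)
  then show ?thesis by (simp add: sq)
qed

lemma mult_mat_vec_index:
  "i < dim_row a \<Longrightarrow> vec_index (a *\<^sub>v v) i = (\<Sum>j<dim_vec v. a $$ (i, j) * vec_index v j)"
  if "dim_vec v = dim_col a" for a :: "'a::semiring_0 mat"
  using that by (simp add: scalar_prod_def atLeast0LessThan)

text \<open>A crude bound whose purpose is finiteness: of the supremum in \<open>opnorm\<close> and,
  over a compact space, of the supremum in the matrix norms of \<open>C_opspace\<close>.\<close>

lemma l2norm_mult_mat_vec_entries:
  assumes "dim_vec v = dim_col a"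
  shows "l2norm (a *\<^sub>v v) \<le> (\<Sum>i<dim_row a. \<Sum>j<dim_col a. cmod (a $$ (i, j))) * l2norm v"
proof -
  have "l2norm (a *\<^sub>v v) \<le> (\<Sum>i<dim_row a. cmod (vec_index (a *\<^sub>v v) i))"
    unfolding l2norm_L2_set by (rule order_trans[OF L2_set_le_sum]) simp_all
  also have "\<dots> \<le> (\<Sum>i<dim_row a. \<Sum>j<dim_col a. cmod (a $$ (i, j)) * l2norm v)"
  proof (rule sum_mono)
    fix i assume "i \<in> {..<dim_row a}"
    then have "cmod (vec_index (a *\<^sub>v v) i) \<le> (\<Sum>j<dim_col a. cmod (a $$ (i, j) * vec_index v j))"
      using assms by (simp add: mult_mat_vec_index norm_sum del: index_mult_mat_vec)
    also have "\<dots> \<le> (\<Sum>j<dim_col a. cmod (a $$ (i, j)) * l2norm v)"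
      using assms by (intro sum_mono) (simp add: norm_mult mult_left_mono cmod_le_l2norm)
    finally show "cmod (vec_index (a *\<^sub>v v) i) \<le> (\<Sum>j<dim_col a. cmod (a $$ (i, j)) * l2norm v)" .
  qed
  finally show ?thesis by (simp add: sum_distrib_right)
qed

lemma opnorm_bdd: "bdd_above {l2norm (a *\<^sub>v v) | v. v \<in> carrier_vec (dim_col a) \<and> l2norm v \<le> 1}"
proof (rule bdd_aboveI, clarify)
  fix v :: "complex Matrix.vec" assume v: "v \<in> carrier_vec (dim_col a)" "l2norm v \<le> 1"
  let ?K = "\<Sum>i<dim_row a. \<Sum>j<dim_col a. cmod (a $$ (i, j))"
  have "?K * l2norm v \<le> ?K * 1" using v(2) by (intro mult_left_mono sum_nonneg) auto
  then show "l2norm (a *\<^sub>v v) \<le> ?K" using l2norm_mult_mat_vec_entries[of v a] v by simp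
qed

lemma opnorm_nonneg [simp]: "0 \<le> opnorm a"
proof -
  have "l2norm (a *\<^sub>v 0\<^sub>v (dim_col a)) \<le> opnorm a"
    unfolding opnorm_def using l2norm_eq_0[of "0\<^sub>v (dim_col a)"]
    by (intro cSup_upper[OF _ opnorm_bdd]) (auto intro!: exI[of _ "0\<^sub>v (dim_col a)"])
  then show ?thesis using l2norm_nonneg order_trans by blast
qed

lemma l2norm_mult_mat_vec:
  assumes v: "v \<in> carrier_vec (dim_col a)"
  shows "l2norm (a *\<^sub>v v) \<le> opnorm a * l2norm v"
proof (cases "l2norm v = 0")
  case True
  then show ?thesis using l2norm_mult_mat_vec_entries[of v a] v by simp
next
  case False
  then have pos: "l2norm v > 0" using l2norm_nonneg[of v] by linarith
  \<comment> \<open>Normalisation brings v into the unit ball over which \<open>opnorm\<close> takes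
    its supremum.\<close>
  let ?w = "complex_of_real (1 / l2norm v) \<cdot>\<^sub>v v"
  have "l2norm ?w = 1" using pos by (simp add: l2norm_smult norm_divide)
  moreover have "?w \<in> carrier_vec (dim_col a)" using v by simp
  ultimately have "l2norm (a *\<^sub>v ?w) \<le> opnorm a"
    unfolding opnorm_def by (intro cSup_upper[OF _ opnorm_bdd]) force
  moreover have "a *\<^sub>v ?w = complex_of_real (1 / l2norm v) \<cdot>\<^sub>v (a *\<^sub>v v)"
    using v mult_mat_vec[of a "dim_row a" "dim_col a" v] by auto
  ultimately have "l2norm (a *\<^sub>v v) / l2norm v \<le> opnorm a"
    using pos by (simp add: l2norm_smult norm_divide)
  then show ?thesis using pos by (simp add: field_simps)
qed

lemma opnorm_le:
  assumes "0 \<le> K" "\<And>v. v \<in> carrier_vec (dim_col a) \<Longrightarrow> l2norm (a *\<^sub>v v) \<le> K * l2norm v"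
  shows "opnorm a \<le> K"
  unfolding opnorm_def
proof (rule cSup_least)
  have "l2norm (0\<^sub>v (dim_col a)) = 0" by (simp add: l2norm_eq_0)
  then show "{l2norm (a *\<^sub>v v) | v. v \<in> carrier_vec (dim_col a) \<and> l2norm v \<le> 1} \<noteq> {}"
    using zero_carrier_vec[of "dim_col a"] by (auto intro!: exI[of _ "0\<^sub>v (dim_col a)"])
next
  fix t assume "t \<in> {l2norm (a *\<^sub>v v) | v. v \<in> carrier_vec (dim_col a) \<and> l2norm v \<le> 1}"
  then obtain v where v: "t = l2norm (a *\<^sub>v v)" "v \<in> carrier_vec (dim_col a)" "l2norm v \<le> 1" by auto
  have "K * l2norm v \<le> K * 1" using assms(1) v(3) by (rule mult_left_mono[rotated])
  then show "t \<le> K" using assms(2)[OF v(2)] v(1) by simp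
qed

lemma opnorm_entries_le: "opnorm a \<le> (\<Sum>i<dim_row a. \<Sum>j<dim_col a. cmod (a $$ (i, j)))"
  by (rule opnorm_le) (auto intro!: sum_nonneg l2norm_mult_mat_vec_entries)

text \<open>Tested on the j-th unit vector. This is what lets a vanishing matrix norm force
  vanishing entries.\<close>

lemma entry_le_opnorm:
  assumes "i < dim_row a" "j < dim_col a"
  shows "cmod (a $$ (i, j)) \<le> opnorm a"
proof -
  have "l2norm (unit_vec (dim_col a) j) \<le> 1"
    unfolding l2norm_def using assms by (simp add: unit_vec_def if_distrib[of cmod] if_distrib[of "\<lambda>x. x\<^sup>2"] cong: if_cong)
  then have u: "opnorm a * l2norm (unit_vec (dim_col a) j) \<le> opnorm a * 1" by (intro mult_left_mono) auto
  have "cmod (a $$ (i, j)) = cmod (vec_index (a *\<^sub>v unit_vec (dim_col a) j) i)"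
    using assms by simp
  also have "\<dots> \<le> l2norm (a *\<^sub>v unit_vec (dim_col a) j)" using assms by (intro cmod_le_l2norm) simp
  also have "\<dots> \<le> opnorm a" using l2norm_mult_mat_vec[of "unit_vec (dim_col a) j" a] u by simp
  finally show ?thesis .
qed

lemma opnorm_zero [simp]: "opnorm (0\<^sub>m n m) = 0"
  using opnorm_entries_le[of "0\<^sub>m n m"] opnorm_nonneg[of "0\<^sub>m n m"] by simp

lemma opnorm_triangle:
  assumes "a \<in> carrier_mat n m" "b \<in> carrier_mat n m"
  shows "opnorm (a + b) \<le> opnorm a + opnorm b"
proof (rule opnorm_le)
  fix v :: "complex Matrix.vec" assume "v \<in> carrier_vec (dim_col (a + b))"
  then have v: "v \<in> carrier_vec m" using assms by simp
  have "l2norm ((a + b) *\<^sub>v v) \<le> l2norm (a *\<^sub>v v) + l2norm (b *\<^sub>v v)"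
    using assms by (simp add: add_mult_distrib_mat_vec[OF assms v] l2norm_triangle)
  also have "\<dots> \<le> opnorm a * l2norm v + opnorm b * l2norm v"
    using assms v by (intro add_mono l2norm_mult_mat_vec) auto
  finally show "l2norm ((a + b) *\<^sub>v v) \<le> (opnorm a + opnorm b) * l2norm v" by (simp add: algebra_simps)
qed simp

lemma opnorm_smult: "opnorm (c \<cdot>\<^sub>m a) = cmod c * opnorm a"
proof -
  have le: "opnorm (c \<cdot>\<^sub>m a) \<le> cmod c * opnorm a" for c a
  proof (rule opnorm_le)
    fix v :: "complex Matrix.vec" assume "v \<in> carrier_vec (dim_col (c \<cdot>\<^sub>m a))"
    then have v: "v \<in> carrier_vec (dim_col a)" by simp
    have "(c \<cdot>\<^sub>m a) *\<^sub>v v = c \<cdot>\<^sub>v (a *\<^sub>v v)" using v by (intro eq_vecI) auto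
    then show "l2norm ((c \<cdot>\<^sub>m a) *\<^sub>v v) \<le> cmod c * opnorm a * l2norm v"
      using l2norm_mult_mat_vec[OF v] by (simp add: l2norm_smult mult_left_mono mult.assoc)
  qed simp
  show ?thesis
  proof (cases "c = 0")
    case True
    then show ?thesis using le[of c a] by (intro antisym) simp_all
  next
    case False
    have "a = inverse c \<cdot>\<^sub>m (c \<cdot>\<^sub>m a)" using False by (intro eq_matI) auto
    then have "opnorm a \<le> inverse (cmod c) * opnorm (c \<cdot>\<^sub>m a)" using le[of "inverse c" "c \<cdot>\<^sub>m a"] by (simp add: norm_inverse)
    then have "cmod c * opnorm a \<le> opnorm (c \<cdot>\<^sub>m a)" using False by (simp add: field_simps)
    then show ?thesis using le[of c a] by simp
  qed
qed

lemma opnorm_mult: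
  assumes "a \<in> carrier_mat n m" "b \<in> carrier_mat m k"
  shows "opnorm (a * b) \<le> opnorm a * opnorm b"
proof (rule opnorm_le)
  fix v :: "complex Matrix.vec" assume "v \<in> carrier_vec (dim_col (a * b))"
  then have v: "v \<in> carrier_vec k" using assms by simp
  have "l2norm ((a * b) *\<^sub>v v) \<le> opnorm a * l2norm (b *\<^sub>v v)"
    using assms v by (simp add: assoc_mult_mat_vec[OF assms v] l2norm_mult_mat_vec)
  also have "\<dots> \<le> opnorm a * (opnorm b * l2norm v)"
    using assms v by (intro mult_left_mono l2norm_mult_mat_vec) auto
  finally show "l2norm ((a * b) *\<^sub>v v) \<le> opnorm a * opnorm b * l2norm v" by (simp add: mult.assoc)
qed simp

text \<open>The blocks act on orthogonal summands, so the squares of the norms add up and the larger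
  block norm suffices as a bound. Vectors with one zero block show that neither block norm can be
  lowered.\<close>

lemma opnorm_direct_sum: "opnorm (direct_sum_mat a b) = max (opnorm a) (opnorm b)"
proof -
  let ?d = "direct_sum_mat a b"
  have dim: "dim_row ?d = dim_row a + dim_row b" "dim_col ?d = dim_col a + dim_col b"
    by (simp_all add: direct_sum_mat_def)
  have mv: "?d *\<^sub>v (v @\<^sub>v w) = (a *\<^sub>v v) @\<^sub>v (b *\<^sub>v w)"
    if "v \<in> carrier_vec (dim_col a)" "w \<in> carrier_vec (dim_col b)" for v w :: "complex Matrix.vec"
  proof -
    have "?d *\<^sub>v (v @\<^sub>v w) = (a *\<^sub>v v + 0\<^sub>m (dim_row a) (dim_col b) *\<^sub>v w) @\<^sub>v
        (0\<^sub>m (dim_row b) (dim_col a) *\<^sub>v v + b *\<^sub>v w)"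
      unfolding direct_sum_mat_def
      by (rule four_block_mat_mult_vec[of _ "dim_row a" "dim_col a" _ "dim_col b" _ "dim_row b"]) (use that in auto)
    moreover have "a *\<^sub>v v + 0\<^sub>m (dim_row a) (dim_col b) *\<^sub>v w = a *\<^sub>v v"
      using that by (intro eq_vecI) auto
    moreover have "0\<^sub>m (dim_row b) (dim_col a) *\<^sub>v v + b *\<^sub>v w = b *\<^sub>v w"
      using that by (intro eq_vecI) auto
    ultimately show ?thesis by simp
  qed
  have sq: "l2norm (v @\<^sub>v w) = sqrt ((l2norm v)\<^sup>2 + (l2norm w)\<^sup>2)" for v w
    using l2norm_append[of v w] by (metis l2norm_nonneg real_sqrt_unique)
  have z: "l2norm (0\<^sub>v n) = 0" for n by (simp add: l2norm_eq_0)
  have "opnorm ?d \<le> max (opnorm a) (opnorm b)"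
  proof (rule opnorm_le)
    let ?M = "max (opnorm a) (opnorm b)"
    show "0 \<le> ?M" using opnorm_nonneg[of a] by linarith
    fix u :: "complex Matrix.vec" assume "u \<in> carrier_vec (dim_col ?d)"
    then have u: "u \<in> carrier_vec (dim_col a + dim_col b)" by (simp add: dim)
    define v w where "v = vec_first u (dim_col a)" and "w = vec_last u (dim_col b)"
    have vw: "v \<in> carrier_vec (dim_col a)" "w \<in> carrier_vec (dim_col b)" "u = v @\<^sub>v w"
      using u by (simp_all add: v_def w_def)
    have "l2norm (a *\<^sub>v v) \<le> ?M * l2norm v" "l2norm (b *\<^sub>v w) \<le> ?M * l2norm w"
      using l2norm_mult_mat_vec[OF vw(1)] l2norm_mult_mat_vec[OF vw(2)]
      by (meson l2norm_nonneg max.cobounded1 max.cobounded2 mult_right_mono order_trans)+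
    then have "(l2norm (a *\<^sub>v v))\<^sup>2 + (l2norm (b *\<^sub>v w))\<^sup>2 \<le> (?M * l2norm v)\<^sup>2 + (?M * l2norm w)\<^sup>2"
      by (intro add_mono power_mono) auto
    also have "\<dots> = ?M\<^sup>2 * ((l2norm v)\<^sup>2 + (l2norm w)\<^sup>2)" by (simp add: algebra_simps power_mult_distrib)
    finally have "l2norm (?d *\<^sub>v u) \<le> sqrt (?M\<^sup>2 * ((l2norm v)\<^sup>2 + (l2norm w)\<^sup>2))"
      unfolding vw(3) mv[OF vw(1,2)] sq by (rule real_sqrt_le_mono)
    then show "l2norm (?d *\<^sub>v u) \<le> ?M * l2norm u"
      using \<open>0 \<le> ?M\<close> by (simp add: vw(3) sq real_sqrt_mult)
  qed
  moreover have "opnorm a \<le> opnorm ?d"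
  proof (rule opnorm_le)
    fix v :: "complex Matrix.vec" assume v: "v \<in> carrier_vec (dim_col a)"
    let ?w = "0\<^sub>v (dim_col b)"
    have "l2norm (a *\<^sub>v v) \<le> l2norm (?d *\<^sub>v (v @\<^sub>v ?w))"
      using mv[OF v, of ?w] by (simp add: sq)
    also have "\<dots> \<le> opnorm ?d * l2norm (v @\<^sub>v ?w)" using v by (intro l2norm_mult_mat_vec) (simp add: dim)
    finally show "l2norm (a *\<^sub>v v) \<le> opnorm ?d * l2norm v" by (simp add: sq z)
  qed simp
  moreover have "opnorm b \<le> opnorm ?d"
  proof (rule opnorm_le)
    fix w :: "complex Matrix.vec" assume w: "w \<in> carrier_vec (dim_col b)"
    let ?v = "0\<^sub>v (dim_col a)"
    have "l2norm (b *\<^sub>v w) \<le> l2norm (?d *\<^sub>v (?v @\<^sub>v w))"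
      using mv[OF _ w, of ?v] by (simp add: sq)
    also have "\<dots> \<le> opnorm ?d * l2norm (?v @\<^sub>v w)" using w by (intro l2norm_mult_mat_vec) (simp add: dim)
    finally show "l2norm (b *\<^sub>v w) \<le> opnorm ?d * l2norm w" by (simp add: sq z)
  qed simp
  ultimately show ?thesis by linarith
qed


section \<open>Matrices of continuous functions; C(X) as an operator space\<close>

lemma mats_iff:
  "a \<in> mats V n \<longleftrightarrow> a \<in> carrier_mat n n \<and> (\<forall>i<n. \<forall>j<n. a $$ (i, j) \<in> carrier V)"
  by (fastforce simp: mats_def elements_mat_def)

lemma vector_space_C_scale: "vector_space C_scale"
  by unfold_locales (auto simp: C_scale_def fun_eq_iff algebra_simps)

lemma continuous_map_comp_continuous_on:
  assumes "continuous_map X euclidean u" "continuous_on UNIV f"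
  shows "continuous_map X euclidean (\<lambda>x. f (u x))"
  using continuous_map_compose[OF assms(1), of euclidean f] assms(2) by (simp add: o_def)

text \<open>Formulated for any record with this carrier and scaling, because C(X) occurs as three
  different records.\<close>

lemma is_cspace_C:
  assumes "carrier V = C_carrier X" "cscale V = C_scale"
  shows "is_cspace V"
proof -
  interpret vector_space C_scale by (rule vector_space_C_scale)
  have "subspace (C_carrier X)"
    unfolding subspace_def
    by (auto simp: C_carrier_def C_scale_def zero_fun_def plus_fun_def
        intro!: continuous_map_add continuous_map_comp_continuous_on[of _ _ "(*) c" for c] continuous_intros)
  then show ?thesis using vector_space_C_scale by (simp add: is_cspace_def assms)
qed

lemma C_opspace_simps [simp]:
  "carrier (C_opspace X) = C_carrier X" "cscale (C_opspace X) = C_scale"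
  by (simp_all add: C_opspace_def)

lemma C_opsystem_simps [simp]:
  "carrier (C_opsystem X) = C_carrier X" "cscale (C_opsystem X) = C_scale"
  "invol (C_opsystem X) = (\<lambda>u x. cnj (u x))"
  "ounit (C_opsystem X) = (\<lambda>x. if x \<in> topspace X then 1 else 0)"
  by (simp_all add: C_opsystem_def)

lemma C_banach_simps [simp]:
  "carrier (C_banach X) = C_carrier X" "cscale (C_banach X) = C_scale"
  by (simp_all add: C_banach_def)

lemma C_carrier_bounded:
  assumes "compact_space X" "u \<in> C_carrier X"
  obtains B where "B \<ge> 0" "\<And>x. cmod (u x) \<le> B"
proof -
  have "compactin euclidean (u ` topspace X)"
    using assms by (intro image_compactin[of X]) (auto simp: C_carrier_def compact_space_def)
  then have "bounded (u ` topspace X)" by (simp add: compact_imp_bounded)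
  then obtain B where "\<forall>y\<in>u ` topspace X. cmod y \<le> B" by (auto simp: bounded_iff)
  then have "cmod (u x) \<le> max 0 B" for x
    using assms(2) by (cases "x \<in> topspace X") (auto simp: C_carrier_def max.coboundedI2)
  then show ?thesis using that[of "max 0 B"] by simp
qed

text \<open>The identification of matrices over C(X) with matrix-valued functions on X. Each matrix
  axiom for C(X) is reduced through it to a fact about complex matrices at every point.\<close>

abbreviation eval_mat :: "'x \<Rightarrow> ('x \<Rightarrow> 'b) mat \<Rightarrow> 'b mat" where
  "eval_mat x a \<equiv> map_mat (\<lambda>u. u x) a"

text \<open>Compactness bounds each entry, and the sum of the entry bounds serves for all points at
  once.\<close>

lemma C_mnorm_bdd:
  assumes X: "compact_space X" and a: "a \<in> mats (C_opspace X) n"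
  shows "bdd_above (insert 0 ((\<lambda>x. opnorm (eval_mat x a)) ` topspace X))"
proof -
  have "\<forall>i<n. \<forall>j<n. \<exists>B. \<forall>x. cmod ((a $$ (i, j)) x) \<le> B"
    using a C_carrier_bounded[OF X] by (metis C_opspace_simps(1) mats_iff)
  then obtain B where B: "\<And>i j x. i < n \<Longrightarrow> j < n \<Longrightarrow> cmod ((a $$ (i, j)) x) \<le> B i j" by metis
  have "opnorm (eval_mat x a) \<le> (\<Sum>i<n. \<Sum>j<n. B i j)" for x
  proof -
    have "opnorm (eval_mat x a) \<le> (\<Sum>i<n. \<Sum>j<n. cmod ((a $$ (i, j)) x))"
      using opnorm_entries_le[of "eval_mat x a"] a by (auto simp: mats_iff)
    also have "\<dots> \<le> (\<Sum>i<n. \<Sum>j<n. B i j)" using B by (intro sum_mono) auto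
    finally show ?thesis .
  qed
  then show ?thesis by (auto intro!: bdd_aboveI2)
qed

lemma C_mnorm_nonneg:
  assumes "compact_space X" "a \<in> mats (C_opspace X) n"
  shows "0 \<le> mnorm (C_opspace X) a"
  unfolding C_opspace_def using cSup_upper[OF _ C_mnorm_bdd[OF assms]] by simp

lemma opnorm_le_C_mnorm:
  assumes "compact_space X" "a \<in> mats (C_opspace X) n" "x \<in> topspace X"
  shows "opnorm (eval_mat x a) \<le> mnorm (C_opspace X) a"
  unfolding C_opspace_def using cSup_upper[OF _ C_mnorm_bdd[OF assms(1,2)]] assms(3) by simp

text \<open>The sign condition on K accounts for the 0 inserted into the supremum.\<close>

lemma C_mnorm_le:
  assumes "0 \<le> K" "\<And>x. x \<in> topspace X \<Longrightarrow> opnorm (eval_mat x a) \<le> K"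
  shows "mnorm (C_opspace X) a \<le> K"
  unfolding C_opspace_def using assms by (auto intro!: cSup_least)

text \<open>At a point, the abstract product with two scalar matrices becomes the ordinary one. Only
  the scaling of V is fixed, so that the lemma serves the operator space and the operator system
  alike.\<close>

lemma eval_mat_sandwich:
  assumes "a \<in> carrier_mat n m" "b \<in> carrier_mat m n" "y \<in> carrier_mat m m" "cscale V = C_scale"
  shows "eval_mat x (sandwich V a y b) = a * eval_mat x y * b"
proof (rule eq_matI)
  fix i j assume ij: "i < dim_row (a * eval_mat x y * b)" "j < dim_col (a * eval_mat x y * b)"
  have sum_apply: "(\<Sum>k\<in>K. f k) x = (\<Sum>k\<in>K. f k x)" for K and f :: "nat \<Rightarrow> 'a \<Rightarrow> complex"
    by (induction K rule: infinite_finite_induct) auto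
  have "eval_mat x (sandwich V a y b) $$ (i, j) = (\<Sum>k<m. \<Sum>l<m. a $$ (i, k) * b $$ (l, j) * (y $$ (k, l)) x)"
    using ij assms by (simp add: sandwich_def sum_apply C_scale_def)
  also have "\<dots> = (a * eval_mat x y * b) $$ (i, j)"
    using ij assms
    by (simp add: scalar_prod_def atLeast0LessThan sum_distrib_right sum_distrib_left algebra_simps)
  finally show "eval_mat x (sandwich V a y b) $$ (i, j) = (a * eval_mat x y * b) $$ (i, j)" .
qed (use assms in \<open>simp_all add: sandwich_def\<close>)

lemma sandwich_in_mats:
  assumes V: "is_cspace V" and "a \<in> carrier_mat n m" "b \<in> carrier_mat m n" "x \<in> mats V m"
  shows "sandwich V a x b \<in> mats V n"
proof -
  interpret vector_space "cscale V" using V by (simp add: is_cspace_def)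
  have s: "subspace (carrier V)" using V by (simp add: is_cspace_def)
  show ?thesis
    using assms by (auto simp: mats_iff sandwich_def intro!: subspace_sum[OF s] subspace_scale[OF s])
qed

lemma add_in_mats:
  assumes V: "is_cspace V" and "x \<in> mats V n" "y \<in> mats V n"
  shows "x + y \<in> mats V n"
proof -
  interpret vector_space "cscale V" using V by (simp add: is_cspace_def)
  have s: "subspace (carrier V)" using V by (simp add: is_cspace_def)
  show ?thesis using assms by (auto simp: mats_iff intro!: subspace_add[OF s])
qed

lemma scale_in_mats:
  assumes V: "is_cspace V" and "x \<in> mats V n"
  shows "map_mat (cscale V c) x \<in> mats V n"
proof -
  interpret vector_space "cscale V" using V by (simp add: is_cspace_def)
  have s: "subspace (carrier V)" using V by (simp add: is_cspace_def)
  show ?thesis using assms by (auto simp: mats_iff intro!: subspace_scale[OF s])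
qed

lemma direct_sum_in_mats:
  assumes V: "is_cspace V" and "x \<in> mats V m" "y \<in> mats V n"
  shows "direct_sum_mat x y \<in> mats V (m + n)"
proof -
  interpret vector_space "cscale V" using V by (simp add: is_cspace_def)
  have s: "0 \<in> carrier V" using V by (auto simp: is_cspace_def intro: subspace_0)
  show ?thesis using assms s by (auto simp: mats_iff direct_sum_mat_def)
qed

lemma eval_mat_scale: "eval_mat x (map_mat (C_scale c) a) = c \<cdot>\<^sub>m eval_mat x a"
  by (intro eq_matI) (auto simp: C_scale_def)

lemma eval_mat_add:
  assumes "a \<in> carrier_mat n n" "b \<in> carrier_mat n n"
  shows "eval_mat x (a + b) = eval_mat x a + eval_mat x b"
  using assms by (intro eq_matI) auto

lemma operator_space_C:
  assumes X: "compact_space X"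
  shows "operator_space (C_opspace X)"
  unfolding operator_space_def
proof (intro conjI allI ballI)
  let ?V = "C_opspace X"
  let ?N = "mnorm ?V"
  show cs: "is_cspace ?V" by (rule is_cspace_C) simp_all
  fix n :: nat and a assume a: "a \<in> mats ?V n"
  show "0 \<le> ?N a" using X a by (rule C_mnorm_nonneg)
  show "?N a = 0 \<longleftrightarrow> a = 0\<^sub>m n n"
  proof
    assume 0: "?N a = 0"
    show "a = 0\<^sub>m n n"
    proof (rule eq_matI)
      fix i j assume "i < dim_row (0\<^sub>m n n)" "j < dim_col (0\<^sub>m n n)"
      then have ij: "i < n" "j < n" by simp_all
      have "(a $$ (i, j)) x = 0" for x
      proof (cases "x \<in> topspace X")
        case True
        have "cmod ((a $$ (i, j)) x) \<le> opnorm (eval_mat x a)"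
          using entry_le_opnorm[of i "eval_mat x a" j] ij a by (auto simp: mats_iff)
        then have "cmod ((a $$ (i, j)) x) \<le> 0" using opnorm_le_C_mnorm[OF X a True] 0 by linarith
        then show ?thesis by simp
      next
        \<comment> \<open>By the convention of \<open>C_carrier\<close>, functions vanish off
          \<open>topspace X\<close>.\<close>
        case False
        then show ?thesis using a ij by (simp add: mats_iff C_carrier_def)
      qed
      then show "a $$ (i, j) = 0\<^sub>m n n $$ (i, j)" using ij by (auto simp: zero_fun_def)
    qed (use a in \<open>auto simp: mats_iff\<close>)
  next
    assume "a = 0\<^sub>m n n"
    then have "eval_mat x a = 0\<^sub>m n n" for x by (intro eq_matI) auto
    then have "?N a \<le> 0" by (intro C_mnorm_le) simp_all
    then show "?N a = 0" using C_mnorm_nonneg[OF X a] by simp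
  qed
  show "?N (a + b) \<le> ?N a + ?N b" if b: "b \<in> mats ?V n" for b
  proof (rule C_mnorm_le)
    show "0 \<le> ?N a + ?N b" using C_mnorm_nonneg[OF X a] C_mnorm_nonneg[OF X b] by simp
    fix x assume x: "x \<in> topspace X"
    have "opnorm (eval_mat x (a + b)) \<le> opnorm (eval_mat x a) + opnorm (eval_mat x b)"
      using a b by (subst eval_mat_add) (auto simp: mats_iff intro!: opnorm_triangle[of _ n n])
    also have "\<dots> \<le> ?N a + ?N b" using a b x X by (intro add_mono opnorm_le_C_mnorm)
    finally show "opnorm (eval_mat x (a + b)) \<le> ?N a + ?N b" .
  qed
  show "?N (map_mat (cscale ?V c) a) = cmod c * ?N a" for c
  proof (rule antisym)
    have ca: "map_mat (cscale ?V c) a \<in> mats ?V n" using cs a by (rule scale_in_mats)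
    have ev: "opnorm (eval_mat x (map_mat (cscale ?V c) a)) = cmod c * opnorm (eval_mat x a)" for x
      by (simp add: eval_mat_scale opnorm_smult)
    show "?N (map_mat (cscale ?V c) a) \<le> cmod c * ?N a"
      using ev opnorm_le_C_mnorm[OF X a] C_mnorm_nonneg[OF X a]
      by (intro C_mnorm_le) (auto intro!: mult_left_mono)
    show "cmod c * ?N a \<le> ?N (map_mat (cscale ?V c) a)"
    proof (cases "c = 0")
      case True
      then show ?thesis using C_mnorm_nonneg[OF X ca] by simp
    next
      case False
      have "?N a \<le> ?N (map_mat (cscale ?V c) a) / cmod c"
        using False C_mnorm_nonneg[OF X ca] opnorm_le_C_mnorm[OF X ca]
        by (intro C_mnorm_le) (auto simp: field_simps simp flip: ev)
      then show ?thesis using False by (simp add: field_simps)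
    qed
  qed
next
  let ?V = "C_opspace X"
  let ?N = "mnorm ?V"
  have cs: "is_cspace ?V" by (rule is_cspace_C) simp_all
  fix m n :: nat and a b assume a: "a \<in> mats ?V m" and b: "b \<in> mats ?V n"
  have d: "direct_sum_mat a b \<in> mats ?V (m + n)" using cs a b by (rule direct_sum_in_mats)
  have ev: "opnorm (eval_mat x (direct_sum_mat a b)) = max (opnorm (eval_mat x a)) (opnorm (eval_mat x b))" for x
  proof -
    have "eval_mat x (direct_sum_mat a b) = direct_sum_mat (eval_mat x a) (eval_mat x b)"
      using a b by (intro eq_matI) (auto simp: direct_sum_mat_def mats_iff)
    then show ?thesis by (simp add: opnorm_direct_sum)
  qed
  show "?N (direct_sum_mat a b) = max (?N a) (?N b)"
  proof (rule antisym)
    show "?N (direct_sum_mat a b) \<le> max (?N a) (?N b)"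
    proof (rule C_mnorm_le)
      show "0 \<le> max (?N a) (?N b)" using C_mnorm_nonneg[OF X a] by (rule max.coboundedI1)
      show "opnorm (eval_mat x (direct_sum_mat a b)) \<le> max (?N a) (?N b)" if "x \<in> topspace X" for x
        unfolding ev using opnorm_le_C_mnorm[OF X a that] opnorm_le_C_mnorm[OF X b that] by (rule max.mono)
    qed
    have "?N a \<le> ?N (direct_sum_mat a b)"
      using opnorm_le_C_mnorm[OF X d] by (intro C_mnorm_le C_mnorm_nonneg[OF X d]) (auto simp: ev)
    moreover have "?N b \<le> ?N (direct_sum_mat a b)"
      using opnorm_le_C_mnorm[OF X d] by (intro C_mnorm_le C_mnorm_nonneg[OF X d]) (auto simp: ev)
    ultimately show "max (?N a) (?N b) \<le> ?N (direct_sum_mat a b)" by simp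
  qed
next
  let ?V = "C_opspace X"
  let ?N = "mnorm ?V"
  fix m n :: nat and y and a b :: "complex mat"
  assume y: "y \<in> mats ?V m" and a: "a \<in> carrier_mat n m" and b: "b \<in> carrier_mat m n"
  show "?N (sandwich ?V a y b) \<le> opnorm a * ?N y * opnorm b"
  proof (rule C_mnorm_le)
    show "0 \<le> opnorm a * ?N y * opnorm b" using C_mnorm_nonneg[OF X y] by simp
    fix x assume x: "x \<in> topspace X"
    have "y \<in> carrier_mat m m" using y by (simp add: mats_iff)
    then have "opnorm (eval_mat x (sandwich ?V a y b)) = opnorm (a * eval_mat x y * b)"
      using a b by (subst eval_mat_sandwich) auto
    also have "\<dots> \<le> opnorm (a * eval_mat x y) * opnorm b"
      using a b y by (intro opnorm_mult[of _ n m _ n]) (auto simp: mats_iff)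
    also have "\<dots> \<le> (opnorm a * opnorm (eval_mat x y)) * opnorm b"
      using a y by (intro mult_right_mono opnorm_mult[of _ n m _ m]) (auto simp: mats_iff)
    also have "\<dots> \<le> (opnorm a * ?N y) * opnorm b"
      by (intro mult_right_mono mult_left_mono opnorm_le_C_mnorm[OF X y x]) simp_all
    finally show "opnorm (eval_mat x (sandwich ?V a y b)) \<le> opnorm a * ?N y * opnorm b" .
  qed
qed

section \<open>Positivity through quadratic forms; C(X) as an operator system\<close>

text \<open>The form u* a v, conjugate-linear in u and linear in v. Vectors are plain functions on
  the natural numbers, which spares all side conditions on dimensions.\<close>

definition sesq :: "nat \<Rightarrow> complex mat \<Rightarrow> (nat \<Rightarrow> complex) \<Rightarrow> (nat \<Rightarrow> complex) \<Rightarrow> complex" where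
  "sesq n a u v = (\<Sum>i<n. \<Sum>j<n. a $$ (i, j) * v j * cnj (u i))"

lemma psd_mat_iff:
  assumes "a \<in> carrier_mat n n"
  shows "psd_mat a \<longleftrightarrow> (\<forall>v. 0 \<le> sesq n a v v)"
proof -
  have e: "(a *\<^sub>v v) \<bullet>c v = sesq n a (vec_index v) (vec_index v)" if "v \<in> carrier_vec n" for v
    using assms that
    by (simp add: sesq_def scalar_prod_def atLeast0LessThan sum_distrib_right conjugate_vec_def)
  have c: "sesq n a v v = sesq n a (vec_index (Matrix.vec n v)) (vec_index (Matrix.vec n v))" for v
    by (simp add: sesq_def)
  have sq: "square_mat a" "dim_row a = n" using assms by auto
  show ?thesis
  proof
    assume "psd_mat a"
    then have "0 \<le> sesq n a (vec_index v) (vec_index v)" if "v \<in> carrier_vec n" for v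
      using that sq by (simp add: psd_mat_def e)
    then show "\<forall>v. 0 \<le> sesq n a v v" by (subst c) simp
  qed (use sq in \<open>simp add: psd_mat_def e\<close>)
qed

text \<open>Over the complex numbers a form is determined by its diagonal: the values at u + v and u
  + i v give both the sum and the difference of the two mixed terms. With u and v standard basis
  vectors, the mixed term is an entry of the matrix.\<close>

lemma sesq_polarization:
  assumes "\<And>v. sesq n a v v = 0" and ij: "i < n" "j < n"
  shows "a $$ (i, j) = 0"
proof -
  have exp: "sesq n a (\<lambda>k. u k + c * v k) (\<lambda>k. u k + c * v k) =
      sesq n a u u + cnj c * sesq n a v u + c * sesq n a u v + c * cnj c * sesq n a v v" for u v c
    by (simp add: sesq_def algebra_simps sum.distrib sum_distrib_left)
  define u v :: "nat \<Rightarrow> complex" where "u k = (if k = i then 1 else 0)" and "v k = (if k = j then 1 else 0)" for k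
  have "sesq n a v u + sesq n a u v = 0" using exp[of u 1 v] by (simp add: assms(1))
  moreover have "- \<i> * sesq n a v u + \<i> * sesq n a u v = 0" using exp[of u \<i> v] by (simp add: assms(1))
  then have "\<i> * (sesq n a u v - sesq n a v u) = 0" by (simp add: algebra_simps)
  then have "sesq n a u v = sesq n a v u" by simp
  ultimately have "sesq n a u v = 0" by simp
  moreover have "sesq n a u v = a $$ (i, j)"
  proof -
    have "sesq n a u v = (\<Sum>k<n. \<Sum>l<n. if k = i then if l = j then a $$ (i, j) else 0 else 0)"
      unfolding sesq_def u_def v_def by (intro sum.cong refl) auto
    also have "\<dots> = (\<Sum>k<n. if k = i then \<Sum>l<n. if l = j then a $$ (i, j) else 0 else 0)"
      by (intro sum.cong refl) simp
    finally show ?thesis using ij by simp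
  qed
  ultimately show ?thesis by simp
qed

lemma cnj_sesq: "cnj (sesq n a v v) = sesq n (Matrix.mat n n (\<lambda>(i, j). cnj (a $$ (j, i)))) v v"
proof -
  have "cnj (sesq n a v v) = (\<Sum>i<n. \<Sum>j<n. cnj (a $$ (i, j)) * v i * cnj (v j))"
    by (simp add: sesq_def mult.assoc mult.commute[of "v _"])
  also have "\<dots> = (\<Sum>j<n. \<Sum>i<n. cnj (a $$ (i, j)) * v i * cnj (v j))" by (rule sum.swap)
  finally show ?thesis by (simp add: sesq_def)
qed

lemma complex_ge_0_iff: "0 \<le> (z::complex) \<longleftrightarrow> 0 \<le> Re z \<and> Im z = 0"
  by (auto simp: less_eq_complex_def)

text \<open>Nonnegative values are real, so the conjugate transpose of a has the same quadratic form
  as a; polarization applied to the difference shows that the matrices agree.\<close>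

lemma psd_mat_hermitian:
  assumes a: "a \<in> carrier_mat n n" and "psd_mat a" and ij: "i < n" "j < n"
  shows "cnj (a $$ (j, i)) = a $$ (i, j)"
proof -
  let ?b = "Matrix.mat n n (\<lambda>(i, j). cnj (a $$ (j, i)))"
  have "sesq n (?b - a) v v = 0" for v
  proof -
    have "sesq n (?b - a) v v = sesq n ?b v v - sesq n a v v"
      using a by (simp add: sesq_def algebra_simps sum_subtractf)
    also have "\<dots> = cnj (sesq n a v v) - sesq n a v v" by (simp add: cnj_sesq)
    also have "\<dots> = 0"
      using assms(2) by (simp add: psd_mat_iff[OF a] complex_ge_0_iff complex_eq_iff)
    finally show ?thesis .
  qed
  then have "(?b - a) $$ (i, j) = 0" using ij by (rule sesq_polarization)
  then show ?thesis using a ij by simp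
qed

lemma sesq_add:
  assumes "a \<in> carrier_mat n n" "b \<in> carrier_mat n n"
  shows "sesq n (a + b) v v = sesq n a v v + sesq n b v v"
  using assms by (simp add: sesq_def algebra_simps sum.distrib)

text \<open>Coarse, but explicit in the entries: it tells which multiple of the unit dominates a
  matrix of bounded functions.\<close>

lemma cmod_sesq_le:
  "cmod (sesq n a v v) \<le> (\<Sum>i<n. \<Sum>j<n. cmod (a $$ (i, j))) * (\<Sum>k<n. (cmod (v k))\<^sup>2)"
proof -
  let ?S = "\<Sum>k<n. (cmod (v k))\<^sup>2"
  have S: "?S \<ge> 0" by (simp add: sum_nonneg)
  have le: "cmod (v j) * cmod (v i) \<le> ?S" if "i < n" "j < n" for i j
  proof -
    have r: "cmod (v k) \<le> sqrt ?S" if "k < n" for k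
      using that by (intro real_le_rsqrt member_le_sum) auto
    have "cmod (v j) * cmod (v i) \<le> sqrt ?S * sqrt ?S" using r that S by (intro mult_mono) auto
    then show ?thesis using S by simp
  qed
  have "cmod (sesq n a v v) \<le> (\<Sum>i<n. \<Sum>j<n. cmod (a $$ (i, j) * v j * cnj (v i)))"
    unfolding sesq_def by (rule order_trans[OF norm_sum sum_mono[OF norm_sum]])
  also have "\<dots> \<le> (\<Sum>i<n. \<Sum>j<n. cmod (a $$ (i, j)) * ?S)"
    using le by (intro sum_mono) (auto simp: norm_mult mult.assoc intro!: mult_left_mono)
  finally show ?thesis by (simp add: sum_distrib_right)
qed

text \<open>The right side is again a diagonal value of the form of x, so positivity of x passes to
  its congruences.\<close>

lemma sesq_sandwich:
  assumes "a \<in> carrier_mat m n" "x \<in> carrier_mat m m"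
  shows "sesq n (mat_adjoint a * x * a) v v =
    sesq m x (\<lambda>k. \<Sum>i<n. a $$ (k, i) * v i) (\<lambda>k. \<Sum>i<n. a $$ (k, i) * v i)"
proof -
  have adj: "mat_adjoint a = Matrix.mat n m (\<lambda>(i, k). cnj (a $$ (k, i)))"
    using assms by (intro eq_matI) (auto simp: mat_adjoint_def mat_of_rows_def)
  have rot: "(\<Sum>j<n. \<Sum>l<m. \<Sum>k<m. f j l k) = (\<Sum>l<m. \<Sum>k<m. \<Sum>j<n. f j l k)"
    for f :: "nat \<Rightarrow> nat \<Rightarrow> nat \<Rightarrow> complex"
    by (subst sum.swap) (intro sum.cong refl sum.swap)
  let ?t = "\<lambda>i j k l. cnj (a $$ (k, i)) * x $$ (k, l) * a $$ (l, j) * v j * cnj (v i)"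
  have "sesq n (mat_adjoint a * x * a) v v = (\<Sum>i<n. \<Sum>j<n. \<Sum>l<m. \<Sum>k<m. ?t i j k l)"
    using assms unfolding sesq_def adj
    by (simp add: scalar_prod_def atLeast0LessThan sum_distrib_right)
  also have "\<dots> = (\<Sum>i<n. \<Sum>l<m. \<Sum>k<m. \<Sum>j<n. ?t i j k l)" by (intro sum.cong refl rot)
  also have "\<dots> = (\<Sum>l<m. \<Sum>k<m. \<Sum>i<n. \<Sum>j<n. ?t i j k l)" by (rule rot)
  also have "\<dots> = (\<Sum>k<m. \<Sum>l<m. \<Sum>i<n. \<Sum>j<n. ?t i j k l)" by (rule sum.swap)
  also have "\<dots> = (\<Sum>k<m. \<Sum>l<m. x $$ (k, l) * (\<Sum>j<n. a $$ (l, j) * v j) * cnj (\<Sum>i<n. a $$ (k, i) * v i))"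
    by (intro sum.cong refl, subst sum.swap) (simp add: sum_distrib_right sum_distrib_left algebra_simps)
  finally show ?thesis by (simp add: sesq_def)
qed

lemma mcone_C_iff:
  assumes "a \<in> mats (C_opsystem X) n"
  shows "a \<in> mcone (C_opsystem X) \<longleftrightarrow> (\<forall>x\<in>topspace X. \<forall>v. 0 \<le> sesq n (eval_mat x a) v v)"
proof -
  have a: "a \<in> carrier_mat n n" "elements_mat a \<subseteq> C_carrier X" using assms by (auto simp: mats_def)
  then have "eval_mat x a \<in> carrier_mat n n" for x by simp
  then show ?thesis using a by (auto simp: C_opsystem_def psd_mat_iff)
qed

lemma mcone_C_mats: "a \<in> mcone (C_opsystem X) \<Longrightarrow> a \<in> mats (C_opsystem X) (dim_row a)"
  by (auto simp: C_opsystem_def mats_def)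

lemma C_carrier_cnj: "u \<in> C_carrier X \<Longrightarrow> (\<lambda>x. cnj (u x)) \<in> C_carrier X"
  by (auto simp: C_carrier_def intro!: continuous_map_comp_continuous_on[of _ _ cnj] continuous_intros)

lemma C_carrier_eqI:
  assumes "u \<in> C_carrier X" "v \<in> C_carrier X" "\<And>x. x \<in> topspace X \<Longrightarrow> u x = v x"
  shows "u = v"
proof
  show "u x = v x" for x using assms by (cases "x \<in> topspace X") (auto simp: C_carrier_def)
qed

lemma one_in_C_carrier: "(\<lambda>x. if x \<in> topspace X then 1 else 0) \<in> C_carrier X"
  by (auto simp: C_carrier_def intro: continuous_map_eq[of _ _ "\<lambda>_. 1"])

lemma star_space_C: "star_space (C_opsystem X)"
  unfolding star_space_def
proof (intro conjI)
  show "is_cspace (C_opsystem X)" by (rule is_cspace_C) simp_all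
qed (auto simp: C_carrier_cnj C_scale_def fun_eq_iff)

lemma mat_star_C_entry:
  assumes "a \<in> carrier_mat n n" "i < n" "j < n"
  shows "mat_star (C_opsystem X) a $$ (i, j) = (\<lambda>x. cnj ((a $$ (j, i)) x))"
  using assms by (simp add: mat_star_def)

lemma matrix_ordered_C: "matrix_ordered (C_opsystem X)"
  unfolding matrix_ordered_def
proof (intro conjI allI ballI impI)
  let ?V = "C_opsystem X"
  have cs: "is_cspace ?V" by (rule is_cspace_C) simp_all
  show "star_space ?V" by (rule star_space_C)
  show "mcone ?V \<subseteq> (\<Union>n. mats ?V n)" using mcone_C_mats by blast
  show "mat_star ?V a = a" if a: "a \<in> mcone ?V" for a
  proof -
    define n where "n = dim_row a"
    have m: "a \<in> mats ?V n" using mcone_C_mats[OF a] by (simp add: n_def)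
    then have c: "a \<in> carrier_mat n n" by (simp add: mats_iff)
    show ?thesis
    proof (rule eq_matI)
      fix i j assume "i < dim_row a" "j < dim_col a"
      then have ij: "i < n" "j < n" using c by auto
      have "cnj ((a $$ (j, i)) x) = (a $$ (i, j)) x" if "x \<in> topspace X" for x
        using psd_mat_hermitian[of "eval_mat x a" n i j] a c ij that by (auto simp: C_opsystem_def)
      then have "(\<lambda>x. cnj ((a $$ (j, i)) x)) = a $$ (i, j)"
        using m ij by (intro C_carrier_eqI[of _ X] C_carrier_cnj) (auto simp: mats_iff)
      then show "mat_star ?V a $$ (i, j) = a $$ (i, j)" using mat_star_C_entry[OF c ij] by simp
    qed (use c in \<open>auto simp: mat_star_def\<close>)
  qed
  show "0\<^sub>m n n \<in> mcone ?V" for n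
  proof (subst mcone_C_iff)
    show "0\<^sub>m n n \<in> mats ?V n" using cs by (auto simp: mats_iff C_carrier_def zero_fun_def)
  qed (simp add: sesq_def)
  show "a + b \<in> mcone ?V" if "a \<in> mcone ?V \<inter> mats ?V n" "b \<in> mcone ?V \<inter> mats ?V n" for n a b
  proof -
    have ab: "a \<in> mats ?V n" "b \<in> mats ?V n" using that by auto
    then have "eval_mat x a \<in> carrier_mat n n" "eval_mat x b \<in> carrier_mat n n" for x by (auto simp: mats_iff)
    moreover have "eval_mat x (a + b) = eval_mat x a + eval_mat x b" for x
      using ab by (intro eval_mat_add[of _ n]) (auto simp: mats_iff)
    ultimately show ?thesis
      using that ab mcone_C_iff[OF ab(1)] mcone_C_iff[OF ab(2)]
      by (subst mcone_C_iff[OF add_in_mats[OF cs ab]]) (auto simp: sesq_add)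
  qed
  show "map_mat (cscale ?V (complex_of_real r)) a \<in> mcone ?V" if "a \<in> mcone ?V" "0 \<le> r" for a r
  proof -
    define n where "n = dim_row a"
    have a: "a \<in> mats ?V n" using mcone_C_mats[OF that(1)] by (simp add: n_def)
    have "sesq n (eval_mat x (map_mat (cscale ?V (complex_of_real r)) a)) v v =
        complex_of_real r * sesq n (eval_mat x a) v v" for x v
      using a by (auto simp: sesq_def mats_iff C_scale_def sum_distrib_left mult.assoc)
    then show ?thesis
      using that(1) mcone_C_iff[OF a] that(2)
      by (subst mcone_C_iff[OF scale_in_mats[OF cs a]]) (auto simp: complex_ge_0_iff)
  qed
  show "a = 0\<^sub>m n n" if "a \<in> mcone ?V \<inter> mats ?V n" "- a \<in> mcone ?V" for n a
  proof (rule eq_matI)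
    have a: "a \<in> mats ?V n" using that by auto
    then have c: "a \<in> carrier_mat n n" by (simp add: mats_iff)
    have "- a \<in> mats ?V n" using mcone_C_mats[OF that(2)] c by simp
    then have neg: "0 \<le> sesq n (eval_mat x (- a)) v v" if "x \<in> topspace X" for x v
      using that \<open>- a \<in> mcone ?V\<close> by (simp add: mcone_C_iff)
    fix i j assume "i < dim_row (0\<^sub>m n n :: ('a \<Rightarrow> complex) mat)" "j < dim_col (0\<^sub>m n n :: ('a \<Rightarrow> complex) mat)"
    then have ij: "i < n" "j < n" by auto
    \<comment> \<open>Positivity of both a and - a makes the quadratic form at x vanish identically,
      and polarization recovers the entries.\<close>
    have "(a $$ (i, j)) x = 0" if x: "x \<in> topspace X" for x
    proof -
      have "sesq n (eval_mat x a) v v = 0" for v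
      proof -
        have "sesq n (eval_mat x (- a)) v v = - sesq n (eval_mat x a) v v"
          using c by (simp add: sesq_def sum_negf)
        moreover have "0 \<le> sesq n (eval_mat x a) v v"
          using x \<open>a \<in> mcone ?V \<inter> mats ?V n\<close> mcone_C_iff[OF a] by blast
        ultimately show ?thesis
          using neg[OF x, of v] unfolding complex_ge_0_iff complex_eq_iff by simp
      qed
      then have "eval_mat x a $$ (i, j) = 0" using ij by (rule sesq_polarization)
      then show ?thesis using c ij by simp
    qed
    then have "a $$ (i, j) = (\<lambda>_. 0)"
      using a ij by (intro C_carrier_eqI[of _ X]) (auto simp: mats_iff C_carrier_def)
    then show "a $$ (i, j) = 0\<^sub>m n n $$ (i, j)" using ij by (simp add: zero_fun_def)
  qed (use that in \<open>auto simp: mats_iff\<close>)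
  show "sandwich ?V (mat_adjoint a) y a \<in> mcone ?V"
    if "y \<in> mcone ?V \<inter> mats ?V m" and a: "a \<in> carrier_mat m n" for m n y a
  proof -
    have y: "y \<in> mats ?V m" "y \<in> carrier_mat m m" using that by (auto simp: mats_iff)
    have adj: "mat_adjoint a \<in> carrier_mat n m" using a by (auto simp: mat_adjoint_def)
    have "eval_mat x (sandwich ?V (mat_adjoint a) y a) = mat_adjoint a * eval_mat x y * a" for x
      using adj a y(2) by (intro eval_mat_sandwich) auto
    then show ?thesis
      using that(1) mcone_C_iff[OF y(1)] y(2) a
      by (subst mcone_C_iff[OF sandwich_in_mats[OF cs adj a y(1)]]) (auto simp: sesq_sandwich)
  qed
qed

lemma eval_unit_mat_sesq:
  assumes "x \<in> topspace X" "a \<in> carrier_mat n n"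
  shows "sesq n (eval_mat x (unit_mat (C_opsystem X) r n + a)) v v =
    complex_of_real (r * (\<Sum>k<n. (cmod (v k))\<^sup>2)) + sesq n (eval_mat x a) v v"
proof -
  have u: "unit_mat (C_opsystem X) r n \<in> carrier_mat n n" by (simp add: unit_mat_def)
  have vv: "v i * cnj (v i) = complex_of_real ((cmod (v i))\<^sup>2)" for i by (rule complex_norm_square[symmetric])
  have "sesq n (eval_mat x (unit_mat (C_opsystem X) r n)) v v =
      (\<Sum>i<n. \<Sum>j<n. if i = j then complex_of_real r * v j * cnj (v i) else 0)"
    unfolding sesq_def using assms(1)
    by (intro sum.cong refl) (simp add: unit_mat_def C_scale_def)
  also have "\<dots> = (\<Sum>i<n. complex_of_real r * (v i * cnj (v i)))" by (simp add: mult.assoc)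
  also have "\<dots> = complex_of_real (r * (\<Sum>k<n. (cmod (v k))\<^sup>2))"
    by (simp add: sum_distrib_left vv)
  finally show ?thesis
    using u assms(2) by (simp add: eval_mat_add[OF u assms(2)] sesq_add[of _ n])
qed

lemma operator_system_C:
  assumes X: "compact_space X"
  shows "operator_system (C_opsystem X)"
  unfolding operator_system_def
proof (intro conjI allI ballI impI)
  let ?V = "C_opsystem X"
  have cs: "is_cspace ?V" by (rule is_cspace_C) simp_all
  show "matrix_ordered ?V" by (rule matrix_ordered_C)
  show o: "ounit ?V \<in> carrier ?V" by (simp add: one_in_C_carrier)
  show "invol ?V (ounit ?V) = ounit ?V" by (auto simp: fun_eq_iff)
  fix n a assume a: "a \<in> mats ?V n" and h: "mat_star ?V a = a"
  have c: "a \<in> carrier_mat n n" using a by (simp add: mats_iff)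
  have um: "unit_mat ?V r n + a \<in> mats ?V n" for r
    using o is_cspaceD(1,3)[OF cs] by (intro add_in_mats[OF cs _ a]) (auto simp: mats_iff unit_mat_def)
  \<comment> \<open>Self-adjointness makes the quadratic form real at every point, so that
    positivity becomes an inequality between real numbers.\<close>
  have real: "Im (sesq n (eval_mat x a) v v) = 0" for x v
  proof -
    have "cnj ((a $$ (j, i)) x) = (a $$ (i, j)) x" if "i < n" "j < n" for i j
      using mat_star_C_entry[OF c that, of X] h by (metis)
    then have "cnj (sesq n (eval_mat x a) v v) = sesq n (eval_mat x a) v v"
      unfolding cnj_sesq using c by (simp add: sesq_def)
    then show ?thesis by (simp add: complex_eq_iff)
  qed
  have iff: "unit_mat ?V r n + a \<in> mcone ?V \<longleftrightarrow>
      (\<forall>x\<in>topspace X. \<forall>v. 0 \<le> r * (\<Sum>k<n. (cmod (v k))\<^sup>2) + Re (sesq n (eval_mat x a) v v))" for r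
    unfolding mcone_C_iff[OF um] by (auto simp: eval_unit_mat_sesq[OF _ c] complex_ge_0_iff real)
  show "\<exists>r>0. unit_mat ?V r n + a \<in> mcone ?V"
  proof -
    have "\<forall>i<n. \<forall>j<n. \<exists>B. \<forall>x. cmod ((a $$ (i, j)) x) \<le> B"
      using a C_carrier_bounded[OF X] by (metis C_opsystem_simps(1) mats_iff)
    then obtain B where B: "\<And>i j x. i < n \<Longrightarrow> j < n \<Longrightarrow> cmod ((a $$ (i, j)) x) \<le> B i j" by metis
    \<comment> \<open>The entry bounds control the form through \<open>cmod_sesq_le\<close>; the
      maximum with 1 keeps r positive, for instance when n = 0.\<close>
    define r where "r = max 1 (\<Sum>i<n. \<Sum>j<n. B i j)"
    have "0 \<le> r * (\<Sum>k<n. (cmod (v k))\<^sup>2) + Re (sesq n (eval_mat x a) v v)" for x v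
    proof -
      have "- Re (sesq n (eval_mat x a) v v) \<le> cmod (sesq n (eval_mat x a) v v)"
        using abs_Re_le_cmod[of "sesq n (eval_mat x a) v v"] by linarith
      also have "\<dots> \<le> (\<Sum>i<n. \<Sum>j<n. cmod (eval_mat x a $$ (i, j))) * (\<Sum>k<n. (cmod (v k))\<^sup>2)"
        by (rule cmod_sesq_le)
      also have "\<dots> \<le> (\<Sum>i<n. \<Sum>j<n. B i j) * (\<Sum>k<n. (cmod (v k))\<^sup>2)"
        using B c by (intro mult_right_mono sum_mono sum_nonneg) auto
      also have "\<dots> \<le> r * (\<Sum>k<n. (cmod (v k))\<^sup>2)"
        by (intro mult_right_mono sum_nonneg) (auto simp: r_def)
      finally show ?thesis by linarith
    qed
    moreover have "r > 0" by (simp add: r_def)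
    ultimately show ?thesis using iff by blast
  qed
  show "a \<in> mcone ?V" if all: "\<forall>r>0. unit_mat ?V r n + a \<in> mcone ?V"
  proof -
    have "0 \<le> Re (sesq n (eval_mat x a) v v)" if x: "x \<in> topspace X" for x v
    proof (rule field_le_epsilon)
      fix e :: real assume e: "e > 0"
      let ?S = "\<Sum>k<n. (cmod (v k))\<^sup>2"
      have S: "?S \<ge> 0" by (simp add: sum_nonneg)
      \<comment> \<open>This multiple of the unit changes the form at v by at most e; the summand 1
        prevents a division by zero.\<close>
      have "e / (?S + 1) > 0" using e S by simp
      then have "0 \<le> e / (?S + 1) * ?S + Re (sesq n (eval_mat x a) v v)"
        using all x iff by blast
      moreover have "e / (?S + 1) * ?S \<le> e" using e S by (simp add: field_simps)
      ultimately show "0 \<le> Re (sesq n (eval_mat x a) v v) + e" by linarith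
    qed
    then show ?thesis by (simp add: mcone_C_iff[OF a] complex_ge_0_iff real)
  qed
qed

section \<open>C(X) as a Banach space\<close>

lemma C_vnorm_bdd:
  assumes "compact_space X" "u \<in> C_carrier X"
  shows "bdd_above (insert 0 ((\<lambda>x. cmod (u x)) ` topspace X))"
proof -
  obtain B where "B \<ge> 0" "\<And>x. cmod (u x) \<le> B" using C_carrier_bounded[OF assms] by blast
  then show ?thesis by (auto intro!: bdd_aboveI2)
qed

lemma C_vnorm_nonneg:
  assumes "compact_space X" "u \<in> C_carrier X"
  shows "0 \<le> vnorm (C_banach X) u"
  unfolding C_banach_def using cSup_upper[OF _ C_vnorm_bdd[OF assms]] by simp

lemma cmod_le_C_vnorm:
  assumes "compact_space X" "u \<in> C_carrier X" "x \<in> topspace X"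
  shows "cmod (u x) \<le> vnorm (C_banach X) u"
  unfolding C_banach_def using cSup_upper[OF _ C_vnorm_bdd[OF assms(1,2)]] assms(3) by simp

lemma C_vnorm_le:
  assumes "0 \<le> K" "\<And>x. x \<in> topspace X \<Longrightarrow> cmod (u x) \<le> K"
  shows "vnorm (C_banach X) u \<le> K"
  unfolding C_banach_def using assms by (auto intro!: cSup_least)

text \<open>Only completeness goes beyond pointwise estimates: a Cauchy sequence has a pointwise
  limit, the convergence is uniform over the points, and a uniform limit of continuous functions is
  continuous.\<close>

lemma banach_space_C:
  assumes X: "compact_space X"
  shows "banach_space (C_banach X)"
  unfolding banach_space_def
proof (intro conjI ballI allI impI)
  let ?V = "C_banach X"
  let ?N = "vnorm ?V"
  show cs: "is_cspace ?V" by (rule is_cspace_C) simp_all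
  note csD = is_cspaceD[OF cs, unfolded C_banach_simps]
  note nn = C_vnorm_nonneg[OF X] and le = cmod_le_C_vnorm[OF X]
  {
    fix u assume "u \<in> carrier ?V"
    then have u: "u \<in> C_carrier X" by simp
    show "0 \<le> ?N u" using u by (rule nn)
    show "?N u = 0 \<longleftrightarrow> u = 0"
    proof
      assume 0: "?N u = 0"
      show "u = 0"
      proof (rule C_carrier_eqI[OF u csD(1)])
        show "u x = 0 x" if "x \<in> topspace X" for x using le[OF u that] 0 by simp
      qed
    next
      assume "u = 0"
      then have "?N u \<le> 0" by (intro C_vnorm_le) auto
      then show "?N u = 0" using nn[OF u] by simp
    qed
    show "?N (u + v) \<le> ?N u + ?N v" if "v \<in> carrier ?V" for v
    proof (rule C_vnorm_le)
      have v: "v \<in> C_carrier X" using that by simp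
      show "0 \<le> ?N u + ?N v" using nn[OF u] nn[OF v] by simp
      show "cmod ((u + v) x) \<le> ?N u + ?N v" if "x \<in> topspace X" for x
        using norm_triangle_ineq[of "u x" "v x"] le[OF u that] le[OF v that] by simp
    qed
    show "?N (cscale ?V c u) = cmod c * ?N u" for c
    proof (rule antisym)
      have cu: "C_scale c u \<in> C_carrier X" using csD(3)[OF u] .
      show "?N (cscale ?V c u) \<le> cmod c * ?N u"
        using nn[OF u] le[OF u] by (intro C_vnorm_le) (auto simp: C_scale_def norm_mult mult_left_mono)
      show "cmod c * ?N u \<le> ?N (cscale ?V c u)"
      proof (cases "c = 0")
        case True
        then show ?thesis using nn[OF cu] by simp
      next
        case False
        have "?N u \<le> ?N (C_scale c u) / cmod c"
        proof (rule C_vnorm_le)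
          show "0 \<le> ?N (C_scale c u) / cmod c" using nn[OF cu] by simp
          show "cmod (u x) \<le> ?N (C_scale c u) / cmod c" if "x \<in> topspace X" for x
            using le[OF cu that] False by (simp add: C_scale_def norm_mult field_simps)
        qed
        then show ?thesis using False by (simp add: field_simps)
      qed
    qed
  }
  fix s :: "nat \<Rightarrow> 'a \<Rightarrow> complex"
  assume "range s \<subseteq> carrier ?V" and cau: "\<forall>\<epsilon>>0. \<exists>N. \<forall>m\<ge>N. \<forall>n\<ge>N. ?N (s m - s n) < \<epsilon>"
  then have s: "s n \<in> C_carrier X" for n by auto
  \<comment> \<open>Valid for every x, also off \<open>topspace X\<close>, where both values are 0;
    the pointwise limit can then be taken on the whole type.\<close>
  have diff: "cmod (s m x - s n x) \<le> ?N (s m - s n)" for m n x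
  proof (cases "x \<in> topspace X")
    case True
    then show ?thesis using le[OF csD(5)[OF s s] True] by simp
  next
    case False
    then show ?thesis using s nn[OF csD(5)[OF s s]] by (simp add: C_carrier_def)
  qed
  have "Cauchy (\<lambda>n. s n x)" for x
    unfolding Cauchy_def dist_norm using cau diff by (meson le_less_trans)
  then have "\<exists>l. (\<lambda>n. s n x) \<longlonglongrightarrow> l" for x by (simp add: Cauchy_convergent_iff convergent_def)
  then obtain u where lim: "\<And>x. (\<lambda>n. s n x) \<longlonglongrightarrow> u x" by metis
  have unif: "\<exists>N. \<forall>n\<ge>N. \<forall>x. cmod (s n x - u x) \<le> e" if e: "e > 0" for e
  proof -
    obtain N where N: "\<And>m n. m \<ge> N \<Longrightarrow> n \<ge> N \<Longrightarrow> ?N (s m - s n) < e" using cau e by blast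
    have "cmod (s n x - u x) \<le> e" if "n \<ge> N" for n x
    proof (rule tendsto_upperbound)
      show "(\<lambda>m. cmod (s n x - s m x)) \<longlonglongrightarrow> cmod (s n x - u x)" by (intro tendsto_intros lim)
      show "eventually (\<lambda>m. cmod (s n x - s m x) \<le> e) sequentially"
        unfolding eventually_sequentially
        using diff N[OF that] by (intro exI[of _ N]) (meson less_imp_le order_trans)
    qed simp
    then show ?thesis by blast
  qed
  have "continuous_map X euclidean u"
  proof -
    have "continuous_map X Met_TC.mtopology u"
    proof (rule Met_TC.continuous_map_uniform_limit[where F = sequentially and f = s])
      show "\<forall>\<^sub>F n in sequentially. continuous_map X Met_TC.mtopology (s n)"
        using s by (simp add: C_carrier_def)
      fix e :: real assume e: "e > 0"
      \<comment> \<open>Half of e turns the weak estimate into the strict one that the uniform limit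
        theorem asks for.\<close>
      obtain N where N: "\<And>n x. n \<ge> N \<Longrightarrow> cmod (s n x - u x) \<le> e / 2" using unif[of "e / 2"] e by auto
      have "cmod (s n x - u x) < e" if "n \<ge> N" for n x using N[OF that, of x] e by linarith
      then show "\<forall>\<^sub>F n in sequentially. \<forall>x\<in>topspace X. u x \<in> UNIV \<and> dist (s n x) (u x) < e"
        unfolding eventually_sequentially dist_norm by blast
    qed simp
    then show ?thesis by simp
  qed
  moreover have "u x = 0" if "x \<notin> topspace X" for x
    using lim[of x] s that by (simp add: C_carrier_def LIMSEQ_const_iff)
  ultimately have u: "u \<in> C_carrier X" by (simp add: C_carrier_def)
  have "(\<lambda>n. ?N (s n - u)) \<longlonglongrightarrow> 0"
    unfolding LIMSEQ_def dist_norm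
  proof (intro allI impI)
    fix e :: real assume e: "e > 0"
    obtain N where N: "\<And>n x. n \<ge> N \<Longrightarrow> cmod (s n x - u x) \<le> e / 2" using unif[of "e / 2"] e by auto
    have "norm (?N (s n - u) - 0) < e" if "n \<ge> N" for n
    proof -
      have "?N (s n - u) \<le> e / 2" using N[OF that] e by (intro C_vnorm_le) auto
      then show ?thesis using nn[OF csD(5)[OF s u], of n] e by simp
    qed
    then show "\<exists>N. \<forall>n\<ge>N. norm (?N (s n - u) - 0) < e" by blast
  qed
  then show "\<exists>u\<in>carrier ?V. (\<lambda>n. ?N (s n - u)) \<longlonglongrightarrow> 0" using u by auto
qed

section \<open>The induced action on C(X)\<close>

locale G_space_locale =
  fixes G :: "('g, 'm) monoid_scheme" and X :: "'x topology" and \<alpha> :: "'g \<Rightarrow> 'x \<Rightarrow> 'x"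
  assumes grp: "group G" and spc: "G_space G X \<alpha>"
begin

sublocale group G by (rule grp)

lemmas spcD = G_spaceD[OF spc]

lemma C_action_apply:
  assumes "u \<in> C_carrier X" "x \<in> topspace X"
  shows "C_action G X \<alpha> g u x = u (\<alpha> (inv\<^bsub>G\<^esub> g) x)"
  using assms by (simp add: C_action_def)

lemma C_action_closed:
  assumes g: "g \<in> carrier G" and u: "u \<in> C_carrier X"
  shows "C_action G X \<alpha> g u \<in> C_carrier X"
proof -
  have "continuous_map X euclidean (u \<circ> \<alpha> (inv\<^bsub>G\<^esub> g))"
    using u g by (intro continuous_map_compose[OF spcD(4)]) (auto simp: C_carrier_def)
  then have "continuous_map X euclidean (C_action G X \<alpha> g u)"
    by (rule continuous_map_eq) (simp add: C_action_apply u)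
  then show ?thesis using u by (simp add: C_carrier_def C_action_def)
qed

text \<open>Composition with functions reverses the order of factors and so does inversion; together
  they give a left action.\<close>

lemma group_action_C: "group_action G (C_carrier X) (C_action G X \<alpha>)"
proof (rule group_actionI[OF grp])
  show "C_action G X \<alpha> \<one>\<^bsub>G\<^esub> u = u" if "u \<in> C_carrier X" for u
    using that by (intro C_carrier_eqI[OF C_action_closed])
      (auto simp: C_action_apply group_action_one[OF spcD(3)])
  show "C_action G X \<alpha> (g \<otimes>\<^bsub>G\<^esub> h) u = C_action G X \<alpha> g (C_action G X \<alpha> h u)"
    if "g \<in> carrier G" "h \<in> carrier G" "u \<in> C_carrier X" for g h u
    using that by (intro C_carrier_eqI[OF C_action_closed C_action_closed])
      (auto simp: C_action_apply C_action_closed spcD(5) inv_mult_group group_action.composition_rule[OF spcD(3)])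
  show "C_action G X \<alpha> g \<in> extensional (C_carrier X)" for g by (simp add: C_action_def)
qed (rule C_action_closed)

lemma C_action_linear:
  assumes g: "g \<in> carrier G" and V: "carrier V = C_carrier X" "cscale V = C_scale"
  shows "linear_map V V (C_action G X \<alpha> g)"
proof -
  have cs: "is_cspace V" using V by (rule is_cspace_C)
  note csD = is_cspaceD[OF cs, unfolded V]
  show ?thesis
    unfolding linear_map_def V
  proof (intro conjI ballI allI funcsetI C_action_closed[OF g])
    fix u assume u: "u \<in> C_carrier X"
    show "C_action G X \<alpha> g (u + v) = C_action G X \<alpha> g u + C_action G X \<alpha> g v" if v: "v \<in> C_carrier X" for v
      using u v g csD(2) C_action_closed by (intro C_carrier_eqI[of _ X]) (auto simp: C_action_apply)
    show "C_action G X \<alpha> g (C_scale c u) = C_scale c (C_action G X \<alpha> g u)" for c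
    proof (rule C_carrier_eqI[of _ X])
      show "C_action G X \<alpha> g (C_scale c u) x = C_scale c (C_action G X \<alpha> g u) x" if "x \<in> topspace X" for x
        using C_action_apply[OF csD(3)[OF u] that] C_action_apply[OF u that] by (simp add: C_scale_def)
    qed (intro C_action_closed g csD(3) u)+
  qed
qed

lemma eval_mat_C_action:
  assumes "a \<in> carrier_mat n n" "\<forall>i<n. \<forall>j<n. a $$ (i, j) \<in> C_carrier X" "x \<in> topspace X"
  shows "eval_mat x (map_mat (C_action G X \<alpha> g) a) = eval_mat (\<alpha> (inv\<^bsub>G\<^esub> g) x) a"
  using assms by (intro eq_matI) (auto simp: C_action_apply)

text \<open>An element g permutes the points of X, so the supremum defining the norm runs over the
  same set of values before and after acting. The same reindexing settles the order and the Banach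
  space norm.\<close>

lemma G_operator_space_C: "G_operator_space G (C_opspace X) (C_action G X \<alpha>)"
  unfolding G_operator_space_def completely_isometric_def
proof (intro conjI ballI allI)
  show "operator_space (C_opspace X)" using spcD(1) by (rule operator_space_C)
  show "group_action G (carrier (C_opspace X)) (C_action G X \<alpha>)" using group_action_C by simp
  fix g assume g: "g \<in> carrier G"
  show "linear_map (C_opspace X) (C_opspace X) (C_action G X \<alpha> g)" using g by (rule C_action_linear) simp_all
  fix n a assume a: "a \<in> mats (C_opspace X) n"
  have "(\<lambda>x. opnorm (eval_mat x (map_mat (C_action G X \<alpha> g) a))) ` topspace X =
      (\<lambda>x. opnorm (eval_mat (\<alpha> (inv\<^bsub>G\<^esub> g) x) a)) ` topspace X"
    using a by (intro image_cong refl arg_cong[of _ _ opnorm] eval_mat_C_action) (auto simp: mats_iff)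
  also have "\<dots> = (\<lambda>x. opnorm (eval_mat x a)) ` (\<alpha> (inv\<^bsub>G\<^esub> g) ` topspace X)"
    by (simp add: image_image)
  also have "\<alpha> (inv\<^bsub>G\<^esub> g) ` topspace X = topspace X"
    using g group_action.surj_prop[OF spcD(3)] by simp
  finally show "mnorm (C_opspace X) (map_mat (C_action G X \<alpha> g) a) = mnorm (C_opspace X) a"
    by (simp add: C_opspace_def)
qed

lemma G_operator_system_C: "G_operator_system G (C_opsystem X) (C_action G X \<alpha>)"
  unfolding G_operator_system_def unital_complete_order_embedding_def
proof (intro conjI ballI allI)
  show "operator_system (C_opsystem X)" using spcD(1) by (rule operator_system_C)
  show "group_action G (carrier (C_opsystem X)) (C_action G X \<alpha>)" using group_action_C by simp
  fix g assume g: "g \<in> carrier G"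
  show lin: "linear_map (C_opsystem X) (C_opsystem X) (C_action G X \<alpha> g)" using g by (rule C_action_linear) simp_all
  show "C_action G X \<alpha> g (ounit (C_opsystem X)) = ounit (C_opsystem X)"
    using g one_in_C_carrier[of X]
    by (intro C_carrier_eqI[OF C_action_closed]) (auto simp: C_action_apply spcD(5))
  fix n a assume a: "a \<in> mats (C_opsystem X) n"
  have ga: "map_mat (C_action G X \<alpha> g) a \<in> mats (C_opsystem X) n"
    using a g by (auto simp: mats_iff C_action_closed)
  have e: "eval_mat x (map_mat (C_action G X \<alpha> g) a) = eval_mat (\<alpha> (inv\<^bsub>G\<^esub> g) x) a"
    if "x \<in> topspace X" for x
    using a that by (intro eval_mat_C_action[of _ n]) (auto simp: mats_iff)
  have "(\<forall>x\<in>topspace X. \<forall>v. 0 \<le> sesq n (eval_mat (\<alpha> (inv\<^bsub>G\<^esub> g) x) a) v v) \<longleftrightarrow>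
      (\<forall>x\<in>\<alpha> (inv\<^bsub>G\<^esub> g) ` topspace X. \<forall>v. 0 \<le> sesq n (eval_mat x a) v v)" by simp
  also have "\<alpha> (inv\<^bsub>G\<^esub> g) ` topspace X = topspace X"
    using g group_action.surj_prop[OF spcD(3)] by simp
  finally show "map_mat (C_action G X \<alpha> g) a \<in> mcone (C_opsystem X) \<longleftrightarrow> a \<in> mcone (C_opsystem X)"
    unfolding mcone_C_iff[OF ga] mcone_C_iff[OF a] by (simp add: e cong: ball_cong)
qed

lemma G_banach_space_C: "G_banach_space G (C_banach X) (C_action G X \<alpha>)"
  unfolding G_banach_space_def linear_isometry_def
proof (intro conjI ballI)
  show "banach_space (C_banach X)" using spcD(1) by (rule banach_space_C)
  show "group_action G (carrier (C_banach X)) (C_action G X \<alpha>)" using group_action_C by simp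
  fix g assume g: "g \<in> carrier G"
  show "linear_map (C_banach X) (C_banach X) (C_action G X \<alpha> g)" using g by (rule C_action_linear) simp_all
  fix u assume u: "u \<in> carrier (C_banach X)"
  have "(\<lambda>x. cmod (C_action G X \<alpha> g u x)) ` topspace X = (\<lambda>x. cmod (u (\<alpha> (inv\<^bsub>G\<^esub> g) x))) ` topspace X"
    using u by (intro image_cong refl) (simp add: C_action_apply)
  also have "\<dots> = (\<lambda>x. cmod (u x)) ` (\<alpha> (inv\<^bsub>G\<^esub> g) ` topspace X)" by (simp add: image_image)
  also have "\<alpha> (inv\<^bsub>G\<^esub> g) ` topspace X = topspace X"
    using g group_action.surj_prop[OF spcD(3)] by simp
  finally show "vnorm (C_banach X) (C_action G X \<alpha> g u) = vnorm (C_banach X) u"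
    by (simp add: C_banach_def)
qed

end

section \<open>Extending equivariant maps\<close>

lemma linear_map_sum:
  assumes V: "is_cspace V" and \<omega>: "linear_map V scalars \<omega>" and u: "\<And>i. i \<in> I \<Longrightarrow> u i \<in> carrier V"
  shows "\<omega> (\<Sum>i\<in>I. u i) = (\<Sum>i\<in>I. \<omega> (u i))"
proof -
  have add: "\<omega> (x + y) = \<omega> x + \<omega> y" if "x \<in> carrier V" "y \<in> carrier V" for x y
    using \<omega> that by (simp add: linear_map_scalars_iff)
  have "\<omega> (cscale V 0 0) = 0 * \<omega> 0" using \<omega> is_cspaceD(1)[OF V] by (simp add: linear_map_scalars_iff)
  then have "\<omega> 0 = 0" by (simp add: is_cspaceD[OF V])
  then show ?thesis
    using u by (induction I rule: infinite_finite_induct) (simp_all add: add is_cspace_sum[OF V])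
qed

lemma linear_map_scalarsD:
  assumes V: "is_cspace V" and \<omega>: "linear_map V scalars \<omega>" and x: "x \<in> carrier V"
  shows "y \<in> carrier V \<Longrightarrow> \<omega> (x + y) = \<omega> x + \<omega> y" and "\<omega> (cscale V c x) = c * \<omega> x"
    and "\<omega> (- x) = - \<omega> x" and "y \<in> carrier V \<Longrightarrow> \<omega> (x - y) = \<omega> x - \<omega> y"
proof -
  show add: "\<omega> (x + y) = \<omega> x + \<omega> y" if "y \<in> carrier V" for y
    using \<omega> x that by (simp add: linear_map_scalars_iff)
  have sc: "\<omega> (cscale V c x) = c * \<omega> x" if "x \<in> carrier V" for c x
    using \<omega> that by (simp add: linear_map_scalars_iff)
  show "\<omega> (cscale V c x) = c * \<omega> x" using x by (rule sc)
  have neg: "\<omega> (- x) = - \<omega> x" if "x \<in> carrier V" for x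
    using sc[OF that, of "- 1"] by (simp add: is_cspaceD[OF V])
  show "\<omega> (- x) = - \<omega> x" using x by (rule neg)
  show "\<omega> (x - y) = \<omega> x - \<omega> y" if "y \<in> carrier V"
    using add[of "- y"] neg[OF that] that by (simp add: is_cspaceD[OF V])
qed

text \<open>A factor c of modulus 1 makes c \<psi> f equal to |\<psi> f|, so the bound on real
  parts, applied to c f, bounds the modulus, and p does not distinguish c f from f.\<close>

lemma seminorm_Hahn_Banach:
  assumes E: "is_cspace E" and F: "is_cspace F" and \<iota>: "linear_map E F \<iota>"
    and \<phi>: "linear_map E scalars \<phi>"
    and tri: "\<And>x y. x \<in> carrier F \<Longrightarrow> y \<in> carrier F \<Longrightarrow> p (x + y) \<le> p x + p y"
    and hom: "\<And>x c. x \<in> carrier F \<Longrightarrow> p (cscale F c x) = cmod c * p x"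
    and le: "\<And>e. e \<in> carrier E \<Longrightarrow> cmod (\<phi> e) \<le> p (\<iota> e)"
  obtains \<psi> where "linear_map F scalars \<psi>" "\<And>e. e \<in> carrier E \<Longrightarrow> \<psi> (\<iota> e) = \<phi> e"
    "\<And>f. f \<in> carrier F \<Longrightarrow> cmod (\<psi> f) \<le> p f"
proof -
  have "sublinear F p" using tri hom by (simp add: sublinear_def)
  moreover have "Re (\<phi> e) \<le> p (\<iota> e)" if "e \<in> carrier E" for e
    using le[OF that] complex_Re_le_cmod order_trans by blast
  ultimately obtain \<psi> where \<psi>: "linear_map F scalars \<psi>" "\<And>e. e \<in> carrier E \<Longrightarrow> \<psi> (\<iota> e) = \<phi> e"
    "\<And>f. f \<in> carrier F \<Longrightarrow> Re (\<psi> f) \<le> p f"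
    using complex_Hahn_Banach[OF E F \<iota> \<phi>] by blast
  have "cmod (\<psi> f) \<le> p f" if f: "f \<in> carrier F" for f
  proof (cases "\<psi> f = 0")
    case True
    have "0 \<le> p f"
      using \<psi>(3)[OF f] True by simp
    then show ?thesis using True by simp
  next
    case False
    define c where "c = cnj (\<psi> f) / complex_of_real (cmod (\<psi> f))"
    have c: "cmod c = 1" using False by (simp add: c_def norm_divide)
    have "c * \<psi> f = complex_of_real (cmod (\<psi> f))"
      using False complex_norm_square[of "\<psi> f"] by (simp add: c_def field_simps power2_eq_square)
    then have "cmod (\<psi> f) = Re (\<psi> (cscale F c f))"
      by (simp add: linear_map_scalarsD(2)[OF F \<psi>(1) f])
    also have "\<dots> \<le> p (cscale F c f)" using f by (intro \<psi>(3) is_cspaceD(3)[OF F])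
    also have "\<dots> = p f" using hom[OF f] c by simp
    finally show ?thesis .
  qed
  then show ?thesis using that \<psi> by blast
qed

text \<open>The common core of the three categories: V is any record over C(X), and
  \<open>bdd\<close> confines the values belonging to a given f to a compact disc. The last
  conclusion transports every closed condition that all \<omega> x satisfy on the orbit of f to the
  values of \<psi> f; it is applied to discs and to the nonnegative numbers.\<close>

lemma (in G_space_locale) equivariant_extension:
  assumes proj: "G_projective TYPE(('g \<times> 'x) set set) G X \<alpha>"
    and V: "carrier V = C_carrier X" "cscale V = C_scale"
    and F: "is_cspace F" and \<delta>: "group_action G (carrier F) \<delta>"
    and \<delta>_lin: "\<And>g. g \<in> carrier G \<Longrightarrow> linear_map F F (\<delta> g)"
    and \<gamma>: "group_action G (carrier E) \<gamma>"
    and \<iota>: "linear_map E F \<iota>" "equivariant_on G (carrier E) \<gamma> \<delta> \<iota>"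
    and \<phi>: "linear_map E V \<phi>" "equivariant_on G (carrier E) \<gamma> (C_action G X \<alpha>) \<phi>"
    and \<omega>: "\<And>x. x \<in> topspace X \<Longrightarrow> linear_map F scalars (\<omega> x)"
    and ext: "\<And>x e. x \<in> topspace X \<Longrightarrow> e \<in> carrier E \<Longrightarrow> \<omega> x (\<iota> e) = \<phi> e x"
    and bdd: "\<And>f. f \<in> carrier F \<Longrightarrow>
      \<exists>B. \<forall>g\<in>carrier G. \<forall>x\<in>topspace X. cmod (\<omega> x (\<delta> g f)) \<le> B"
  obtains \<psi> where "linear_map F V \<psi>" "equivariant_on G (carrier F) \<delta> (C_action G X \<alpha>) \<psi>"
    "\<forall>e\<in>carrier E. \<psi> (\<iota> e) = \<phi> e"
    "\<forall>f\<in>carrier F. \<forall>S. closed S \<longrightarrow> (\<forall>g\<in>carrier G. \<forall>x\<in>topspace X. \<omega> x (\<delta> g f) \<in> S) \<longrightarrow>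
       (\<forall>y\<in>topspace X. \<psi> f y \<in> S)"
proof -
  let ?D = "carrier G \<times> topspace X" let ?f = "\<lambda>(g, x). \<alpha> g x"
  obtain r where r: "G_map G X \<alpha> (ultra_topology ?D) (ultra_action G (topspace X)) r"
    and r_lim: "\<And>y. y \<in> topspace X \<Longrightarrow> limitin X ?f y (ufilter (r y))"
    using G_projective_section[OF grp proj] by blast
  have r_cont: "continuous_map X (ultra_topology ?D) r" using r by (simp add: G_map_def)
  then have "r \<in> topspace X \<rightarrow> ultrafilters ?D" by (simp add: continuous_map_def)
  then have rU: "r y \<in> ultrafilters ?D" if "y \<in> topspace X" for y using that by (rule funcset_mem)
  have nb: "ufilter (r y) \<noteq> bot" if "y \<in> topspace X" for y using rU[OF that] by (rule ufilter_neq_bot)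
  have \<delta>_closed: "\<delta> g f \<in> carrier F" if "g \<in> carrier G" "f \<in> carrier F" for g f
    using group_action.element_image[OF \<delta> that] by simp
  \<comment> \<open>Whatever \<omega> is, f \<mapsto> u f is equivariant into the functions on G
    \<times> X under translation of the first factor.\<close>
  define u where "u f = (\<lambda>(g, x). \<omega> x (\<delta> (inv\<^bsub>G\<^esub> g) f))" for f
  define \<psi> where "\<psi> f = (\<lambda>y. if y \<in> topspace X then Lim (ufilter (r y)) (u f) else 0)" for f
  have lim: "\<exists>q. continuous_map (ultra_topology ?D) euclidean q \<and>
      (\<forall>U\<in>ultrafilters ?D. (u f \<longlongrightarrow> q U) (ufilter U))" if f: "f \<in> carrier F" for f
  proof -
    obtain B where B: "\<And>g x. g \<in> carrier G \<Longrightarrow> x \<in> topspace X \<Longrightarrow> cmod (\<omega> x (\<delta> g f)) \<le> B"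
      using bdd[OF f] by blast
    \<comment> \<open>Restricting the target to a compact disc is what makes the limits
      exist.\<close>
    let ?T = "top_of_set (cball (0::complex) B)"
    have T: "compact_space ?T" "Hausdorff_space ?T"
      by (simp_all add: compact_space_subtopology Hausdorff_space_subtopology)
    have "\<exists>l. limitin ?T (u f) l (ufilter U)" if "U \<in> ultrafilters ?D" for U
      using that B by (intro ultrafilter_limit_exists[OF T(1)]) (auto simp: u_def)
    then obtain q where q: "\<And>U. U \<in> ultrafilters ?D \<Longrightarrow> limitin ?T (u f) (q U) (ufilter U)" by metis
    have "continuous_map (ultra_topology ?D) ?T q" using q by (rule continuous_map_ultrafilter_limit[OF T])
    then have "continuous_map (ultra_topology ?D) euclidean q" by (rule continuous_map_into_fulltopology)
    then show ?thesis using q by (auto simp: limitin_subtopology)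
  qed
  have tends: "(u f \<longlongrightarrow> \<psi> f y) (ufilter (r y))" if f: "f \<in> carrier F" and y: "y \<in> topspace X" for f y
  proof -
    obtain l where l: "(u f \<longlongrightarrow> l) (ufilter (r y))" using lim[OF f] rU[OF y] by blast
    then have "Lim (ufilter (r y)) (u f) = l" by (rule tendsto_Lim[OF nb[OF y]])
    then show ?thesis using l y by (simp add: \<psi>_def)
  qed
  \<comment> \<open>Every computation of \<psi> goes through this: u f may be replaced by a function
    that agrees with it on G \<times> X, since this set belongs to r y.\<close>
  have \<psi>I: "\<psi> f y = l" if "f \<in> carrier F" "y \<in> topspace X"
    "\<And>g x. g \<in> carrier G \<Longrightarrow> x \<in> topspace X \<Longrightarrow> u f (g, x) = v (g, x)" "(v \<longlongrightarrow> l) (ufilter (r y))" for f y v l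
  proof -
    have "eventually (\<lambda>d. u f d = v d) (ufilter (r y))"
      using rU[OF that(2)] by (rule eventually_ufilter_carrier) (use that(3) in auto)
    then have "(u f \<longlongrightarrow> l) (ufilter (r y))" using that(4) by (simp add: tendsto_cong)
    then show ?thesis using tendsto_unique[OF nb[OF that(2)] tends[OF that(1,2)]] by blast
  qed
  have \<psi>C: "\<psi> f \<in> C_carrier X" if f: "f \<in> carrier F" for f
  proof -
    obtain q where q: "continuous_map (ultra_topology ?D) euclidean q"
      "\<And>U. U \<in> ultrafilters ?D \<Longrightarrow> (u f \<longlongrightarrow> q U) (ufilter U)" using lim[OF f] by blast
    \<comment> \<open>Here \<psi> f appears as the continuous extension of u f to the
      compactification, pulled back along r.\<close>
    have "continuous_map X euclidean (q \<circ> r)" using r_cont q(1) by (rule continuous_map_compose)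
    then have "continuous_map X euclidean (\<psi> f)"
    proof (rule continuous_map_eq)
      fix y assume y: "y \<in> topspace X"
      show "(q \<circ> r) y = \<psi> f y" using \<psi>I[OF f y _ q(2)[OF rU[OF y]]] by simp
    qed
    then show ?thesis by (simp add: C_carrier_def \<psi>_def)
  qed
  have \<delta>_add: "\<delta> g (f + h) = \<delta> g f + \<delta> g h" if "g \<in> carrier G" "f \<in> carrier F" "h \<in> carrier F" for g f h
    using \<delta>_lin[OF that(1)] that by (simp add: linear_map_def)
  have \<delta>_scale: "\<delta> g (cscale F c f) = cscale F c (\<delta> g f)" if "g \<in> carrier G" "f \<in> carrier F" for g f c
    using \<delta>_lin[OF that(1)] that by (simp add: linear_map_def)
  note csF = is_cspaceD[OF F]
  have csV: "is_cspace V" using V by (rule is_cspace_C)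
  note csV' = is_cspaceD[OF csV, unfolded V]
  have "linear_map F V \<psi>"
    unfolding linear_map_def V
  proof (intro conjI ballI allI funcsetI \<psi>C)
    fix f assume f: "f \<in> carrier F"
    show "\<psi> (f + h) = \<psi> f + \<psi> h" if h: "h \<in> carrier F" for h
    proof (rule C_carrier_eqI[OF \<psi>C[OF csF(2)[OF f h]] csV'(2)[OF \<psi>C[OF f] \<psi>C[OF h]]])
      fix y assume y: "y \<in> topspace X"
      have "\<psi> (f + h) y = \<psi> f y + \<psi> h y"
      proof (rule \<psi>I[OF csF(2)[OF f h] y])
        show "((\<lambda>d. u f d + u h d) \<longlongrightarrow> \<psi> f y + \<psi> h y) (ufilter (r y))"
          by (intro tendsto_add tends f h y)
        show "u (f + h) (g, x) = u f (g, x) + u h (g, x)" if "g \<in> carrier G" "x \<in> topspace X" for g x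
          using that f h by (simp add: u_def \<delta>_add \<delta>_closed linear_map_scalarsD(1)[OF F \<omega>])
      qed
      then show "\<psi> (f + h) y = (\<psi> f + \<psi> h) y" by simp
    qed
    show "\<psi> (cscale F c f) = C_scale c (\<psi> f)" for c
    proof (rule C_carrier_eqI[OF \<psi>C[OF csF(3)[OF f]] csV'(3)[OF \<psi>C[OF f]]])
      fix y assume y: "y \<in> topspace X"
      have "\<psi> (cscale F c f) y = c * \<psi> f y"
      proof (rule \<psi>I[OF csF(3)[OF f] y])
        show "((\<lambda>d. c * u f d) \<longlongrightarrow> c * \<psi> f y) (ufilter (r y))"
          by (intro tendsto_mult tendsto_const tends f y)
        show "u (cscale F c f) (g, x) = c * u f (g, x)" if "g \<in> carrier G" "x \<in> topspace X" for g x
          using that f by (simp add: u_def \<delta>_scale \<delta>_closed linear_map_scalarsD(2)[OF F \<omega>])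
      qed
      then show "\<psi> (cscale F c f) y = C_scale c (\<psi> f) y" by (simp add: C_scale_def)
    qed
  qed
  moreover have "equivariant_on G (carrier F) \<delta> (C_action G X \<alpha>) \<psi>"
    unfolding equivariant_on_def
  proof (intro ballI)
    fix g f assume g: "g \<in> carrier G" and f: "f \<in> carrier F"
    let ?i = "inv\<^bsub>G\<^esub> g"
    have gf: "\<delta> g f \<in> carrier F" using g f by (rule \<delta>_closed)
    show "\<psi> (\<delta> g f) = C_action G X \<alpha> g (\<psi> f)"
    proof (rule C_carrier_eqI[OF \<psi>C[OF gf] C_action_closed[OF g \<psi>C[OF f]]])
      fix y assume y: "y \<in> topspace X"
      have i: "?i \<in> carrier G" using g by simp
      have iy: "\<alpha> ?i y \<in> topspace X" using i y by (rule spcD(5))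
      \<comment> \<open>The equivariance of r enters: moving y by the inverse of g replaces the
        ultrafilter by its image under translation.\<close>
      have "r (\<alpha> ?i y) = push (shift G ?i) (r y)"
        using r i y rU[OF y] by (simp add: G_map_def equivariant_on_def ultra_action_def)
      then have "ufilter (r (\<alpha> ?i y)) = filtermap (shift G ?i) (ufilter (r y))"
        by (simp add: ufilter_push[OF shift_closed[OF grp i] rU[OF y]])
      then have "((\<lambda>d. u f (shift G ?i d)) \<longlongrightarrow> \<psi> f (\<alpha> ?i y)) (ufilter (r y))"
        using tends[OF f iy] by (simp add: filterlim_filtermap)
      \<comment> \<open>Both sides are \<omega> x applied to h^-1 g f.\<close>
      moreover have "u (\<delta> g f) (h, x) = u f (shift G ?i (h, x))" if "h \<in> carrier G" "x \<in> topspace X" for h x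
        using that g f by (simp add: u_def shift_def inv_mult_group group_action.composition_rule[OF \<delta>])
      ultimately have "\<psi> (\<delta> g f) y = \<psi> f (\<alpha> ?i y)" using \<psi>I[OF gf y, of "\<lambda>d. u f (shift G ?i d)"] by blast
      then show "\<psi> (\<delta> g f) y = C_action G X \<alpha> g (\<psi> f) y" by (simp add: C_action_apply[OF \<psi>C[OF f] y])
    qed
  qed
  moreover have "\<psi> (\<iota> e) = \<phi> e" if e: "e \<in> carrier E" for e
  proof -
    have ie: "\<iota> e \<in> carrier F" using \<iota>(1) e by (auto simp: linear_map_def)
    have pe: "\<phi> e \<in> C_carrier X" using \<phi>(1) e V by (auto simp: linear_map_def)
    show ?thesis
    proof (rule C_carrier_eqI[OF \<psi>C[OF ie] pe])
      fix y assume y: "y \<in> topspace X"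
      have "limitin euclidean (\<phi> e \<circ> ?f) (\<phi> e y) (ufilter (r y))"
        using pe by (intro continuous_map_limit[OF _ r_lim[OF y]]) (simp add: C_carrier_def)
      \<comment> \<open>Equivariance of \<iota> and \<phi> turns the value into \<phi> e (g x), a
        continuous function of the orbit point; the orbit point tends to y along r y.\<close>
      moreover have "u (\<iota> e) (g, x) = (\<phi> e \<circ> ?f) (g, x)" if g: "g \<in> carrier G" and x: "x \<in> topspace X" for g x
      proof -
        have i: "inv\<^bsub>G\<^esub> g \<in> carrier G" using g by simp
        have "u (\<iota> e) (g, x) = \<omega> x (\<iota> (\<gamma> (inv\<^bsub>G\<^esub> g) e))"
          using \<iota>(2) i e by (simp add: u_def equivariant_on_def)
        also have "\<dots> = \<phi> (\<gamma> (inv\<^bsub>G\<^esub> g) e) x"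
          using x group_action.element_image[OF \<gamma> i e] by (intro ext) simp_all
        also have "\<dots> = C_action G X \<alpha> (inv\<^bsub>G\<^esub> g) (\<phi> e) x"
          using \<phi>(2) i e by (simp add: equivariant_on_def)
        finally show ?thesis using g by (simp add: C_action_apply[OF pe x])
      qed
      ultimately show "\<psi> (\<iota> e) y = \<phi> e y" using \<psi>I[OF ie y, of "\<phi> e \<circ> ?f"] by simp
    qed
  qed
  moreover have "\<psi> f y \<in> S" if f: "f \<in> carrier F" and S: "closed S"
    and in_S: "\<And>g x. g \<in> carrier G \<Longrightarrow> x \<in> topspace X \<Longrightarrow> \<omega> x (\<delta> g f) \<in> S" and y: "y \<in> topspace X" for f S y
  proof (rule Lim_in_closed_set[OF S _ nb[OF y] tends[OF f y]])
    show "eventually (\<lambda>d. u f d \<in> S) (ufilter (r y))"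
      using rU[OF y] by (rule eventually_ufilter_carrier) (use in_S in \<open>auto simp: u_def\<close>)
  qed
  ultimately show ?thesis by (intro that[of \<psi>]) blast+
qed

section \<open>Injectivity among Banach spaces\<close>

lemma linear_map_eval:
  assumes "linear_map E V \<phi>" "carrier V = C_carrier X" "cscale V = C_scale"
  shows "linear_map E scalars (\<lambda>e. \<phi> e x)"
  using assms unfolding linear_map_scalars_iff by (simp add: linear_map_def C_scale_def)

lemma (in G_space_locale) G_injective_banach_space_C:
  assumes proj: "G_projective TYPE(('g \<times> 'x) set set) G X \<alpha>"
  shows "G_injective_banach_space TYPE('e::ab_group_add) TYPE('f::ab_group_add) G (C_banach X) (C_action G X \<alpha>)"
  unfolding G_injective_banach_space_def
proof (intro conjI allI impI)
  show "G_banach_space G (C_banach X) (C_action G X \<alpha>)" by (rule G_banach_space_C)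
  fix E :: "'e nspace" and \<gamma> and F :: "'f nspace" and \<delta> \<iota> \<phi>
  assume E: "G_banach_space G E \<gamma>" and F: "G_banach_space G F \<delta>"
    and \<iota>: "linear_isometry E F \<iota>" "equivariant_on G (carrier E) \<gamma> \<delta> \<iota>"
    and \<phi>: "contractive E (C_banach X) \<phi>" "equivariant_on G (carrier E) \<gamma> (C_action G X \<alpha>) \<phi>"
  have cs: "is_cspace E" "is_cspace F" using E F by (simp_all add: G_banach_space_def banach_space_def)
  have ga: "group_action G (carrier E) \<gamma>" "group_action G (carrier F) \<delta>"
    using E F by (simp_all add: G_banach_space_def)
  have iso: "linear_map F F (\<delta> g)" "\<And>f. f \<in> carrier F \<Longrightarrow> vnorm F (\<delta> g f) = vnorm F f" if "g \<in> carrier G" for g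
    using F that by (simp_all add: G_banach_space_def linear_isometry_def)
  have lin: "linear_map E F \<iota>" "linear_map E (C_banach X) \<phi>"
    using \<iota> \<phi> by (simp_all add: linear_isometry_def contractive_def)
  \<comment> \<open>Hahn-Banach at each point separately, with no relation sought between different
    points or group elements.\<close>
  have "\<exists>\<omega>. linear_map F scalars \<omega> \<and> (\<forall>e\<in>carrier E. \<omega> (\<iota> e) = \<phi> e x) \<and>
      (\<forall>f\<in>carrier F. cmod (\<omega> f) \<le> vnorm F f)" if x: "x \<in> topspace X" for x
  proof (rule seminorm_Hahn_Banach[where p = "vnorm F",
        OF cs lin(1) linear_map_eval[OF lin(2) C_banach_simps, where x = x]])
    show "vnorm F (a + b) \<le> vnorm F a + vnorm F b" if "a \<in> carrier F" "b \<in> carrier F" for a b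
      using F that by (simp add: G_banach_space_def banach_space_def)
    show "vnorm F (cscale F c a) = cmod c * vnorm F a" if "a \<in> carrier F" for a c
      using F that by (simp add: G_banach_space_def banach_space_def)
    fix e assume e: "e \<in> carrier E"
    have "\<phi> e \<in> C_carrier X" using lin(2) e by (auto simp: linear_map_def)
    then have "cmod (\<phi> e x) \<le> vnorm (C_banach X) (\<phi> e)" using cmod_le_C_vnorm[OF spcD(1)] x by blast
    also have "\<dots> \<le> vnorm E e" using \<phi>(1) e by (simp add: contractive_def)
    also have "\<dots> = vnorm F (\<iota> e)" using \<iota>(1) e by (simp add: linear_isometry_def)
    finally show "cmod (\<phi> e x) \<le> vnorm F (\<iota> e)" .
  qed blast
  then obtain \<omega> where \<omega>: "\<And>x. x \<in> topspace X \<Longrightarrow> linear_map F scalars (\<omega> x)"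
    "\<And>x e. x \<in> topspace X \<Longrightarrow> e \<in> carrier E \<Longrightarrow> \<omega> x (\<iota> e) = \<phi> e x"
    "\<And>x f. x \<in> topspace X \<Longrightarrow> f \<in> carrier F \<Longrightarrow> cmod (\<omega> x f) \<le> vnorm F f" by metis
  \<comment> \<open>Each \<delta> g is isometric, so one bound holds on the whole orbit of
    f.\<close>
  have bound: "cmod (\<omega> x (\<delta> g f)) \<le> vnorm F f"
    if "g \<in> carrier G" "x \<in> topspace X" "f \<in> carrier F" for g x f
    using \<omega>(3)[OF that(2) group_action.element_image[OF ga(2) that(1,3)]] iso(2)[OF that(1,3)] by simp
  then have ex: "\<exists>B. \<forall>g\<in>carrier G. \<forall>x\<in>topspace X. cmod (\<omega> x (\<delta> g f)) \<le> B"
    if "f \<in> carrier F" for f using that by blast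
  obtain \<psi> where \<psi>: "linear_map F (C_banach X) \<psi>" "equivariant_on G (carrier F) \<delta> (C_action G X \<alpha>) \<psi>"
    "\<forall>e\<in>carrier E. \<psi> (\<iota> e) = \<phi> e"
    "\<forall>f\<in>carrier F. \<forall>S. closed S \<longrightarrow> (\<forall>g\<in>carrier G. \<forall>x\<in>topspace X. \<omega> x (\<delta> g f) \<in> S) \<longrightarrow>
       (\<forall>y\<in>topspace X. \<psi> f y \<in> S)"
    using equivariant_extension[OF proj C_banach_simps cs(2) ga(2) iso(1) ga(1) lin(1) \<iota>(2) lin(2) \<phi>(2) \<omega>(1,2) ex]
    by blast
  have "vnorm (C_banach X) (\<psi> f) \<le> vnorm F f" if f: "f \<in> carrier F" for f
  proof (rule C_vnorm_le)
    show "0 \<le> vnorm F f" using F f by (simp add: G_banach_space_def banach_space_def)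
    show "cmod (\<psi> f y) \<le> vnorm F f" if "y \<in> topspace X" for y
      \<comment> \<open>The closed condition is membership in the disc of radius
        \<open>vnorm F f\<close> about 0.\<close>
      using \<psi>(4)[rule_format, OF f closed_cball[of 0 "vnorm F f"] _ that] bound f by simp
  qed
  then show "\<exists>\<psi>. contractive F (C_banach X) \<psi> \<and> equivariant_on G (carrier F) \<delta> (C_action G X \<alpha>) \<psi> \<and>
      (\<forall>x\<in>carrier E. \<psi> (\<iota> x) = \<phi> x)"
    using \<psi>(1-3) by (auto simp: contractive_def)
qed

section \<open>Operator spaces\<close>

text \<open>Operator spaces carry norms, and operator systems cones, of matrices only; the norm or
  positivity of a single element is read off its 1 x 1 matrix.\<close>

definition mat1 :: "'a \<Rightarrow> 'a mat" where
  "mat1 f = Matrix.mat 1 1 (\<lambda>_. f)"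

lemma mat1_carrier [simp]: "mat1 f \<in> carrier_mat 1 1"
  by (simp add: mat1_def)

lemma mat1_index [simp]: "mat1 f $$ (0, 0) = f"
  by (simp add: mat1_def)

lemma mat1_in_mats [simp]: "mat1 f \<in> mats V (Suc 0) \<longleftrightarrow> f \<in> carrier V"
  by (auto simp: mats_iff mat1_def)

lemma map_mat_mat1: "map_mat h (mat1 f) = mat1 (h f)"
  by (intro eq_matI) (auto simp: mat1_def)

lemma mat1_add: "mat1 (f + h) = mat1 f + mat1 h"
  by (intro eq_matI) (auto simp: mat1_def)

lemma mat1_zero: "mat1 0 = 0\<^sub>m 1 1"
  by (intro eq_matI) (auto simp: mat1_def)

lemma mat1_inject: "mat1 f = mat1 h \<longleftrightarrow> f = h"
  by (metis mat1_index)

text \<open>A row and a column compress a matrix of any size to a single element. This is the bridge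
  from the matrix axioms to scalar functionals.\<close>

lemma sandwich_mat1:
  assumes "a \<in> carrier_mat 1 n" "b \<in> carrier_mat n 1" "x \<in> carrier_mat n n"
  shows "sandwich V a x b = mat1 (\<Sum>k<n. \<Sum>l<n. cscale V (a $$ (0, k) * b $$ (l, 0)) (x $$ (k, l)))"
  using assms by (intro eq_matI) (auto simp: sandwich_def mat1_def)

lemma linear_map_sandwich:
  assumes F: "is_cspace F" and \<omega>: "linear_map F scalars \<omega>" and x: "x \<in> mats F n"
  shows "(\<Sum>k<n. \<Sum>l<n. cscale F (c k l) (x $$ (k, l))) \<in> carrier F"
    and "\<omega> (\<Sum>k<n. \<Sum>l<n. cscale F (c k l) (x $$ (k, l))) = (\<Sum>k<n. \<Sum>l<n. c k l * \<omega> (x $$ (k, l)))"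
proof -
  have m: "cscale F (c k l) (x $$ (k, l)) \<in> carrier F" if "k < n" "l < n" for k l
    using that x is_cspaceD(3)[OF F] by (simp add: mats_iff)
  have m2: "(\<Sum>l<n. cscale F (c k l) (x $$ (k, l))) \<in> carrier F" if "k < n" for k
    using m that by (intro is_cspace_sum[OF F]) auto
  then show "(\<Sum>k<n. \<Sum>l<n. cscale F (c k l) (x $$ (k, l))) \<in> carrier F"
    by (rule is_cspace_sum[OF F]) auto
  have "\<omega> (\<Sum>k<n. \<Sum>l<n. cscale F (c k l) (x $$ (k, l))) =
      (\<Sum>k<n. \<omega> (\<Sum>l<n. cscale F (c k l) (x $$ (k, l))))"
    using m2 by (intro linear_map_sum[OF F \<omega>]) auto
  also have "\<dots> = (\<Sum>k<n. \<Sum>l<n. \<omega> (cscale F (c k l) (x $$ (k, l))))"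
    using m by (intro sum.cong refl linear_map_sum[OF F \<omega>]) auto
  also have "\<dots> = (\<Sum>k<n. \<Sum>l<n. c k l * \<omega> (x $$ (k, l)))"
    using x by (intro sum.cong refl linear_map_scalarsD(2)[OF F \<omega>]) (auto simp: mats_iff)
  finally show "\<omega> (\<Sum>k<n. \<Sum>l<n. cscale F (c k l) (x $$ (k, l))) = (\<Sum>k<n. \<Sum>l<n. c k l * \<omega> (x $$ (k, l)))" .
qed

lemma opnorm_col: "opnorm (Matrix.mat n 1 (\<lambda>(i, _). vec_index v i)) \<le> l2norm v" if "dim_vec v = n"
proof (rule opnorm_le)
  let ?c = "Matrix.mat n 1 (\<lambda>(i, _). vec_index v i)"
  fix u :: "complex Matrix.vec" assume "u \<in> carrier_vec (dim_col ?c)"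
  then have u: "dim_vec u = 1" by simp
  have "?c *\<^sub>v u = vec_index u 0 \<cdot>\<^sub>v v"
    using that u by (intro eq_vecI) (auto simp: scalar_prod_def mult.commute)
  then show "l2norm (?c *\<^sub>v u) \<le> l2norm v * l2norm u"
    using cmod_le_l2norm[of 0 u] u by (simp add: l2norm_smult mult.commute[of "l2norm v"] mult_right_mono)
qed simp

text \<open>This is the Cauchy-Schwarz inequality, the row being the adjoint of the column
  w.\<close>

lemma opnorm_row: "opnorm (Matrix.mat 1 n (\<lambda>(_, i). cnj (vec_index w i))) \<le> l2norm w" if "dim_vec w = n"
proof (rule opnorm_le)
  let ?c = "Matrix.mat 1 n (\<lambda>(_, i). cnj (vec_index w i))"
  fix u :: "complex Matrix.vec" assume "u \<in> carrier_vec (dim_col ?c)"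
  then have u: "dim_vec u = n" by simp
  have "l2norm (?c *\<^sub>v u) = cmod (\<Sum>i<n. cnj (vec_index w i) * vec_index u i)"
    using u by (simp add: l2norm_def scalar_prod_def atLeast0LessThan)
  also have "\<dots> \<le> (\<Sum>i<n. cmod (vec_index w i) * cmod (vec_index u i))"
    by (rule order_trans[OF norm_sum]) (simp add: norm_mult)
  also have "\<dots> \<le> l2norm w * l2norm u"
    unfolding l2norm_L2_set that u
    using L2_set_mult_ineq[of "\<lambda>i. cmod (vec_index w i)" "\<lambda>i. cmod (vec_index u i)" "{..<n}"] by simp
  finally show "l2norm (?c *\<^sub>v u) \<le> l2norm w * l2norm u" .
qed simp

text \<open>Contractive functionals on operator spaces are completely contractive, by Ruan's axiom
  applied to a row and a column.\<close>
lemma contractive_functional_matrix: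
  assumes F: "operator_space F" and \<omega>: "linear_map F scalars \<omega>"
    and le: "\<And>f. f \<in> carrier F \<Longrightarrow> cmod (\<omega> f) \<le> mnorm F (mat1 f)" and a: "a \<in> mats F n"
  shows "opnorm (map_mat \<omega> a) \<le> mnorm F a"
proof (rule opnorm_le)
  have cs: "is_cspace F" using F by (simp add: operator_space_def)
  show N: "0 \<le> mnorm F a" using F a by (simp add: operator_space_def)
  let ?M = "map_mat \<omega> a"
  have ac: "a \<in> carrier_mat n n" using a by (simp add: mats_iff)
  fix v :: "complex Matrix.vec" assume "v \<in> carrier_vec (dim_col ?M)"
  then have v: "dim_vec v = n" using ac by simp
  \<comment> \<open>With w the image of v, the row formed from w and the column v compress a to one
    element, at which \<omega> takes the square of the norm of w as value.\<close>
  define w where "w = ?M *\<^sub>v v"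
  have w: "dim_vec w = n" using ac by (simp add: w_def)
  let ?r = "Matrix.mat 1 n (\<lambda>(_, i). cnj (vec_index w i))"
  let ?c = "Matrix.mat n 1 (\<lambda>(i, _). vec_index v i)"
  let ?s = "\<Sum>k<n. \<Sum>l<n. cscale F (?r $$ (0, k) * ?c $$ (l, 0)) (a $$ (k, l))"
  have "\<omega> ?s = (\<Sum>k<n. \<Sum>l<n. ?r $$ (0, k) * ?c $$ (l, 0) * \<omega> (a $$ (k, l)))"
    by (rule linear_map_sandwich(2)[OF cs \<omega> a])
  also have "\<dots> = (\<Sum>k<n. cnj (vec_index w k) * (\<Sum>l<n. \<omega> (a $$ (k, l)) * vec_index v l))"
    by (intro sum.cong refl) (simp add: sum_distrib_left mult_ac)
  also have "\<dots> = (\<Sum>k<n. cnj (vec_index w k) * vec_index w k)"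
    using ac v by (intro sum.cong refl arg_cong2[of _ _ _ _ "(*)"])
      (simp_all add: w_def scalar_prod_def atLeast0LessThan)
  also have "\<dots> = complex_of_real ((l2norm w)\<^sup>2)"
  proof -
    have "cnj (vec_index w k) * vec_index w k = complex_of_real ((cmod (vec_index w k))\<^sup>2)" for k
      using complex_norm_square[of "vec_index w k"] by (simp add: mult.commute)
    then show ?thesis by (simp add: l2norm_def w sum_nonneg)
  qed
  finally have "(l2norm w)\<^sup>2 = cmod (\<omega> ?s)" by (simp add: norm_power)
  also have "\<dots> \<le> mnorm F (sandwich F ?r a ?c)"
    using le[OF linear_map_sandwich(1)[OF cs \<omega> a]] ac by (subst sandwich_mat1[of _ n]) auto
  also have "\<dots> \<le> opnorm ?r * mnorm F a * opnorm ?c"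
    using F a unfolding operator_space_def by (metis (no_types, lifting) mat_carrier)
  also have "\<dots> \<le> l2norm w * mnorm F a * l2norm v"
    using N opnorm_row[OF w] opnorm_col[OF v] by (intro mult_mono) auto
  finally have *: "l2norm w * l2norm w \<le> l2norm w * (mnorm F a * l2norm v)"
    by (simp add: power2_eq_square mult.assoc)
  show "l2norm (?M *\<^sub>v v) \<le> mnorm F a * l2norm v"
  proof (cases "l2norm w = 0")
    case True
    then show ?thesis using N by (simp flip: w_def)
  next
    case False
    then have "l2norm w > 0" using l2norm_nonneg[of w] by linarith
    then show ?thesis using * by (simp flip: w_def)
  qed
qed

lemma (in G_space_locale) G_injective_operator_space_C:
  assumes proj: "G_projective TYPE(('g \<times> 'x) set set) G X \<alpha>"
  shows "G_injective_operator_space TYPE('e::ab_group_add) TYPE('f::ab_group_add) G (C_opspace X) (C_action G X \<alpha>)"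
  unfolding G_injective_operator_space_def
proof (intro conjI allI impI)
  show "G_operator_space G (C_opspace X) (C_action G X \<alpha>)" by (rule G_operator_space_C)
  fix E :: "'e opspace" and \<gamma> and F :: "'f opspace" and \<delta> \<iota> \<phi>
  assume E: "G_operator_space G E \<gamma>" and F: "G_operator_space G F \<delta>"
    and \<iota>: "completely_isometric E F \<iota>" "equivariant_on G (carrier E) \<gamma> \<delta> \<iota>"
    and \<phi>: "completely_contractive E (C_opspace X) \<phi>" "equivariant_on G (carrier E) \<gamma> (C_action G X \<alpha>) \<phi>"
  have os: "operator_space E" "operator_space F" using E F by (simp_all add: G_operator_space_def)
  have cs: "is_cspace E" "is_cspace F" using os by (simp_all add: operator_space_def)
  have ga: "group_action G (carrier E) \<gamma>" "group_action G (carrier F) \<delta>"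
    using E F by (simp_all add: G_operator_space_def)
  let ?p = "\<lambda>f. mnorm F (mat1 f)"
  have iso: "linear_map F F (\<delta> g)" "\<And>f. f \<in> carrier F \<Longrightarrow> ?p (\<delta> g f) = ?p f" if "g \<in> carrier G" for g
    using F that map_mat_mat1 mat1_in_mats unfolding G_operator_space_def completely_isometric_def
    by metis+
  have lin: "linear_map E F \<iota>" "linear_map E (C_opspace X) \<phi>"
    using \<iota> \<phi> by (simp_all add: completely_isometric_def completely_contractive_def)
  have "\<exists>\<omega>. linear_map F scalars \<omega> \<and> (\<forall>e\<in>carrier E. \<omega> (\<iota> e) = \<phi> e x) \<and>
      (\<forall>f\<in>carrier F. cmod (\<omega> f) \<le> ?p f)" if x: "x \<in> topspace X" for x
  \<comment> \<open>Only the norm of 1 x 1 matrices enters the extension; the higher levels are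
    recovered afterwards.\<close>
  proof (rule seminorm_Hahn_Banach[where p = ?p,
        OF cs lin(1) linear_map_eval[OF lin(2) C_opspace_simps, where x = x]])
    show "?p (a + b) \<le> ?p a + ?p b" if "a \<in> carrier F" "b \<in> carrier F" for a b
      using os(2) that mat1_in_mats[of _ F] unfolding operator_space_def mat1_add by blast
    show "?p (cscale F c a) = cmod c * ?p a" if "a \<in> carrier F" for a c
      using os(2) that mat1_in_mats[of _ F] unfolding operator_space_def map_mat_mat1[symmetric] by blast
    fix e assume e: "e \<in> carrier E"
    have "\<phi> e \<in> C_carrier X" using lin(2) e by (auto simp: linear_map_def)
    then have m: "mat1 (\<phi> e) \<in> mats (C_opspace X) 1" by simp
    have "cmod (\<phi> e x) \<le> opnorm (mat1 (\<phi> e x))"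
      using entry_le_opnorm[of 0 "mat1 (\<phi> e x)" 0] by (simp add: mat1_def)
    also have "\<dots> \<le> mnorm (C_opspace X) (mat1 (\<phi> e))"
      using opnorm_le_C_mnorm[OF spcD(1) m x] by (simp add: map_mat_mat1)
    also have "\<dots> \<le> mnorm E (mat1 e)"
      using \<phi>(1) e mat1_in_mats[of e E] unfolding completely_contractive_def map_mat_mat1[symmetric] by blast
    also have "\<dots> = ?p (\<iota> e)"
      using \<iota>(1) e mat1_in_mats[of e E] unfolding completely_isometric_def map_mat_mat1[symmetric] by metis
    finally show "cmod (\<phi> e x) \<le> ?p (\<iota> e)" .
  qed blast
  then obtain \<omega> where \<omega>: "\<And>x. x \<in> topspace X \<Longrightarrow> linear_map F scalars (\<omega> x)"
    "\<And>x e. x \<in> topspace X \<Longrightarrow> e \<in> carrier E \<Longrightarrow> \<omega> x (\<iota> e) = \<phi> e x"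
    "\<And>x f. x \<in> topspace X \<Longrightarrow> f \<in> carrier F \<Longrightarrow> cmod (\<omega> x f) \<le> ?p f" by metis
  have bound: "cmod (\<omega> x (\<delta> g f)) \<le> ?p f"
    if "g \<in> carrier G" "x \<in> topspace X" "f \<in> carrier F" for g x f
    using \<omega>(3)[OF that(2) group_action.element_image[OF ga(2) that(1,3)]] iso(2)[OF that(1,3)] by simp
  then have ex: "\<exists>B. \<forall>g\<in>carrier G. \<forall>x\<in>topspace X. cmod (\<omega> x (\<delta> g f)) \<le> B"
    if "f \<in> carrier F" for f using that by blast
  obtain \<psi> where \<psi>: "linear_map F (C_opspace X) \<psi>" "equivariant_on G (carrier F) \<delta> (C_action G X \<alpha>) \<psi>"
    "\<forall>e\<in>carrier E. \<psi> (\<iota> e) = \<phi> e"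
    "\<forall>f\<in>carrier F. \<forall>S. closed S \<longrightarrow> (\<forall>g\<in>carrier G. \<forall>x\<in>topspace X. \<omega> x (\<delta> g f) \<in> S) \<longrightarrow>
       (\<forall>y\<in>topspace X. \<psi> f y \<in> S)"
    using equivariant_extension[OF proj C_opspace_simps cs(2) ga(2) iso(1) ga(1) lin(1) \<iota>(2) lin(2) \<phi>(2) \<omega>(1,2) ex]
    by blast
  have "mnorm (C_opspace X) (map_mat \<psi> a) \<le> mnorm F a" if a: "a \<in> mats F n" for n a
  proof (rule C_mnorm_le)
    show "0 \<le> mnorm F a" using os(2) a by (simp add: operator_space_def)
    fix y assume y: "y \<in> topspace X"
    have "cmod (\<psi> f y) \<le> ?p f" if f: "f \<in> carrier F" for f
      using \<psi>(4)[rule_format, OF f closed_cball[of 0 "?p f"] _ y] bound f by simp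
    \<comment> \<open>Evaluation of \<psi> at y is a contractive functional, hence a completely
      contractive one, and the matrix norms of C(X) are suprema over the points y.\<close>
    then have "opnorm (map_mat (\<lambda>f. \<psi> f y) a) \<le> mnorm F a"
      by (rule contractive_functional_matrix[OF os(2) linear_map_eval[OF \<psi>(1) C_opspace_simps] _ a])
    moreover have "eval_mat y (map_mat \<psi> a) = map_mat (\<lambda>f. \<psi> f y) a" by (intro eq_matI) auto
    ultimately show "opnorm (eval_mat y (map_mat \<psi> a)) \<le> mnorm F a" by simp
  qed
  then show "\<exists>\<psi>. completely_contractive F (C_opspace X) \<psi> \<and> equivariant_on G (carrier F) \<delta> (C_action G X \<alpha>) \<psi> \<and>
      (\<forall>x\<in>carrier E. \<psi> (\<iota> x) = \<phi> x)"
    using \<psi>(1-3) by (auto simp: completely_contractive_def)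
qed

section \<open>Operator systems\<close>

definition pos :: "('a::ab_group_add) opsystem \<Rightarrow> 'a \<Rightarrow> bool" where
  "pos V f \<longleftrightarrow> f \<in> carrier V \<and> mat1 f \<in> mcone V"

definition runit :: "('a::ab_group_add) opsystem \<Rightarrow> real \<Rightarrow> 'a" where
  "runit V r = cscale V (complex_of_real r) (ounit V)"

text \<open>The self-adjoint part. It is needed because the order unit dominates self-adjoint
  elements only, while the majorant has to be defined on all of F.\<close>

definition re_part :: "('a::ab_group_add) opsystem \<Rightarrow> 'a \<Rightarrow> 'a" where
  "re_part V f = cscale V (1 / 2) (f + invol V f)"

lemma mat_star_mat1: "mat_star V (mat1 f) = mat1 (invol V f)"
  by (intro eq_matI) (auto simp: mat_star_def mat1_def)

lemma unit_mat_mat1: "unit_mat V r 1 = mat1 (runit V r)"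
  by (intro eq_matI) (auto simp: unit_mat_def mat1_def runit_def)

lemma cscale_half_double:
  assumes V: "is_cspace V"
  shows "cscale V (1 / 2) (f + f) = f"
proof -
  have "cscale V (1 / 2) (f + f) = cscale V (1 / 2 + 1 / 2) f"
    unfolding is_cspaceD(6,7)[OF V] ..
  then show ?thesis by (simp add: is_cspaceD[OF V])
qed

locale opsystem_locale =
  fixes V :: "'a::ab_group_add opsystem"
  assumes opsys: "operator_system V"
begin

section \<open>Operator systems\<close>

lemma mo: "matrix_ordered V" using opsys by (simp add: operator_system_def)
lemma star: "star_space V" using mo by (simp add: matrix_ordered_def)
lemma cs: "is_cspace V" using star by (simp add: star_space_def)
lemmas csD = is_cspaceD[OF cs]

lemma invol_closed: "x \<in> carrier V \<Longrightarrow> invol V x \<in> carrier V"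
  and invol_invol: "x \<in> carrier V \<Longrightarrow> invol V (invol V x) = x"
  and invol_add: "x \<in> carrier V \<Longrightarrow> y \<in> carrier V \<Longrightarrow> invol V (x + y) = invol V x + invol V y"
  and invol_scale: "x \<in> carrier V \<Longrightarrow> invol V (cscale V c x) = cscale V (cnj c) (invol V x)"
  using star by (simp_all add: star_space_def)

lemma unit_closed: "ounit V \<in> carrier V" and invol_unit: "invol V (ounit V) = ounit V"
  using opsys by (simp_all add: operator_system_def)

lemma runit_closed: "runit V r \<in> carrier V"
  unfolding runit_def by (intro csD unit_closed)

lemma runit_add: "runit V (r + s) = runit V r + runit V s"
  by (simp add: runit_def csD)

lemma runit_scale: "runit V (t * r) = cscale V (complex_of_real t) (runit V r)"
  by (simp add: runit_def csD)

lemma pos_closed: "pos V f \<Longrightarrow> f \<in> carrier V" by (simp add: pos_def)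

lemma pos_invol: "pos V f \<Longrightarrow> invol V f = f"
proof -
  assume "pos V f"
  then have "mat_star V (mat1 f) = mat1 f" using mo unfolding matrix_ordered_def pos_def by blast
  then show ?thesis by (simp add: mat_star_mat1 mat1_inject)
qed

lemma pos_add:
  assumes "pos V f" "pos V h"
  shows "pos V (f + h)"
proof -
  have "mat1 f \<in> mcone V \<inter> mats V (Suc 0)" "mat1 h \<in> mcone V \<inter> mats V (Suc 0)"
    using assms by (simp_all add: pos_def)
  then have "mat1 f + mat1 h \<in> mcone V" using mo unfolding matrix_ordered_def by blast
  then show ?thesis using assms by (simp add: pos_def csD mat1_add)
qed

lemma pos_scale:
  assumes "pos V f" "0 \<le> r"
  shows "pos V (cscale V (complex_of_real r) f)"
proof -
  have "map_mat (cscale V (complex_of_real r)) (mat1 f) \<in> mcone V"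
    using mo assms unfolding matrix_ordered_def pos_def by blast
  then show ?thesis using assms by (simp add: pos_def csD map_mat_mat1)
qed

lemma pos_zero: "pos V 0"
  using mo by (simp add: matrix_ordered_def pos_def csD mat1_zero)

lemma order_unit:
  assumes "f \<in> carrier V" "invol V f = f"
  shows "\<exists>r>0. pos V (runit V r + f)"
proof -
  have m: "mat1 f \<in> mats V (Suc 0)" using assms by simp
  have "mat_star V (mat1 f) = mat1 f" using assms by (simp add: mat_star_mat1)
  then have "\<exists>r>0. unit_mat V r (Suc 0) + mat1 f \<in> mcone V"
    using opsys m unfolding operator_system_def by blast
  then show ?thesis
    using assms by (simp add: pos_def mat1_add csD runit_closed unit_mat_mat1[unfolded One_nat_def])
qed

text \<open>Positivity of the unit is derived from the order unit property at 0, which gives some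
  positive multiple of it; rescaling yields the others.\<close>

lemma pos_unit: "0 \<le> r \<Longrightarrow> pos V (runit V r)"
proof -
  assume r: "0 \<le> r"
  have "invol V 0 = 0" using invol_scale[of 0 0] csD(1) by (simp add: csD)
  then obtain s where s: "s > 0" "pos V (runit V s)" using order_unit[OF csD(1)] by auto
  have "runit V r = cscale V (complex_of_real (r / s)) (runit V s)"
    using s(1) runit_scale[of "r / s" s] by simp
  then show ?thesis using pos_scale[OF s(2), of "r / s"] r s(1) by simp
qed

lemma re_part_closed: "f \<in> carrier V \<Longrightarrow> re_part V f \<in> carrier V"
  unfolding re_part_def by (intro csD invol_closed)

lemma invol_re_part: "f \<in> carrier V \<Longrightarrow> invol V (re_part V f) = re_part V f"
  by (simp add: re_part_def invol_scale csD invol_closed invol_add invol_invol add.commute)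

lemma re_part_add: "f \<in> carrier V \<Longrightarrow> h \<in> carrier V \<Longrightarrow> re_part V (f + h) = re_part V f + re_part V h"
  by (simp add: re_part_def invol_add csD flip: csD(6)) (simp add: algebra_simps)

lemma cscale_commute: "cscale V c (cscale V d x) = cscale V d (cscale V c x)"
  using csD(8)[of c d x] csD(8)[of d c x] by (simp add: mult.commute)

lemma re_part_scale:
  "f \<in> carrier V \<Longrightarrow> re_part V (cscale V (complex_of_real t) f) = cscale V (complex_of_real t) (re_part V f)"
  by (simp add: re_part_def invol_scale cscale_commute[of _ "1 / 2"] flip: csD(6))

lemma re_part_self: "invol V f = f \<Longrightarrow> re_part V f = f"
  by (simp add: re_part_def cscale_half_double[OF cs])

text \<open>An imaginary multiple of a self-adjoint element is skew-adjoint. This is used to show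
  that extended functionals are real on positive elements.\<close>

lemma re_part_imaginary:
  assumes "f \<in> carrier V" "invol V f = f" "Re c = 0"
  shows "re_part V (cscale V c f) = 0"
proof -
  have "cnj c = - c" using assms(3) by (simp add: complex_eq_iff)
  then have "invol V (cscale V c f) = cscale V (- c) f" using assms by (simp add: invol_scale)
  then have "cscale V c f + invol V (cscale V c f) = cscale V (c + - c) f" by (simp only: csD(7))
  then show ?thesis by (simp add: re_part_def csD)
qed

text \<open>The Cartesian decomposition, with the imaginary part written as the self-adjoint part of
  - i f.\<close>

lemma re_im_decomp:
  assumes f: "f \<in> carrier V"
  shows "f = re_part V f + cscale V \<i> (re_part V (cscale V (- \<i>) f))"
proof -
  have "cscale V \<i> (re_part V (cscale V (- \<i>) f)) = cscale V (1 / 2) (f + - invol V f)"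
  proof -
    have "invol V (cscale V (- \<i>) f) = cscale V \<i> (invol V f)" using f by (simp add: invol_scale)
    then have "cscale V \<i> (re_part V (cscale V (- \<i>) f)) =
        cscale V (1 / 2) (cscale V \<i> (cscale V (- \<i>) f + cscale V \<i> (invol V f)))"
      by (simp add: re_part_def cscale_commute[of \<i>])
    also have "cscale V \<i> (cscale V (- \<i>) f + cscale V \<i> (invol V f)) =
        cscale V (\<i> * - \<i>) f + cscale V (\<i> * \<i>) (invol V f)" by (simp only: csD(6,8))
    finally show ?thesis by (simp add: csD)
  qed
  then have "re_part V f + cscale V \<i> (re_part V (cscale V (- \<i>) f)) =
      cscale V (1 / 2) (f + invol V f + (f + - invol V f))"
    by (simp only: re_part_def csD(6))
  also have "\<dots> = cscale V (1 / 2) (f + f)" by (simp add: algebra_simps)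
  finally show ?thesis by (simp add: cscale_half_double[OF cs])
qed

end

section \<open>Positive maps and the involution\<close>

lemma completely_positive_pos:
  assumes "completely_positive V W \<phi>" "pos V f"
  shows "pos W (\<phi> f)"
proof -
  have "map_mat \<phi> (mat1 f) \<in> mcone W"
    using assms mat1_in_mats[of f V] unfolding completely_positive_def pos_def by blast
  then show ?thesis
    using assms by (auto simp: pos_def map_mat_mat1 completely_positive_def linear_map_def)
qed

lemma linear_mapD:
  assumes V: "is_cspace V" and W: "is_cspace W" and \<phi>: "linear_map V W \<phi>" and x: "x \<in> carrier V"
  shows "\<phi> x \<in> carrier W" and "y \<in> carrier V \<Longrightarrow> \<phi> (x + y) = \<phi> x + \<phi> y"
    and "\<phi> (cscale V c x) = cscale W c (\<phi> x)"
    and "\<phi> (- x) = - \<phi> x" and "y \<in> carrier V \<Longrightarrow> \<phi> (x - y) = \<phi> x - \<phi> y"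
proof -
  show add: "\<phi> x \<in> carrier W" "y \<in> carrier V \<Longrightarrow> \<phi> (x + y) = \<phi> x + \<phi> y"
    "\<phi> (cscale V c x) = cscale W c (\<phi> x)" for y c
    using \<phi> x by (auto simp: linear_map_def)
  have neg: "\<phi> (- x) = - \<phi> x" if "x \<in> carrier V" for x
    using \<phi> that is_cspaceD(12)[OF V, of x] is_cspaceD(12)[OF W, of "\<phi> x"] by (metis linear_map_def)
  show "\<phi> (- x) = - \<phi> x" using x by (rule neg)
  show "\<phi> (x - y) = \<phi> x - \<phi> y" if "y \<in> carrier V"
    using add(2)[of "- y"] neg[OF that] that by (simp add: is_cspaceD[OF V])
qed

text \<open>A self-adjoint h is the difference of the positive elements r 1 + h and r 1, so its
  image is self-adjoint; the Cartesian decomposition extends this to all elements. Embeddings and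
  actions are defined through the cones alone, and this shows that they respect the
  involution.\<close>

lemma positive_map_invol:
  assumes V: "operator_system V" and W: "operator_system W" and \<phi>: "linear_map V W \<phi>"
    and pos: "\<And>f. pos V f \<Longrightarrow> pos W (\<phi> f)" and f: "f \<in> carrier V"
  shows "\<phi> (invol V f) = invol W (\<phi> f)"
proof -
  interpret V: opsystem_locale V by standard (rule V)
  interpret W: opsystem_locale W by standard (rule W)
  note L = linear_mapD[OF V.cs W.cs \<phi>]
  have sa: "invol W (\<phi> h) = \<phi> h" if h: "h \<in> carrier V" "invol V h = h" for h
  proof -
    obtain r where r: "r > 0" "pos V (runit V r + h)" using V.order_unit[OF h] by blast
    let ?p = "runit V r + h"
    have p: "?p \<in> carrier V" using r(2) by (rule V.pos_closed)
    have "h = ?p - runit V r" by simp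
    then have e: "\<phi> h = \<phi> ?p - \<phi> (runit V r)" using L(5)[OF p V.runit_closed] by metis
    have "invol W (\<phi> ?p) = \<phi> ?p" "invol W (\<phi> (runit V r)) = \<phi> (runit V r)"
      using W.pos_invol[OF pos] r V.pos_unit by auto
    moreover have "invol W (a - b) = invol W a - invol W b" if "a \<in> carrier W" "b \<in> carrier W" for a b
      using that W.invol_add[of "a - b" b] by (simp add: W.csD)
    ultimately show ?thesis unfolding e using L(1)[OF p] L(1)[OF V.runit_closed] by simp
  qed
  let ?h = "re_part V f" let ?k = "re_part V (cscale V (- \<i>) f)"
  have hk: "?h \<in> carrier V" "?k \<in> carrier V" "invol V ?h = ?h" "invol V ?k = ?k"
    using f by (simp_all add: V.re_part_closed V.invol_re_part V.csD)
  have d: "f = ?h + cscale V \<i> ?k" using f by (rule V.re_im_decomp)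
  have "\<phi> (invol V (?h + cscale V \<i> ?k)) = \<phi> ?h + cscale W (- \<i>) (\<phi> ?k)"
    using hk by (simp add: V.invol_add V.invol_scale V.csD L)
  also have "\<dots> = invol W (\<phi> (?h + cscale V \<i> ?k))"
    using hk by (simp add: W.invol_add W.invol_scale W.csD V.csD L sa)
  finally show ?thesis by (simp flip: d)
qed

lemma positive_map_re_part:
  assumes V: "operator_system V" and W: "operator_system W" and \<phi>: "linear_map V W \<phi>"
    and pos: "\<And>f. pos V f \<Longrightarrow> pos W (\<phi> f)" and f: "f \<in> carrier V"
  shows "\<phi> (re_part V f) = re_part W (\<phi> f)"
proof -
  interpret V: opsystem_locale V by standard (rule V)
  interpret W: opsystem_locale W by standard (rule W)
  note L = linear_mapD[OF V.cs W.cs \<phi>]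
  show ?thesis
    using f by (simp add: re_part_def L V.csD W.csD V.invol_closed positive_map_invol[OF assms])
qed

section \<open>Extension of positive functionals\<close>

text \<open>Closure of the sets M under sums and positive scaling gives one inequality in each case;
  scaling back by 1/t gives the reverse one for homogeneity. The factor 0 is not covered by this and
  rests on \<open>zero\<close>.\<close>

lemma sublinear_Inf:
  assumes F: "is_cspace F"
    and ne: "\<And>f. f \<in> carrier F \<Longrightarrow> M f \<noteq> {}"
    and bdd: "\<And>f. f \<in> carrier F \<Longrightarrow> bdd_below (M f)"
    and add: "\<And>f h s t. f \<in> carrier F \<Longrightarrow> h \<in> carrier F \<Longrightarrow> s \<in> M f \<Longrightarrow> t \<in> M h \<Longrightarrow> s + t \<in> M (f + h)"
    and scale: "\<And>f r s. f \<in> carrier F \<Longrightarrow> s \<in> M f \<Longrightarrow> 0 < r \<Longrightarrow> r * s \<in> M (cscale F (complex_of_real r) f)"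
    and zero: "Inf (M 0) = 0"
  shows "sublinear F (\<lambda>f. Inf (M f))"
  unfolding sublinear_def
proof (intro conjI ballI allI impI)
  note cs = is_cspaceD[OF F]
  fix f h assume f: "f \<in> carrier F" and h: "h \<in> carrier F"
  have "Inf (M (f + h)) - t \<le> Inf (M f)" if "t \<in> M h" for t
  proof (rule cInf_greatest[OF ne[OF f]])
    fix s assume "s \<in> M f"
    then have "Inf (M (f + h)) \<le> s + t" using that f h by (intro cInf_lower bdd cs add)
    then show "Inf (M (f + h)) - t \<le> s" by simp
  qed
  then have "Inf (M (f + h)) - Inf (M f) \<le> Inf (M h)"
    by (intro cInf_greatest[OF ne[OF h]]) (simp add: algebra_simps)
  then show "Inf (M (f + h)) \<le> Inf (M f) + Inf (M h)" by simp
next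
  note cs = is_cspaceD[OF F]
  have le: "Inf (M (cscale F (complex_of_real t) f)) \<le> t * Inf (M f)"
    if f: "f \<in> carrier F" and t: "t > 0" for f t
  proof -
    have "Inf (M (cscale F (complex_of_real t) f)) / t \<le> Inf (M f)"
    proof (rule cInf_greatest[OF ne[OF f]])
      fix s assume "s \<in> M f"
      then have "Inf (M (cscale F (complex_of_real t) f)) \<le> t * s" using f t by (intro cInf_lower bdd cs scale)
      then show "Inf (M (cscale F (complex_of_real t) f)) / t \<le> s" using t by (simp add: field_simps)
    qed
    then show ?thesis using t by (simp add: field_simps)
  qed
  fix f and t :: real assume f: "f \<in> carrier F" and t: "0 \<le> t"
  show "Inf (M (cscale F (complex_of_real t) f)) = t * Inf (M f)"
  proof (cases "t = 0")
    case True
    then show ?thesis using zero by (simp add: cs)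
  next
    case False
    then have t: "t > 0" using t by simp
    have "cscale F (complex_of_real (1 / t)) (cscale F (complex_of_real t) f) = f"
      using t cscale_inverse_cancel[OF F, of "1 / t" f] by simp
    then have "Inf (M f) \<le> 1 / t * Inf (M (cscale F (complex_of_real t) f))"
      using le[OF cs(3)[OF f], of "1 / t" "complex_of_real t"] t by simp
    then show ?thesis using le[OF f t] t by (simp add: field_simps)
  qed
qed

text \<open>The Hahn-Banach majorant is the infimum of the values \<open>r \<phi>(1)\<close> over all \<open>r\<close> with
  \<open>r 1 \<ge> Re f\<close>.\<close>
lemma positive_functional_extension:
  assumes E: "operator_system E" and F: "operator_system F"
    and \<iota>: "unital_complete_order_embedding E F \<iota>"
    and \<phi>: "linear_map E scalars \<phi>" and pos: "\<And>e. pos E e \<Longrightarrow> 0 \<le> \<phi> e"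
  obtains \<psi> where "linear_map F scalars \<psi>" "\<And>e. e \<in> carrier E \<Longrightarrow> \<psi> (\<iota> e) = \<phi> e"
    "\<And>f. pos F f \<Longrightarrow> 0 \<le> \<psi> f"
    "\<And>f r. f \<in> carrier F \<Longrightarrow> pos F (runit F r - re_part F f) \<Longrightarrow> Re (\<psi> f) \<le> r * Re (\<phi> (ounit E))"
proof -
  interpret E: opsystem_locale E by standard (rule E)
  interpret F: opsystem_locale F by standard (rule F)
  have lin: "linear_map E F \<iota>" using \<iota> by (simp add: unital_complete_order_embedding_def)
  note L = linear_mapD[OF E.cs F.cs lin]
  note P = linear_map_scalarsD[OF E.cs \<phi>]
  have ipos: "pos F (\<iota> e) \<longleftrightarrow> pos E e" if e: "e \<in> carrier E" for e
  proof -
    have "map_mat \<iota> (mat1 e) \<in> mcone F \<longleftrightarrow> mat1 e \<in> mcone E"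
      using \<iota> e mat1_in_mats[of e E] unfolding unital_complete_order_embedding_def by blast
    then show ?thesis using e L(1) by (simp add: pos_def map_mat_mat1)
  qed
  have ire: "\<iota> (re_part E e) = re_part F (\<iota> e)" if "e \<in> carrier E" for e
    using ipos E.pos_closed that by (intro positive_map_re_part[OF E F lin]) auto
  have iunit: "\<iota> (runit E r) = runit F r" for r
    using \<iota> L(3)[OF E.unit_closed] by (simp add: runit_def unital_complete_order_embedding_def)
  \<comment> \<open>For a positive functional the value at the unit plays the role of its
    norm.\<close>
  define c where "c = Re (\<phi> (ounit E))"
  have prunit: "\<phi> (runit E r) = complex_of_real r * \<phi> (ounit E)" for r
    using P(2)[OF E.unit_closed] by (simp add: runit_def)
  \<comment> \<open>No sign of r is presupposed. As \<iota> is unital and reflects positivity, r 1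
    is positive in E too, where \<phi> can be applied.\<close>
  have unit_nonneg: "0 \<le> r * c" if "pos F (runit F r)" for r
  proof -
    have "pos E (runit E r)" using that ipos[OF E.runit_closed] by (simp add: iunit)
    then have "0 \<le> \<phi> (runit E r)" by (rule pos)
    then show ?thesis by (simp add: prunit complex_ge_0_iff c_def)
  qed
  define M where "M f = {r * c | r. pos F (runit F r - re_part F f)}" for f
  have MI: "r * c \<in> M f" if "pos F (runit F r - re_part F f)" for r f using that by (auto simp: M_def)
  have bdd: "bdd_below (M f)" if f: "f \<in> carrier F" for f
  proof -
    obtain s where s: "pos F (runit F s + re_part F f)"
      using F.order_unit[OF F.re_part_closed[OF f] F.invol_re_part[OF f]] by blast
    have "- (s * c) \<le> r * c" if "pos F (runit F r - re_part F f)" for r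
    proof -
      \<comment> \<open>Adding r 1 \<ge> Re f and s 1 \<ge> - Re f leaves (r + s) 1 \<ge> 0.\<close>
      have "pos F ((runit F r - re_part F f) + (runit F s + re_part F f))" using that s by (rule F.pos_add)
      then have "pos F (runit F (r + s))" by (simp add: F.runit_add)
      then show ?thesis using unit_nonneg[of "r + s"] by (simp add: algebra_simps)
    qed
    then show ?thesis by (auto simp: M_def intro!: bdd_belowI)
  qed
  have ne: "M f \<noteq> {}" if f: "f \<in> carrier F" for f
  proof -
    have n: "- re_part F f = re_part F (- f)"
      using F.re_part_scale[OF f, of "- 1"] by (simp add: F.csD)
    have "\<exists>r>0. pos F (runit F r + - re_part F f)"
      unfolding n using f by (intro F.order_unit F.re_part_closed F.invol_re_part F.csD)
    then show ?thesis using MI by fastforce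
  qed
  have re0: "re_part F 0 = 0" using F.re_part_scale[OF F.csD(1), of 0] by (simp add: F.csD)
  have runit0: "runit F 0 = 0" by (simp add: runit_def F.csD)
  have Mle: "Inf (M f) \<le> r * c" if "f \<in> carrier F" "pos F (runit F r - re_part F f)" for f r
    using bdd[OF that(1)] MI[OF that(2)] by (intro cInf_lower)
  have sub: "sublinear F (\<lambda>f. Inf (M f))"
  proof (rule sublinear_Inf[OF F.cs ne bdd])
    fix f h s t assume f: "f \<in> carrier F" and h: "h \<in> carrier F" and "s \<in> M f" "t \<in> M h"
    then obtain a b where ab: "s = a * c" "pos F (runit F a - re_part F f)"
      "t = b * c" "pos F (runit F b - re_part F h)" by (auto simp: M_def)
    have "(runit F a - re_part F f) + (runit F b - re_part F h) = runit F (a + b) - re_part F (f + h)"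
      using f h by (simp add: F.runit_add F.re_part_add)
    then have "(a + b) * c \<in> M (f + h)" using F.pos_add[OF ab(2,4)] by (intro MI) simp
    then show "s + t \<in> M (f + h)" by (simp add: ab algebra_simps)
  next
    fix f and r s :: real assume f: "f \<in> carrier F" and "s \<in> M f" and r: "0 < r"
    then obtain a where a: "s = a * c" "pos F (runit F a - re_part F f)" by (auto simp: M_def)
    have "cscale F (complex_of_real r) (runit F a - re_part F f) =
        cscale F (complex_of_real r) (runit F a) - cscale F (complex_of_real r) (re_part F f)"
      using F.csD(6)[of _ "runit F a" "- re_part F f"] by (simp add: F.csD)
    also have "\<dots> = runit F (r * a) - re_part F (cscale F (complex_of_real r) f)"
      using f by (simp add: F.runit_scale F.re_part_scale)
    finally have "(r * a) * c \<in> M (cscale F (complex_of_real r) f)"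
      using F.pos_scale[OF a(2), of r] r by (intro MI) simp
    then show "r * s \<in> M (cscale F (complex_of_real r) f)" by (simp add: a mult.assoc)
  next
    show "Inf (M 0) = 0"
    proof (rule antisym)
      show "Inf (M 0) \<le> 0" using Mle[of 0 0] F.pos_zero by (simp add: F.csD re0 runit0)
      show "0 \<le> Inf (M 0)"
        by (rule cInf_greatest[OF ne[OF F.csD(1)]]) (auto simp: M_def re0 unit_nonneg)
    qed
  qed
  \<comment> \<open>A multiple of the unit that dominates Re (\<iota> e) in F dominates Re e already
    in E, because \<iota> reflects the order; there the positivity of \<phi> applies.\<close>
  have major: "Re (\<phi> e) \<le> Inf (M (\<iota> e))" if e: "e \<in> carrier E" for e
  proof (rule cInf_greatest[OF ne[OF L(1)[OF e]]])
    fix s assume "s \<in> M (\<iota> e)"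
    then obtain r where r: "s = r * c" "pos F (runit F r - re_part F (\<iota> e))" by (auto simp: M_def)
    have re: "re_part E e \<in> carrier E" using e by (rule E.re_part_closed)
    have d: "runit E r - re_part E e \<in> carrier E" using re by (intro E.csD E.runit_closed)
    have "\<iota> (runit E r - re_part E e) = runit F r - re_part F (\<iota> e)"
      using L(5)[OF E.runit_closed re] by (simp add: iunit ire[OF e])
    then have "pos E (runit E r - re_part E e)" using ipos[OF d] r(2) by simp
    then have "0 \<le> Re (\<phi> (runit E r - re_part E e))" using pos by (simp add: complex_ge_0_iff)
    then have le: "Re (\<phi> (re_part E e)) \<le> r * c"
      using P(4)[OF E.runit_closed re] by (simp add: prunit c_def)
    have sa_real: "Im (\<phi> h) = 0" if h: "h \<in> carrier E" "invol E h = h" for h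
    proof -
      obtain t where t: "t > 0" "pos E (runit E t + h)" using E.order_unit[OF h] by blast
      have "Im (\<phi> (runit E t + h)) = 0" "Im (\<phi> (runit E t)) = 0"
        using pos t E.pos_unit[of t] by (simp_all add: complex_ge_0_iff)
      then show ?thesis using P(1)[OF E.runit_closed h(1)] by simp
    qed
    let ?k = "re_part E (cscale E (- \<i>) e)"
    have k: "?k \<in> carrier E" "invol E ?k = ?k" using e by (simp_all add: E.re_part_closed E.invol_re_part E.csD)
    have "\<phi> e = \<phi> (re_part E e) + \<i> * \<phi> ?k"
      using P(1)[OF re E.csD(3)[OF k(1), of \<i>]] P(2)[OF k(1)] by (simp flip: E.re_im_decomp[OF e])
    then have "Re (\<phi> e) = Re (\<phi> (re_part E e))" using sa_real[OF k] by simp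
    then show "Re (\<phi> e) \<le> s" using le r(1) by simp
  qed
  obtain \<psi> where \<psi>: "linear_map F scalars \<psi>" "\<And>e. e \<in> carrier E \<Longrightarrow> \<psi> (\<iota> e) = \<phi> e"
    "\<And>f. f \<in> carrier F \<Longrightarrow> Re (\<psi> f) \<le> Inf (M f)"
    using complex_Hahn_Banach[OF E.cs F.cs lin \<phi> sub major] by blast
  have bound: "Re (\<psi> f) \<le> r * c" if "f \<in> carrier F" "pos F (runit F r - re_part F f)" for f r
    using \<psi>(3)[OF that(1)] Mle[OF that] by linarith
  note Q = linear_map_scalarsD[OF F.cs \<psi>(1)]
  \<comment> \<open>The multiple 0 of the unit dominates the self-adjoint parts of - f, i f and - i
    f, the last two being 0. The first test gives a nonnegative real part, the other two a vanishing
    imaginary part.\<close>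
  have "0 \<le> \<psi> f" if f: "pos F f" for f
  proof -
    have fc: "f \<in> carrier F" "invol F f = f" using f by (simp_all add: F.pos_closed F.pos_invol)
    have "re_part F (- f) = - f"
      using F.re_part_scale[OF fc(1), of "- 1"] F.re_part_self[OF fc(2)] by (simp add: F.csD)
    then have "Re (\<psi> (- f)) \<le> 0 * c" using f fc by (intro bound) (simp_all add: runit0 F.csD)
    moreover have im: "Re (\<psi> (cscale F z f)) \<le> 0 * c" if "Re z = 0" for z
      using fc that F.pos_zero
      by (intro bound) (simp_all add: runit0 F.csD F.re_part_imaginary)
    have "Re (\<psi> (cscale F \<i> f)) \<le> 0" "Re (\<psi> (cscale F (- \<i>) f)) \<le> 0" using im[of \<i>] im[of "- \<i>"] by simp_all
    ultimately show ?thesis using Q(2,3)[OF fc(1)] by (simp add: complex_ge_0_iff)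
  qed
  then show ?thesis using that[of \<psi>] \<psi>(1,2) bound by (simp add: c_def)
qed


section \<open>Injectivity among operator systems\<close>

lemma (in G_space_locale) G_injective_operator_system_C:
  assumes proj: "G_projective TYPE(('g \<times> 'x) set set) G X \<alpha>"
  shows "G_injective_operator_system TYPE('e::ab_group_add) TYPE('f::ab_group_add) G (C_opsystem X) (C_action G X \<alpha>)"
  unfolding G_injective_operator_system_def
proof (intro conjI allI impI)
  show "G_operator_system G (C_opsystem X) (C_action G X \<alpha>)" by (rule G_operator_system_C)
  fix E :: "'e opsystem" and \<gamma> and F :: "'f opsystem" and \<delta> \<iota> \<phi>
  assume E: "G_operator_system G E \<gamma>" and F: "G_operator_system G F \<delta>"
    and \<iota>: "unital_complete_order_embedding E F \<iota>" "equivariant_on G (carrier E) \<gamma> \<delta> \<iota>"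
    and \<phi>: "completely_positive E (C_opsystem X) \<phi>" "equivariant_on G (carrier E) \<gamma> (C_action G X \<alpha>) \<phi>"
  have os: "operator_system E" "operator_system F" using E F by (simp_all add: G_operator_system_def)
  interpret E: opsystem_locale E by standard (rule os)
  interpret F: opsystem_locale F by standard (rule os)
  have ga: "group_action G (carrier E) \<gamma>" "group_action G (carrier F) \<delta>"
    using E F by (simp_all add: G_operator_system_def)
  have emb: "unital_complete_order_embedding F F (\<delta> g)" if "g \<in> carrier G" for g
    using F that by (simp add: G_operator_system_def)
  have \<delta>_lin: "linear_map F F (\<delta> g)" if "g \<in> carrier G" for g
    using emb[OF that] by (simp add: unital_complete_order_embedding_def)
  have \<delta>_pos: "pos F (\<delta> g f)" if g: "g \<in> carrier G" and f: "pos F f" for g f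
  proof -
    have "completely_positive F F (\<delta> g)"
      using emb[OF g] by (simp add: unital_complete_order_embedding_def completely_positive_def)
    then show ?thesis using f by (rule completely_positive_pos)
  qed
  have \<delta>_unit: "\<delta> g (runit F r) = runit F r" if "g \<in> carrier G" for g r
    using emb[OF that] linear_mapD(3)[OF F.cs F.cs \<delta>_lin[OF that] F.unit_closed]
    by (simp add: runit_def unital_complete_order_embedding_def)
  have lin: "linear_map E F \<iota>" "linear_map E (C_opsystem X) \<phi>"
    using \<iota> \<phi> by (simp_all add: unital_complete_order_embedding_def completely_positive_def)
  have \<phi>_pos: "0 \<le> \<phi> e x" if e: "pos E e" and x: "x \<in> topspace X" for e x
  proof -
    have "pos (C_opsystem X) (\<phi> e)" using \<phi>(1) e by (rule completely_positive_pos)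
    then have "mat1 (\<phi> e) \<in> mcone (C_opsystem X)" "mat1 (\<phi> e) \<in> mats (C_opsystem X) (Suc 0)"
      by (simp_all add: pos_def)
    then have "0 \<le> sesq (Suc 0) (eval_mat x (mat1 (\<phi> e))) (\<lambda>_. 1) (\<lambda>_. 1)"
      using x mcone_C_iff by blast
    then show ?thesis by (simp add: sesq_def map_mat_mat1)
  qed
  have "\<forall>x\<in>topspace X. \<exists>\<omega>. linear_map F scalars \<omega> \<and> (\<forall>e\<in>carrier E. \<omega> (\<iota> e) = \<phi> e x) \<and>
      (\<forall>f. pos F f \<longrightarrow> 0 \<le> \<omega> f) \<and>
      (\<forall>f\<in>carrier F. \<forall>r. pos F (runit F r - re_part F f) \<longrightarrow> Re (\<omega> f) \<le> r * Re (\<phi> (ounit E) x))"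
    by (intro ballI, rule positive_functional_extension[OF os \<iota>(1) linear_map_eval[OF lin(2) C_opsystem_simps(1,2)]])
      (use \<phi>_pos in blast)+
  then obtain \<omega> where "\<forall>x\<in>topspace X. linear_map F scalars (\<omega> x) \<and>
      (\<forall>e\<in>carrier E. \<omega> x (\<iota> e) = \<phi> e x) \<and> (\<forall>f. pos F f \<longrightarrow> 0 \<le> \<omega> x f) \<and>
      (\<forall>f\<in>carrier F. \<forall>r. pos F (runit F r - re_part F f) \<longrightarrow> Re (\<omega> x f) \<le> r * Re (\<phi> (ounit E) x))"
    unfolding bchoice_iff by blast
  then have \<omega>: "\<And>x. x \<in> topspace X \<Longrightarrow> linear_map F scalars (\<omega> x)"
    "\<And>x e. x \<in> topspace X \<Longrightarrow> e \<in> carrier E \<Longrightarrow> \<omega> x (\<iota> e) = \<phi> e x"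
    "\<And>x f. x \<in> topspace X \<Longrightarrow> pos F f \<Longrightarrow> 0 \<le> \<omega> x f"
    "\<And>x f r. x \<in> topspace X \<Longrightarrow> f \<in> carrier F \<Longrightarrow> pos F (runit F r - re_part F f) \<Longrightarrow>
       Re (\<omega> x f) \<le> r * Re (\<phi> (ounit E) x)" by simp_all
  have "\<phi> (ounit E) \<in> C_carrier X" using lin(2) E.unit_closed by (auto simp: linear_map_def)
  \<comment> \<open>As \<phi> need not be unital, its value at the unit is a function of x;
    compactness of X provides a bound independent of x.\<close>
  then obtain K where K: "K \<ge> 0" "\<And>x. cmod (\<phi> (ounit E) x) \<le> K"
    using C_carrier_bounded[OF spcD(1)] by blast
  have \<delta>_closed: "\<delta> g f \<in> carrier F" if "g \<in> carrier G" "f \<in> carrier F" for g f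
    using group_action.element_image[OF ga(2) that] by simp
  \<comment> \<open>Each \<delta> g fixes the unit and preserves the order and the self-adjoint
    part, so a multiple of the unit that dominates Re f dominates the self-adjoint parts of all its
    translates.\<close>
  have re_bound: "\<exists>B. \<forall>g\<in>carrier G. \<forall>x\<in>topspace X. Re (\<omega> x (\<delta> g f)) \<le> B" if f: "f \<in> carrier F" for f
  proof -
    have n: "- re_part F f = re_part F (- f)"
      using F.re_part_scale[OF f, of "- 1"] by (simp add: F.csD)
    have "\<exists>r>0. pos F (runit F r + - re_part F f)"
      unfolding n using f by (intro F.order_unit F.re_part_closed F.invol_re_part F.csD)
    then obtain r where r: "r > 0" "pos F (runit F r - re_part F f)" by auto
    have "Re (\<omega> x (\<delta> g f)) \<le> r * K" if g: "g \<in> carrier G" and x: "x \<in> topspace X" for g x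
    proof -
      have "\<delta> g (runit F r - re_part F f) = runit F r - re_part F (\<delta> g f)"
        using linear_mapD(5)[OF F.cs F.cs \<delta>_lin[OF g] F.runit_closed F.re_part_closed[OF f]]
          positive_map_re_part[OF os(2,2) \<delta>_lin[OF g] \<delta>_pos[OF g] f] \<delta>_unit[OF g] by simp
      then have "pos F (runit F r - re_part F (\<delta> g f))" using \<delta>_pos[OF g r(2)] by simp
      then have "Re (\<omega> x (\<delta> g f)) \<le> r * Re (\<phi> (ounit E) x)" using \<omega>(4)[OF x \<delta>_closed[OF g f]] by blast
      also have "\<dots> \<le> r * K"
        using r(1) K(2)[of x] complex_Re_le_cmod[of "\<phi> (ounit E) x"] by (intro mult_left_mono) auto
      finally show ?thesis .
    qed
    then show ?thesis by blast
  qed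
  have ex: "\<exists>B. \<forall>g\<in>carrier G. \<forall>x\<in>topspace X. cmod (\<omega> x (\<delta> g f)) \<le> B" if f: "f \<in> carrier F" for f
  proof -
    \<comment> \<open>The one-sided bound on real parts, applied to c f for c = 1, -1, i and - i,
      bounds the real and imaginary parts from both sides.\<close>
    have "\<exists>B. \<forall>g\<in>carrier G. \<forall>x\<in>topspace X. Re (c * \<omega> x (\<delta> g f)) \<le> B" for c
    proof -
      have "c * \<omega> x (\<delta> g f) = \<omega> x (\<delta> g (cscale F c f))" if "g \<in> carrier G" "x \<in> topspace X" for g x
        using linear_mapD(3)[OF F.cs F.cs \<delta>_lin[OF that(1)] f]
          linear_map_scalarsD(2)[OF F.cs \<omega>(1)[OF that(2)] \<delta>_closed[OF that(1) f]] by simp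
      then show ?thesis using re_bound[OF F.csD(3)[OF f]] by simp
    qed
    then obtain B where B: "\<And>c g x. g \<in> carrier G \<Longrightarrow> x \<in> topspace X \<Longrightarrow> Re (c * \<omega> x (\<delta> g f)) \<le> B c" by metis
    have "cmod (\<omega> x (\<delta> g f)) \<le> max (B 1) (B (- 1)) + max (B \<i>) (B (- \<i>))"
      if "g \<in> carrier G" "x \<in> topspace X" for g x
      using cmod_le[of "\<omega> x (\<delta> g f)"] B[OF that, of 1] B[OF that, of "- 1"] B[OF that, of \<i>] B[OF that, of "- \<i>"]
      by simp
    then show ?thesis by blast
  qed
  obtain \<psi> where \<psi>: "linear_map F (C_opsystem X) \<psi>" "equivariant_on G (carrier F) \<delta> (C_action G X \<alpha>) \<psi>"
    "\<forall>e\<in>carrier E. \<psi> (\<iota> e) = \<phi> e"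
    "\<forall>f\<in>carrier F. \<forall>S. closed S \<longrightarrow> (\<forall>g\<in>carrier G. \<forall>x\<in>topspace X. \<omega> x (\<delta> g f) \<in> S) \<longrightarrow>
       (\<forall>y\<in>topspace X. \<psi> f y \<in> S)"
    using equivariant_extension[OF proj C_opsystem_simps(1,2) F.cs ga(2) \<delta>_lin ga(1) lin(1) \<iota>(2) lin(2) \<phi>(2) \<omega>(1,2) ex]
    by blast
  have \<psi>_pos: "0 \<le> \<psi> f y" if f: "pos F f" and y: "y \<in> topspace X" for f y
  proof -
    \<comment> \<open>In the order of the complex numbers this set is the real half-line.\<close>
    have cl: "closed {z::complex. 0 \<le> z}"
      unfolding complex_ge_0_iff by (intro closed_Collect_conj closed_Collect_le closed_Collect_eq continuous_intros)
    have "\<psi> f y \<in> {z. 0 \<le> z}"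
      by (rule \<psi>(4)[rule_format, OF F.pos_closed[OF f] cl _ y]) (simp add: \<omega>(3) \<delta>_pos[OF _ f])
    then show ?thesis by simp
  qed
  have "map_mat \<psi> a \<in> mcone (C_opsystem X)" if a: "a \<in> mats F n" "a \<in> mcone F" for n a
  proof -
    have ac: "a \<in> carrier_mat n n" using a(1) by (simp add: mats_iff)
    have m: "map_mat \<psi> a \<in> mats (C_opsystem X) n" using a(1) \<psi>(1) by (auto simp: mats_iff linear_map_def)
    have "0 \<le> sesq n (eval_mat y (map_mat \<psi> a)) v v" if y: "y \<in> topspace X" for y v
    proof -
      \<comment> \<open>The congruence of a by the column v is a positive 1 x 1 matrix, and \<psi>
        at y sends its entry to the quadratic form of the image matrix at v. This is why positivity
        on single elements carries over to all matrix levels.\<close>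
      let ?c = "Matrix.mat n 1 (\<lambda>(i, _). v i)"
      let ?s = "\<Sum>k<n. \<Sum>l<n. cscale F (mat_adjoint ?c $$ (0, k) * ?c $$ (l, 0)) (a $$ (k, l))"
      note lin_y = linear_map_eval[OF \<psi>(1) C_opsystem_simps(1,2), where x = y]
      have adj: "mat_adjoint ?c \<in> carrier_mat 1 n" by (auto simp: mat_adjoint_def)
      have entry: "mat_adjoint ?c $$ (0, k) = cnj (v k)" if "k < n" for k
        using that by (simp add: mat_adjoint_def mat_of_rows_def)
      have "sandwich F (mat_adjoint ?c) a ?c \<in> mcone F"
        using F.mo a unfolding matrix_ordered_def by (metis (no_types, lifting) IntI mat_carrier)
      then have "pos F ?s"
        using linear_map_sandwich(1)[OF F.cs lin_y a(1)] sandwich_mat1[OF adj _ ac, of ?c F] by (simp add: pos_def)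
      then have "0 \<le> \<psi> ?s y" using y by (rule \<psi>_pos)
      also have "\<psi> ?s y = (\<Sum>k<n. \<Sum>l<n. (mat_adjoint ?c $$ (0, k) * ?c $$ (l, 0)) * \<psi> (a $$ (k, l)) y)"
        by (rule linear_map_sandwich(2)[OF F.cs lin_y a(1)])
      also have "\<dots> = sesq n (eval_mat y (map_mat \<psi> a)) v v"
        unfolding sesq_def using ac by (intro sum.cong refl) (simp add: entry[unfolded One_nat_def])
      finally show ?thesis .
    qed
    then show ?thesis by (simp add: mcone_C_iff[OF m])
  qed
  then show "\<exists>\<psi>. completely_positive F (C_opsystem X) \<psi> \<and> equivariant_on G (carrier F) \<delta> (C_action G X \<alpha>) \<psi> \<and>
      (\<forall>x\<in>carrier E. \<psi> (\<iota> x) = \<phi> x)"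
    using \<psi>(1-3) by (auto simp: completely_positive_def)
qed

theorem proposition3p6:
  fixes G :: "('g, 'm) monoid_scheme"
    and X :: "'x topology"
    and \<alpha> :: "'g \<Rightarrow> 'x \<Rightarrow> 'x"
  assumes "group G"
    and "G_projective TYPE(('g \<times> 'x) set set) G X \<alpha>"
  shows "G_injective_operator_space TYPE('e::ab_group_add) TYPE('f::ab_group_add) G
           (C_opspace X) (C_action G X \<alpha>) \<and>
         G_injective_operator_system TYPE('e) TYPE('f) G
           (C_opsystem X) (C_action G X \<alpha>) \<and>
         G_injective_banach_space TYPE('e) TYPE('f) G
           (C_banach X) (C_action G X \<alpha>)"
proof -
  interpret G_space_locale G X \<alpha>
    using assms by (simp add: G_space_locale_def G_projective_def)
  show ?thesis
    using G_injective_operator_space_C[OF assms(2)] G_injective_operator_system_C[OF assms(2)]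
      G_injective_banach_space_C[OF assms(2)] by blast
qed

end
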